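(* Let $n$ be an even positive integer and let $\mathcal{V}^d(t)$ be the component of largest diameter of the excursion set $\mathcal{U}(t)=\{x\in\mathcal{S}^2:f_n(x)\le t\}$ of Kostlan's ensemble $f_n$. Then for every $t\in\mathbb{R}$ and $\epsilon>0$ there exists a number $c=c(t,\epsilon)>0$ (not depending on $n$) such that $$\Pr(\mathcal{V}^d(t)=\mathcal{S}^2)\ge\exp(-cn)\qquad\text{and}\qquad\Pr(\operatorname{Area}(\mathcal{V}^d(t))<\epsilon)\ge\exp(-cn^{1/2}).$$
   Context: $\mathcal{S}^2\subset\mathbb{R}^3$ is the unit sphere with its spherical distance and surface area $\operatorname{Area}$. Kostlan's ensemble is $$f_n(x)=\sum_{|J|=n}\sqrt{\binom nJ}\,a_Jx^J,\quad J=(j_0,j_1,j_2)\in\mathbb{Z}_{\ge0}^3,$$ with $\binom nJ=\frac{n!}{j_0!j_1!j_2!}$, $x^J=x_0^{j_0}x_1^{j_1}x_2^{j_2}$, and $a_J$ i.i.d. standard Gaussians, restricted to $\mathcal{S}^2$; its covariance is $\langle x,y\rangle^n$. Components are connected components; diameters are with respect to the spherical distance. If $\mathcal{U}(t)$ is empty, $\mathcal{V}^d(t)$ is empty and has area $0$. *)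

theory Defs
  imports "HOL-Probability.Probability"
begin

abbreviation S2 :: "(real^3) set" where
  "S2 \<equiv> sphere 0 1"

definition sph_dist :: "real^3 \<Rightarrow> real^3 \<Rightarrow> real" where
  "sph_dist x y = arccos (x \<bullet> y)"

definition sph_diameter :: "(real^3) set \<Rightarrow> real" where
  "sph_diameter A = (if A = {} then 0 else SUP (x, y)\<in>A \<times> A. sph_dist x y)"

(* Surface area via the solid cone over A: in polar coordinates the cone has
   volume (integral of r^2 over [0,1]) * Area A = Area A / 3. *)
definition sph_area :: "(real^3) set \<Rightarrow> real" where
  "sph_area A = 3 * measure lebesgue {r *\<^sub>R x | r x. 0 \<le> r \<and> r \<le> 1 \<and> x \<in> A}"

lemma sph_area_S2: "sph_area S2 = 4 * pi"
proof -
  have "x \<in> {r *\<^sub>R y | r y. 0 \<le> r \<and> r \<le> 1 \<and> y \<in> S2}" if "x \<in> cball 0 1" for x :: "real^3"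
  proof (cases "x = 0")
    case True
    then have "x = 0 *\<^sub>R axis 1 1 \<and> (0::real) \<le> 0 \<and> (0::real) \<le> 1 \<and> (axis 1 1 :: real^3) \<in> S2"
      by (simp add: norm_axis_1)
    then show ?thesis by blast
  next
    case False
    then have "x = norm x *\<^sub>R (x /\<^sub>R norm x) \<and> 0 \<le> norm x \<and> norm x \<le> 1 \<and> x /\<^sub>R norm x \<in> S2"
      using that by simp
    then show ?thesis by blast
  qed
  then have "{r *\<^sub>R x | r x. 0 \<le> r \<and> r \<le> 1 \<and> x \<in> S2} = cball (0 :: real^3) 1"
    by (intro subset_antisym subsetI) (fastforce, blast)
  moreover have "measure lebesgue (cball (0 :: real^3) 1) = unit_ball_vol 3"
    using content_cball[of 1 "0 :: real^3"] by (simp add: measure_completion)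
  ultimately show ?thesis
    by (simp add: sph_area_def unit_ball_vol_3)
qed

(* Multi-indices J = (j_0, j_1, j_2) and coordinates (x_0, x_1, x_2) are both indexed by
   the three-element type 3; nothing below depends on the names of the three indices. *)
definition multi_indices :: "nat \<Rightarrow> (nat^3) set" where
  "multi_indices n = {J. (\<Sum>i\<in>UNIV. J $ i) = n}"

lemma finite_multi_indices: "finite (multi_indices n)"
proof (rule finite_subset)
  show "multi_indices n \<subseteq> {J. \<forall>i. J $ i \<in> {..n}}"
    by (auto simp: multi_indices_def intro: member_le_sum)
  have "finite (vec_lambda ` (UNIV \<rightarrow>\<^sub>E {..n}) :: (nat^3) set)"
    by (intro finite_imageI finite_PiE) auto
  moreover have "{J :: nat^3. \<forall>i. J $ i \<in> {..n}} \<subseteq> vec_lambda ` (UNIV \<rightarrow>\<^sub>E {..n})"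
  proof
    fix J :: "nat^3" assume "J \<in> {J. \<forall>i. J $ i \<in> {..n}}"
    then have "vec_nth J \<in> UNIV \<rightarrow>\<^sub>E {..n}" by auto
    then have "vec_lambda (vec_nth J) \<in> vec_lambda ` (UNIV \<rightarrow>\<^sub>E {..n})" by (rule imageI)
    then show "J \<in> vec_lambda ` (UNIV \<rightarrow>\<^sub>E {..n})" by simp
  qed
  ultimately show "finite {J :: nat^3. \<forall>i. J $ i \<in> {..n}}"
    using finite_subset by blast
qed

definition multinomial :: "nat \<Rightarrow> nat^3 \<Rightarrow> real" where
  "multinomial n J = fact n / (\<Prod>i\<in>UNIV. fact (J $ i))"

definition kostlan :: "nat \<Rightarrow> (nat^3 \<Rightarrow> real) \<Rightarrow> real^3 \<Rightarrow> real" where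
  "kostlan n a x =
     (\<Sum>J\<in>multi_indices n. sqrt (multinomial n J) * a J * (\<Prod>i\<in>UNIV. (x $ i) ^ (J $ i)))"

definition kostlan_coeffs :: "nat \<Rightarrow> 'w measure \<Rightarrow> (nat^3 \<Rightarrow> 'w \<Rightarrow> real) \<Rightarrow> bool" where
  "kostlan_coeffs n M a \<longleftrightarrow>
     prob_space M \<and>
     prob_space.indep_vars M (\<lambda>_. borel) a (multi_indices n) \<and>
     (\<forall>J\<in>multi_indices n. distributed M lborel (a J) std_normal_density)"

definition excursion :: "nat \<Rightarrow> (nat^3 \<Rightarrow> real) \<Rightarrow> real \<Rightarrow> (real^3) set" where
  "excursion n a t = {x \<in> S2. kostlan n a x \<le> t}"

(* All candidates for "the" component of largest diameter. It need not be unique: for even n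
   the excursion set is invariant under x -> -x, so a component disjoint from its antipodal
   image always ties with that image. The empty set is its own (empty) largest component. *)
definition largest_components :: "(real^3) set \<Rightarrow> (real^3) set set" where
  "largest_components U =
     (if U = {} then {{}}
      else {V \<in> components U. \<forall>W\<in>components U. sph_diameter W \<le> sph_diameter V})"

lemma continuous_kostlan: "continuous_on A (kostlan n a)"
  unfolding kostlan_def by (intro continuous_intros)

lemma compact_excursion: "compact (excursion n a t)"
proof -
  have "closed {x. kostlan n a x \<le> t}"
    by (intro closed_Collect_le continuous_kostlan continuous_on_const)
  then have "compact (S2 \<inter> {x. kostlan n a x \<le> t})"
    by (intro compact_Int_closed) auto
  then show ?thesis
    by (simp add: excursion_def Int_def)
qed

lemma abs_inner_S2: "x \<in> S2 \<Longrightarrow> y \<in> S2 \<Longrightarrow> \<bar>x \<bullet> y\<bar> \<le> 1"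
  using Cauchy_Schwarz_ineq2[of x y] by simp

lemma continuous_sph_dist: "continuous_on (S2 \<times> S2) (\<lambda>(x, y). sph_dist x y)"
proof -
  have "-1 \<le> fst p \<bullet> snd p \<and> fst p \<bullet> snd p \<le> 1" if "p \<in> S2 \<times> S2" for p
    using abs_inner_S2[of "fst p" "snd p"] that by (auto simp: abs_le_iff)
  then have "continuous_on (S2 \<times> S2) (\<lambda>p. arccos (fst p \<bullet> snd p))"
    by (intro continuous_intros) auto
  then show ?thesis
    by (simp add: sph_dist_def case_prod_unfold)
qed

lemma bdd_above_sph_dist:
  assumes "A \<subseteq> S2"
  shows "bdd_above ((\<lambda>(x, y). sph_dist x y) ` (A \<times> A))"
proof (rule bdd_aboveI[of _ pi])
  fix z assume "z \<in> (\<lambda>(x, y). sph_dist x y) ` (A \<times> A)"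
  then obtain x y where "x \<in> A" "y \<in> A" "z = arccos (x \<bullet> y)"
    by (auto simp: sph_dist_def)
  moreover from this have "\<bar>x \<bullet> y\<bar> \<le> 1"
    using abs_inner_S2 assms by blast
  ultimately show "z \<le> pi"
    by (simp add: arccos_ubound abs_le_iff)
qed

(* A largest component always exists, so quantifying over all of them is never vacuous. *)
lemma largest_components_nonempty:
  assumes "compact U" "U \<subseteq> S2"
  shows "largest_components U \<noteq> {}"
proof (cases "U = {}")
  case True
  then show ?thesis by (simp add: largest_components_def)
next
  case False
  define R where "R = {(x, y). x \<in> U \<and> y \<in> U \<and> connected_component U x y}"
  have R_sub: "R \<subseteq> U \<times> U"
    by (auto simp: R_def)
  have "closed R"
    unfolding closed_sequential_limits
  proof (intro allI impI, elim conjE)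
    fix s :: "nat \<Rightarrow> (real^3) \<times> (real^3)" and l
    assume s: "\<forall>n. s n \<in> R" and l: "s \<longlonglongrightarrow> l"
    obtain x y where xy: "l = (x, y)" by fastforce
    have "closed (U \<times> U)"
      using assms(1) by (simp add: closed_Times compact_imp_closed)
    then have "l \<in> U \<times> U"
      by (rule closed_sequentially[OF _ _ l]) (use s R_sub in blast)
    then have U: "x \<in> U" "y \<in> U" using xy by auto
    have lx: "(\<lambda>n. fst (s n)) \<longlonglongrightarrow> x" and ly: "(\<lambda>n. snd (s n)) \<longlonglongrightarrow> y"
      using tendsto_fst[OF l] tendsto_snd[OF l] xy by auto
    define C where "C = connected_component_set U x"
    have C: "C \<in> components U"
      using U by (auto simp: C_def components_def)
    have "y \<in> T" if T: "C \<subseteq> T" "openin (top_of_set U) T" "closedin (top_of_set U) T" for T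
    proof -
      have "x \<in> T"
        using T(1) U(1) by (auto simp: C_def)
      obtain V where V: "open V" "T = U \<inter> V"
        using T(2) by (auto simp: openin_open)
      have "\<forall>\<^sub>F n in sequentially. fst (s n) \<in> V"
        using topological_tendstoD[OF lx V(1)] V(2) \<open>x \<in> T\<close> by simp
      moreover have "snd (s n) \<in> T" if "fst (s n) \<in> V" for n
      proof -
        obtain K where K: "connected K" "K \<subseteq> U" "fst (s n) \<in> K" "snd (s n) \<in> K"
          using s by (auto simp: R_def connected_component_def case_prod_unfold)
        have "K \<inter> T \<noteq> {}" using K V that by auto
        moreover have "openin (top_of_set K) (K \<inter> T)"
          using V K(2) by (auto simp: openin_open)
        moreover have "closedin (top_of_set K) (K \<inter> T)"
        proof -
          obtain Z where "closed Z" "T = U \<inter> Z"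
            using T(3) by (auto simp: closedin_closed)
          then show ?thesis
            using K(2) by (auto simp: closedin_closed)
        qed
        ultimately have "K \<inter> T = K"
          using K(1)[unfolded connected_clopen, rule_format, of "K \<inter> T"] by simp
        then show ?thesis using K(4) by blast
      qed
      ultimately have "\<forall>\<^sub>F n in sequentially. snd (s n) \<in> T"
        by (auto elim: eventually_mono)
      moreover have "closed T"
        using compact_imp_closed[OF closedin_compact[OF assms(1) T(3)]] .
      ultimately show "y \<in> T"
        using Lim_in_closed_set[OF _ _ sequentially_bot ly] by simp
    qed
    then have "y \<in> C"
      using Sura_Bura_compact[OF assms(1) C] by blast
    then show "l \<in> R"
      using U xy by (simp add: R_def C_def)
  qed
  then have "compact R"
    using compact_Int_closed[OF compact_Times[OF assms(1) assms(1)]] R_sub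
    by (metis inf.absorb_iff2)
  moreover have "R \<noteq> {}"
  proof -
    obtain x where "x \<in> U" using False by blast
    then have "(x, x) \<in> R" by (simp add: R_def)
    then show ?thesis by blast
  qed
  moreover have "continuous_on R (\<lambda>(x, y). sph_dist x y)"
    using continuous_on_subset[OF continuous_sph_dist] R_sub assms(2) by blast
  ultimately obtain p where p: "p \<in> R" "\<forall>q\<in>R. (\<lambda>(x, y). sph_dist x y) q \<le> (\<lambda>(x, y). sph_dist x y) p"
    using continuous_attains_sup[of R "\<lambda>(x, y). sph_dist x y"] by blast
  obtain x y where xy: "p = (x, y)" by fastforce
  define V where "V = connected_component_set U x"
  have V: "V \<in> components U" "x \<in> V" "y \<in> V" "V \<subseteq> U"
    using p(1) xy connected_component_subset by (auto simp: R_def V_def components_def)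
  have "sph_diameter W \<le> sph_diameter V" if W: "W \<in> components U" for W
  proof -
    have ne: "W \<noteq> {}" using W in_components_nonempty by blast
    have "sph_diameter W = (SUP (x, y)\<in>W \<times> W. sph_dist x y)"
      using ne by (simp add: sph_diameter_def)
    also have "\<dots> \<le> sph_dist x y"
    proof (rule cSUP_least)
      show "W \<times> W \<noteq> {}" using ne by simp
      fix q assume "q \<in> W \<times> W"
      then have "q \<in> R"
        using in_components_connected[OF W] in_components_subset[OF W]
        by (auto simp: R_def connected_component_def)
      then show "(\<lambda>(x, y). sph_dist x y) q \<le> sph_dist x y"
        using p(2) xy by auto
    qed
    also have "\<dots> \<le> (SUP (x, y)\<in>V \<times> V. sph_dist x y)"
      using cSUP_upper[OF _ bdd_above_sph_dist[of V], of "(x, y)"] V assms(2) by auto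
    also have "\<dots> = sph_diameter V"
      using V by (auto simp: sph_diameter_def)
    finally show ?thesis .
  qed
  then show ?thesis
    using V(1) False by (auto simp: largest_components_def)
qed

end

theory Submission
  imports Defs
begin

text \<open>
Both probabilities come from one estimate: on a set \<open>E\<close> of the sphere that is covered by caps of
radius of order \<open>n powr (-1/2)\<close> around the points of a separated finite set \<open>P \<subseteq> E\<close>, the field stays
beyond any prescribed level with probability at least \<open>exp (- K * card P)\<close>, where \<open>K\<close> does not depend
on \<open>n\<close> (\<open>prob_kostlan_beyond_ge\<close>). The scale \<open>n powr (-1/2)\<close> is the correlation length of the
covariance \<open>(x \<bullet> y) ^ n\<close>. For the first probability \<open>E\<close> is the sphere, which needs of the order of
\<open>n\<close> caps, and \<open>- f\<close> is pushed above a high level, so that the excursion set is the whole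
connected sphere. For the second one \<open>E\<close> is the union of the circles on which some coordinate is a
multiple of \<open>1 / L\<close>, which needs only of the order of \<open>sqrt n\<close> caps, and \<open>f\<close> is pushed above \<open>t\<close>.
Every component of the excursion set then avoids these circles, hence lies in a cube of side \<open>1 / L\<close>
and has small area, whichever component has the largest diameter.

The estimate on \<open>E\<close> has two steps. The field is first shown to be bounded by a constant on \<open>E\<close>
with probability at least \<open>exp (- 8 * card P)\<close>. Then the coefficients are shifted by a multiple of the
vector that represents \<open>\<Sum>p\<in>P. (x \<bullet> p) ^ n\<close>. As \<open>n\<close> is even, this function is nonnegative, and it is at
least \<open>1 / 2\<close> on \<open>E\<close>; the square of the norm of the vector is at most of the order of \<open>card P\<close>, because the points
of \<open>P\<close> are separated. So the Gaussian shift formula loses only another factor \<open>exp (- K * card P)\<close>.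

For the bound by a constant, the field near \<open>p\<close> is expanded into monomials in the
coordinates of the tangent plane at \<open>p\<close>, measured in units of \<open>n powr (-1/2)\<close>. The coefficients of all these
expansions (the jets) are finitely many jointly Gaussian variables. Their covariances are bounded by a
constant times a Gaussian profile of the distance from one base point to the other or to its antipode, so
that after weighting the
degree \<open>k\<close> by \<open>4 powr (- k)\<close> the covariance matrix is dominated by a diagonal matrix with geometrically
decreasing entries (\<open>jet_combination_variance_le\<close>). A Gaussian vector whose covariance is dominated by a
diagonal matrix is at least as likely to be small as the bounds for independent variables predict
(\<open>prob_all_small_ge\<close>): the tent function \<open>max 0 (1 - \<bar>x\<bar>)\<close> is dominated by the indicator of \<open>{-1..1}\<close> and
is a mixture of cosines with nonnegative weights, the expectation of a product of such functions is
therefore an average of values \<open>exp (- v / 2)\<close> with \<open>v\<close> the variance of a linear combination, and this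
average decreases when the covariance increases.

Finally the second event has to be measurable. If coefficient vectors converge, components of their
excursion sets accumulate only inside a component of the limiting excursion set. Hence diameter and
area of components are upper semicontinuous, and the event is a countable combination of closed
conditions on the coefficients (\<open>component_limit\<close>, \<open>all_largest_components_small_iff\<close>).
\<close>

section \<open>The tent function as a mixture of cosines\<close>

text \<open>The Fourier transform of the tent function, up to a constant factor.\<close>

definition fejer :: "real \<Rightarrow> real" where
  "fejer l = (1 - cos l) / l\<^sup>2"

lemma fejer_nonneg: "fejer l \<ge> 0"
  by (simp add: fejer_def)

lemma borel_measurable_fejer [measurable]: "fejer \<in> borel_measurable borel"
  unfolding fejer_def by measurable

lemma integrable_inverse_one_plus_square: "integrable lborel (\<lambda>x::real. 1 / (1 + x\<^sup>2))"
proof -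
  have p: "set_integrable lborel {0<..} (\<lambda>x::real. 1 / (1 + x\<^sup>2))"
    using integrable_I0i_1_div_plus_square by (simp add: set_integrable_def interval_lebesgue_integrable_def einterval_def greaterThan_def)
  have n: "set_integrable lborel {..<0} (\<lambda>x::real. 1 / (1 + x\<^sup>2))"
  proof -
    have "integrable lborel (\<lambda>x. indicat_real {0<..} (- x) * (1 / (1 + x\<^sup>2)))"
      using lborel_integrable_real_affine[OF p[unfolded set_integrable_def], of "-1" 0] by (simp add: scaleR_conv_of_real)
    moreover have "indicat_real {0<..} (- x) = indicat_real {..<0} x" for x :: real
      by (auto simp: indicator_def)
    ultimately show ?thesis by (simp add: set_integrable_def)
  qed
  have "indicat_real {0} x *\<^sub>R (1 / (1 + x\<^sup>2)) = indicat_real {0} x" for x :: real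
    by (auto simp: indicator_def)
  then have z: "set_integrable lborel {0} (\<lambda>x::real. 1 / (1 + x\<^sup>2))"
    unfolding set_integrable_def by simp
  have "set_integrable lborel ({0<..} \<union> {..<0} \<union> {0}) (\<lambda>x::real. 1 / (1 + x\<^sup>2))"
    by (intro set_integrable_Un p n z) auto
  moreover have "({0<..} \<union> {..<0} \<union> {0::real}) = UNIV" by auto
  ultimately show ?thesis by (simp add: set_integrable_def)
qed

lemma one_minus_cos_le: "1 - cos (u::real) \<le> u\<^sup>2 / 2"
proof -
  have "1 - cos u = 2 * (sin (u / 2))\<^sup>2"
    using cos_double_sin[of "u/2"] by simp
  also have "\<dots> \<le> 2 * (u / 2)\<^sup>2"
    by (intro mult_left_mono abs_le_square_iff[THEN iffD1] abs_sin_x_le_abs_x) auto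
  finally show ?thesis by (simp add: power2_eq_square)
qed

lemma fejer_le: "fejer u \<le> 4 * (1 / (1 + u\<^sup>2))"
proof (cases "u = 0")
  case False
  then have u: "u\<^sup>2 > 0" by simp
  have "(1 - cos u) * (1 + u\<^sup>2) \<le> 4 * u\<^sup>2"
  proof (cases "u\<^sup>2 \<le> 1")
    case True
    have "(1 - cos u) * (1 + u\<^sup>2) \<le> (u\<^sup>2/2) * 2"
      by (intro mult_mono one_minus_cos_le) (use True in auto)
    then show ?thesis using u by linarith
  next
    case False
    have "(1 - cos u) * (1 + u\<^sup>2) \<le> 2 * (1 + u\<^sup>2)"
      by (intro mult_right_mono) (use cos_ge_minus_one[of u] in linarith, simp)
    also have "\<dots> \<le> 4 * u\<^sup>2" using False by simp
    finally show ?thesis .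
  qed
  moreover have pos: "1 + u\<^sup>2 > 0" by (intro add_pos_nonneg) auto
  ultimately show ?thesis
    by (simp add: fejer_def pos_divide_le_eq[OF u] pos_le_divide_eq[OF pos])
qed (simp add: fejer_def)

lemma integrable_fejer: "integrable lborel fejer"
  by (rule Bochner_Integration.integrable_bound[OF integrable_mult_right[OF integrable_inverse_one_plus_square, of 4]])
     (use fejer_le fejer_nonneg in \<open>auto intro!: AE_I2\<close>)

definition fejer_mass :: real where
  "fejer_mass = (\<integral>l. fejer l \<partial>lborel)"

text \<open>The substitution \<open>l \<mapsto> x * l\<close> reduces the integral to the case \<open>x = 1\<close>, which defines \<open>fejer_mass\<close>.\<close>

lemma integral_one_minus_cos:
  "has_bochner_integral lborel (\<lambda>l. (1 - cos (l * x)) / l\<^sup>2) (fejer_mass * \<bar>x\<bar>)"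
proof (cases "x = 0")
  case False
  have "has_bochner_integral lborel fejer fejer_mass"
    by (simp add: fejer_mass_def has_bochner_integral_iff integrable_fejer)
  then have "has_bochner_integral lborel (\<lambda>l. fejer (0 + x * l)) (fejer_mass /\<^sub>R \<bar>x\<bar>)"
    using lborel_has_bochner_integral_real_affine_iff[OF False] by blast
  then have "has_bochner_integral lborel (\<lambda>l. x\<^sup>2 * fejer (0 + x * l)) (x\<^sup>2 * (fejer_mass /\<^sub>R \<bar>x\<bar>))"
    by (intro has_bochner_integral_mult_right) auto
  moreover have "x\<^sup>2 * fejer (0 + x * l) = (1 - cos (l * x)) / l\<^sup>2" for l
    using False by (simp add: fejer_def power_mult_distrib mult.commute)
  moreover have "x\<^sup>2 * (fejer_mass /\<^sub>R \<bar>x\<bar>) = fejer_mass * \<bar>x\<bar>"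
    using False by (cases "x > 0") (simp_all add: divide_simps power2_eq_square)
  ultimately show ?thesis by (simp only:)
qed (simp add: has_bochner_integral_zero)

definition tent :: "real \<Rightarrow> real" where
  "tent x = max 0 (1 - \<bar>x\<bar>)"

text \<open>The product formula turns \<open>cos (l * x) * (1 - cos l)\<close> into a combination of three terms
\<open>1 - cos (l * y)\<close> with \<open>y = x + 1\<close>, \<open>x - 1\<close> and \<open>x\<close>, and the second difference of \<open>\<bar>x\<bar>\<close> is the tent.\<close>

lemma integral_cos_fejer:
  "has_bochner_integral lborel (\<lambda>l. cos (l * x) * fejer l) (fejer_mass * tent x)"
proof -
  have "has_bochner_integral lborel
     (\<lambda>l. (1 - cos (l * (x+1))) / l\<^sup>2 * (1/2) + (1 - cos (l * (x-1))) / l\<^sup>2 * (1/2) - (1 - cos (l * x)) / l\<^sup>2)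
     (fejer_mass * \<bar>x+1\<bar> * (1/2) + fejer_mass * \<bar>x-1\<bar> * (1/2) - fejer_mass * \<bar>x\<bar>)"
    by (intro has_bochner_integral_diff has_bochner_integral_add has_bochner_integral_mult_left
          integral_one_minus_cos)
  moreover have "fejer_mass * \<bar>x+1\<bar> * (1/2) + fejer_mass * \<bar>x-1\<bar> * (1/2) - fejer_mass * \<bar>x\<bar> = fejer_mass * tent x"
  proof -
    have "\<bar>x+1\<bar> * (1/2) + \<bar>x-1\<bar> * (1/2) - \<bar>x\<bar> = tent x"
      by (auto simp: tent_def max_def abs_if field_simps)
    then have "fejer_mass * (\<bar>x+1\<bar> * (1/2) + \<bar>x-1\<bar> * (1/2) - \<bar>x\<bar>) = fejer_mass * tent x" by simp
    then show ?thesis by (simp only: distrib_left right_diff_distrib mult.assoc)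
  qed
  moreover have "(1 - cos (l * (x+1))) / l\<^sup>2 * (1/2) + (1 - cos (l * (x-1))) / l\<^sup>2 * (1/2) - (1 - cos (l * x)) / l\<^sup>2
      = cos (l * x) * fejer l" for l
  proof -
    have "cos (l * (x+1)) + cos (l * (x-1)) = 2 * cos (l * x) * cos l"
      by (simp add: algebra_simps cos_add cos_diff)
    then have "(1 - cos (l * (x+1))) * (1/2) + (1 - cos (l * (x-1))) * (1/2) - (1 - cos (l * x))
      = cos (l * x) * (1 - cos l)"
      by (simp add: algebra_simps)
    from arg_cong[OF this, of "\<lambda>z. z / l\<^sup>2"] show ?thesis
      by (simp add: fejer_def add_divide_distrib diff_divide_distrib algebra_simps)
  qed
  ultimately show ?thesis by simp
qed

lemma fejer_mass_pos: "fejer_mass > 0"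
proof -
  have "fejer_mass \<noteq> 0"
  proof
    assume "fejer_mass = 0"
    then have "AE l in lborel. fejer l = 0"
      using integral_nonneg_eq_0_iff_AE[OF integrable_fejer] fejer_nonneg by (simp add: fejer_mass_def)
    then have "AE l in lborel. l \<notin> {1..2::real}"
    proof (rule AE_mp, intro AE_I2 impI)
      fix l :: real assume "fejer l = 0"
      show "l \<notin> {1..2}"
      proof
        assume l: "l \<in> {1..2}"
        then have "cos l < cos 0" using pi_ge_two by (intro cos_monotone_0_pi) auto
        with \<open>fejer l = 0\<close> l show False by (auto simp: fejer_def)
      qed
    qed
    then have "{1..2::real} \<in> null_sets lborel"
      by (subst AE_iff_null_sets) auto
    then show False by (simp add: null_sets_def)
  qed
  moreover have "fejer_mass \<ge> 0" unfolding fejer_mass_def by (simp add: fejer_nonneg)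
  ultimately show ?thesis by simp
qed

lemma expectation_cos_std_normal:
  "(LINT x|std_normal_distribution. cos (s * x)) = exp (- (s\<^sup>2) / 2)"
proof -
  interpret S: prob_space std_normal_distribution using prob_space_normal_density by auto
  have "complex_integrable std_normal_distribution (\<lambda>x. iexp (s * x))"
    by (rule S.integrable_const_bound[where B=1]) (auto simp: norm_exp_i_times)
  then have "Re (CLINT x|std_normal_distribution. iexp (s * x)) = (LINT x|std_normal_distribution. Re (iexp (s * x)))"
    by (rule integral_Re[symmetric])
  also have "\<dots> = (LINT x|std_normal_distribution. cos (s * x))"
    by (simp add: cis_conv_exp[symmetric] flip: of_real_mult)
  finally show ?thesis
    using char_std_normal_distribution by (simp add: char_def fun_eq_iff)
qed

lemma (in prob_space) expectation_cos_linear: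
  assumes I: "finite I" and ind: "indep_vars (\<lambda>_. borel) a I"
    and dist: "\<And>J. J \<in> I \<Longrightarrow> distributed M lborel (a J) std_normal_density"
  shows "expectation (\<lambda>\<omega>. cos (\<Sum>J\<in>I. c J * a J \<omega>)) = exp (- (\<Sum>J\<in>I. (c J)\<^sup>2) / 2)"
proof -
  define K where "K = {J\<in>I. c J \<noteq> 0}"
  have K: "finite K" "K \<subseteq> I" using I by (auto simp: K_def)
  have sumK: "(\<Sum>J\<in>I. c J * a J \<omega>) = (\<Sum>J\<in>K. c J * a J \<omega>)" for \<omega>
    unfolding K_def by (rule sum.mono_neutral_right) (use I in auto)
  have sumK2: "(\<Sum>J\<in>I. (c J)\<^sup>2) = (\<Sum>J\<in>K. (c J)\<^sup>2)"
    unfolding K_def by (rule sum.mono_neutral_right) (use I in auto)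
  show ?thesis
  proof (cases "K = {}")
    case True then show ?thesis by (simp add: sumK sumK2 prob_space)
  next
    case False
    define s where "s = sqrt (\<Sum>J\<in>K. (c J)\<^sup>2)"
    have s: "s > 0" unfolding s_def
      using False K(1) by (auto intro!: real_sqrt_gt_zero sum_pos simp: K_def)
    have "indep_vars (\<lambda>_. borel) (\<lambda>J \<omega>. c J * a J \<omega>) K"
      using indep_vars_compose2[OF indep_vars_subset[OF ind K(2)], of "\<lambda>J x. c J * x" "\<lambda>_. borel"] by simp
    moreover have "distributed M lborel (\<lambda>\<omega>. c J * a J \<omega>) (normal_density 0 \<bar>c J\<bar>)" if "J \<in> K" for J
      using normal_density_affine[of "a J" 0 1 "c J" 0] dist[of J] that K by (auto simp: K_def)
    ultimately have D: "distributed M lborel (\<lambda>\<omega>. \<Sum>J\<in>K. c J * a J \<omega>) (normal_density 0 s)"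
      using sum_indep_normal[of K "\<lambda>J \<omega>. c J * a J \<omega>" "\<lambda>J. \<bar>c J\<bar>" "\<lambda>_. 0"] K False
      by (simp add: s_def K_def)
    have D1: "distributed M lborel (\<lambda>\<omega>. (\<Sum>J\<in>K. c J * a J \<omega>) / s) std_normal_density"
      using normal_density_affine[OF D s, of "1/s" 0] s by simp
    have "exp (- (s\<^sup>2) / 2) = (LINT x|std_normal_distribution. cos (s * x))"
      by (rule expectation_cos_std_normal[symmetric])
    also have "std_normal_distribution = distr M lborel (\<lambda>\<omega>. (\<Sum>J\<in>K. c J * a J \<omega>) / s)"
      using distributed_distr_eq_density[OF D1] by simp
    also have "(LINT x|\<dots>. cos (s * x)) = expectation (\<lambda>\<omega>. cos (s * ((\<Sum>J\<in>K. c J * a J \<omega>) / s)))"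
      by (rule integral_distr) (use distributed_measurable[OF D1] in auto)
    finally show ?thesis using s by (simp add: sumK sumK2 s_def sum_nonneg)
  qed
qed

text \<open>Fubini: a tent factor inside an expectation is replaced by a cosine factor that is integrated against
the nonnegative weight \<open>fejer\<close>.\<close>

lemma (in prob_space) expectation_tent_eq:
  fixes X W :: "'a \<Rightarrow> real"
  assumes [measurable]: "random_variable borel X" "random_variable borel W"
    and W: "\<And>\<omega>. \<bar>W \<omega>\<bar> \<le> 1"
  shows "has_bochner_integral lborel (\<lambda>l. expectation (\<lambda>\<omega>. W \<omega> * cos (l * X \<omega>)) * fejer l)
           (fejer_mass * expectation (\<lambda>\<omega>. W \<omega> * tent (X \<omega>)))"
proof -
  interpret P: pair_sigma_finite lborel M ..
  let ?f = "\<lambda>(l, \<omega>). W \<omega> * cos (l * X \<omega>) * fejer l"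
  have int: "integrable (lborel \<Otimes>\<^sub>M M) ?f"
  proof (rule Bochner_Integration.integrable_bound)
    show "integrable (lborel \<Otimes>\<^sub>M M) (\<lambda>(l, \<omega>). fejer l)"
      by (rule P.Fubini_integrable) (auto simp: integrable_fejer fejer_nonneg prob_space)
    show "?f \<in> borel_measurable (lborel \<Otimes>\<^sub>M M)" by measurable
    have "\<bar>W \<omega>\<bar> * \<bar>cos (l * X \<omega>)\<bar> * fejer l \<le> 1 * 1 * fejer l" for l \<omega>
      by (intro mult_right_mono mult_mono W abs_cos_le_one fejer_nonneg) auto
    then show "AE x in lborel \<Otimes>\<^sub>M M. norm (?f x) \<le> norm (case x of (l, \<omega>) \<Rightarrow> fejer l)"
      by (auto simp: abs_mult fejer_nonneg)
  qed
  have "integrable lborel (\<lambda>l. \<integral>\<omega>. W \<omega> * cos (l * X \<omega>) * fejer l \<partial>M)"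
    using P.integrable_fst[OF int] by simp
  moreover have "(\<integral>l. (\<integral>\<omega>. W \<omega> * cos (l * X \<omega>) * fejer l \<partial>M) \<partial>lborel)
     = (\<integral>\<omega>. (\<integral>l. W \<omega> * cos (l * X \<omega>) * fejer l \<partial>lborel) \<partial>M)"
    using P.Fubini_integral[of "\<lambda>l \<omega>. W \<omega> * cos (l * X \<omega>) * fejer l"] int by simp
  moreover have "(\<integral>l. W \<omega> * cos (l * X \<omega>) * fejer l \<partial>lborel) = fejer_mass * (W \<omega> * tent (X \<omega>))" for \<omega>
    using has_bochner_integral_integral_eq[OF integral_cos_fejer[of "X \<omega>"]]
    by (simp add: mult.assoc)
  ultimately show ?thesis
    by (simp add: has_bochner_integral_iff)
qed

text \<open>The expectation of the tent of a centred Gaussian variable of variance \<open>D\<close>, written in the form in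
which it appears when the tent is expanded into cosines.\<close>

definition tent_gauss :: "real \<Rightarrow> real" where
  "tent_gauss D = (\<integral>l. exp (- D * l\<^sup>2 / 2) * fejer l \<partial>lborel) / fejer_mass"

lemma integrable_exp_fejer: "D \<ge> 0 \<Longrightarrow> integrable lborel (\<lambda>l. exp (- D * l\<^sup>2 / 2) * fejer l)"
  by (rule Bochner_Integration.integrable_bound[OF integrable_fejer])
     (auto simp: abs_mult fejer_nonneg intro!: mult_left_le_one_le)

text \<open>For a standard Gaussian variable \<open>x\<close> one has \<open>tent (sqrt D * x) \<ge> 1 - sqrt D * \<bar>x\<bar>\<close>, and the mean of
\<open>\<bar>x\<bar>\<close> is at most \<open>1\<close> because \<open>\<bar>x\<bar> \<le> (1 + x\<^sup>2) / 2\<close>.\<close>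

lemma tent_gauss_ge:
  assumes "D \<ge> 0"
  shows "tent_gauss D \<ge> 1 - sqrt D"
proof -
  interpret S: prob_space std_normal_distribution using prob_space_normal_density by auto
  have "S.expectation (\<lambda>x. cos (l * (sqrt D * x))) = exp (- D * l\<^sup>2 / 2)" for l
    using expectation_cos_std_normal[of "l * sqrt D"] assms by (simp add: power_mult_distrib mult_ac)
  then have "has_bochner_integral lborel (\<lambda>l. exp (- D * l\<^sup>2 / 2) * fejer l)
     (fejer_mass * S.expectation (\<lambda>x. tent (sqrt D * x)))"
    using S.expectation_tent_eq[of "\<lambda>x. sqrt D * x" "\<lambda>_. 1"] by simp
  then have "tent_gauss D = S.expectation (\<lambda>x. tent (sqrt D * x))"
    using fejer_mass_pos by (simp add: tent_gauss_def has_bochner_integral_iff)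
  moreover have "S.expectation (\<lambda>x. tent (sqrt D * x)) \<ge> S.expectation (\<lambda>x. 1 - sqrt D * ((1 + x^2) / 2))"
  proof (rule integral_mono)
    have i2: "integrable std_normal_distribution (\<lambda>x. x\<^sup>2)"
      by (rule integrable_std_normal_distribution_moment)
    then show "integrable std_normal_distribution (\<lambda>x. 1 - sqrt D * ((1 + x\<^sup>2) / 2))"
      by (intro Bochner_Integration.integrable_diff integrable_mult_right integrable_divide
            Bochner_Integration.integrable_add S.integrable_const)
    show "integrable std_normal_distribution (\<lambda>x. tent (sqrt D * x))"
      by (rule S.integrable_const_bound[where B=1]) (auto simp: tent_def)
    fix x :: real
    have "\<bar>x\<bar> \<le> (1 + x\<^sup>2) / 2"
      using zero_le_power2[of "\<bar>x\<bar> - 1"] by (simp add: power2_diff)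
    then have "sqrt D * \<bar>x\<bar> \<le> sqrt D * ((1 + x\<^sup>2) / 2)" using assms by (intro mult_left_mono) auto
    then show "1 - sqrt D * ((1 + x\<^sup>2) / 2) \<le> tent (sqrt D * x)"
      using assms by (auto simp: tent_def abs_mult)
  qed
  moreover have "S.expectation (\<lambda>x. 1 - sqrt D * ((1 + x^2) / 2)) = 1 - sqrt D"
  proof -
    have i2: "integrable std_normal_distribution (\<lambda>x. x\<^sup>2)"
      by (rule integrable_std_normal_distribution_moment)
    have "S.expectation (\<lambda>x. x\<^sup>2) = 1"
      using std_normal_distribution_even_moments(1)[of 1] by simp
    then show ?thesis using i2 S.prob_space by (simp add: add_divide_distrib)
  qed
  ultimately show ?thesis by simp
qed

section \<open>A small ball inequality under diagonal domination\<close>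

lemma borel_measurable_tent [measurable]: "tent \<in> borel_measurable borel"
  unfolding tent_def by measurable

lemma tent_bounds: "0 \<le> tent x" "tent x \<le> 1"
  by (auto simp: tent_def)

text \<open>The hypothesis on \<open>cos\<close> says that characteristic functions are at least those of independent
variables with variances \<open>D i\<close>. It is transferred to products of tents one factor at a
time: the induction carries an extra factor \<open>cos\<close> of a linear combination of the variables that are not
yet used, and expanding the tent of the next variable only changes this linear combination.\<close>

lemma (in prob_space) expectation_prod_tent_cos_ge:
  fixes X :: "'i \<Rightarrow> 'a \<Rightarrow> real"
  assumes T: "finite T" and ST: "S \<subseteq> T"
    and X [measurable]: "\<And>i. i \<in> T \<Longrightarrow> random_variable borel (X i)"
    and D: "\<And>i. i \<in> T \<Longrightarrow> 0 \<le> D i"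
    and char: "\<And>l. exp (- (\<Sum>i\<in>T. D i * (l i)\<^sup>2) / 2) \<le> expectation (\<lambda>\<omega>. cos (\<Sum>i\<in>T. l i * X i \<omega>))"
  shows "(\<Prod>i\<in>S. tent_gauss (D i)) * exp (- (\<Sum>i\<in>T - S. D i * (l i)\<^sup>2) / 2)
     \<le> expectation (\<lambda>\<omega>. (\<Prod>i\<in>S. tent (X i \<omega>)) * cos (\<Sum>i\<in>T - S. l i * X i \<omega>))"
  using finite_subset[OF ST T] ST
proof (induction S arbitrary: l rule: finite_induct)
  case empty
  then show ?case using char by simp
next
  case (insert i S)
  define R where "R = T - insert i S"
  have R: "T - S = insert i R" "i \<notin> R" "finite R" "R \<subseteq> T" "i \<in> T" "S \<subseteq> T"
    using insert T by (auto simp: R_def)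
  have m [measurable]: "random_variable borel (X i)" "\<And>j. j \<in> S \<Longrightarrow> random_variable borel (X j)"
      "\<And>j. j \<in> R \<Longrightarrow> random_variable borel (X j)"
    using X R by auto
  define p where "p = (\<Prod>j\<in>S. tent_gauss (D j))"
  define q where "q = exp (- (\<Sum>j\<in>R. D j * (l j)\<^sup>2) / 2)"
  define W where "W = (\<lambda>\<omega>. \<Prod>j\<in>S. tent (X j \<omega>))"
  define Y where "Y = (\<lambda>\<omega>. \<Sum>j\<in>R. l j * X j \<omega>)"
  have [measurable]: "random_variable borel W" "random_variable borel Y"
    unfolding W_def Y_def by measurable
  have W: "0 \<le> W \<omega>" "W \<omega> \<le> 1" for \<omega>
    unfolding W_def by (auto intro!: prod_nonneg prod_le_1 tent_bounds)
  have WY: "\<bar>W \<omega> * cos z\<bar> \<le> 1" for \<omega> z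
    using mult_mono[OF W(2)[of \<omega>] abs_cos_le_one[of z]] W(1)[of \<omega>] by (simp add: abs_mult)
  have int: "integrable M (\<lambda>\<omega>. W \<omega> * cos (f \<omega>))" if [measurable]: "random_variable borel f" for f
    by (rule integrable_const_bound[where B=1]) (use WY in auto)
  have IH: "p * (q * exp (- D i * u\<^sup>2 / 2)) \<le> expectation (\<lambda>\<omega>. W \<omega> * cos (u * X i \<omega> + Y \<omega>))" for u
  proof -
    have "(\<Sum>j\<in>R. D j * ((l(i:=u)) j)\<^sup>2) = (\<Sum>j\<in>R. D j * (l j)\<^sup>2)"
      "(\<Sum>j\<in>R. (l(i:=u)) j * X j \<omega>) = Y \<omega>" for \<omega>
      unfolding Y_def using R(2) by (auto intro!: sum.cong)
    then show ?thesis
      using insert.IH[of "l(i:=u)"] R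
      by (simp add: p_def[symmetric] W_def q_def exp_add[symmetric] add_divide_distrib diff_divide_distrib algebra_simps)
  qed
  have step: "p * q * exp (- D i * u\<^sup>2 / 2) \<le> expectation (\<lambda>\<omega>. W \<omega> * cos (Y \<omega>) * cos (u * X i \<omega>))" for u
  proof -
    have "W \<omega> * cos (Y \<omega>) * cos (u * X i \<omega>) = (W \<omega> * cos (u * X i \<omega> + Y \<omega>) + W \<omega> * cos ((-u) * X i \<omega> + Y \<omega>)) / 2" for \<omega>
      by (simp add: cos_add cos_diff algebra_simps)
    then have "expectation (\<lambda>\<omega>. W \<omega> * cos (Y \<omega>) * cos (u * X i \<omega>)) =
       (expectation (\<lambda>\<omega>. W \<omega> * cos (u * X i \<omega> + Y \<omega>)) + expectation (\<lambda>\<omega>. W \<omega> * cos ((-u) * X i \<omega> + Y \<omega>))) / 2"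
      by (simp only: integral_divide_zero) (subst Bochner_Integration.integral_add, auto intro!: int)
    then show ?thesis using IH[of u] IH[of "-u"] by simp
  qed
  have Hb: "has_bochner_integral lborel (\<lambda>u. expectation (\<lambda>\<omega>. W \<omega> * cos (Y \<omega>) * cos (u * X i \<omega>)) * fejer u)
           (fejer_mass * expectation (\<lambda>\<omega>. W \<omega> * cos (Y \<omega>) * tent (X i \<omega>)))"
    by (rule expectation_tent_eq) (use WY in auto)
  have "(\<integral>u. p * q * (exp (- D i * u\<^sup>2 / 2) * fejer u) \<partial>lborel)
     \<le> (\<integral>u. expectation (\<lambda>\<omega>. W \<omega> * cos (Y \<omega>) * cos (u * X i \<omega>)) * fejer u \<partial>lborel)"
  proof (rule integral_mono)
    show "integrable lborel (\<lambda>u. p * q * (exp (- D i * u\<^sup>2 / 2) * fejer u))"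
      using integrable_exp_fejer[OF D[OF R(5)]] by (intro integrable_mult_right) auto
    show "integrable lborel (\<lambda>u. expectation (\<lambda>\<omega>. W \<omega> * cos (Y \<omega>) * cos (u * X i \<omega>)) * fejer u)"
      using Hb by (simp add: has_bochner_integral_iff)
    show "p * q * (exp (- D i * u\<^sup>2 / 2) * fejer u) \<le> expectation (\<lambda>\<omega>. W \<omega> * cos (Y \<omega>) * cos (u * X i \<omega>)) * fejer u" for u
      using mult_right_mono[OF step fejer_nonneg, of u u] by (simp add: mult.assoc)
  qed
  then have "p * q * (tent_gauss (D i) * fejer_mass) \<le> fejer_mass * expectation (\<lambda>\<omega>. W \<omega> * cos (Y \<omega>) * tent (X i \<omega>))"
    using Hb fejer_mass_pos by (simp add: has_bochner_integral_iff tent_gauss_def)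
  then have "p * q * tent_gauss (D i) \<le> expectation (\<lambda>\<omega>. W \<omega> * cos (Y \<omega>) * tent (X i \<omega>))"
    using fejer_mass_pos by (simp add: mult.commute[of fejer_mass] flip: mult.assoc)
  also have "(\<lambda>\<omega>. W \<omega> * cos (Y \<omega>) * tent (X i \<omega>)) = (\<lambda>\<omega>. (\<Prod>j\<in>insert i S. tent (X j \<omega>)) * cos (\<Sum>j\<in>T - insert i S. l j * X j \<omega>))"
    using insert by (simp add: W_def Y_def R_def mult_ac fun_eq_iff)
  finally show ?case
    using insert by (simp add: p_def q_def R_def mult_ac)
qed

text \<open>The product of the tents is dominated by the indicator of the event that all variables are at most
\<open>1\<close> in absolute value, and each factor costs \<open>1 - sqrt (D i) \<ge> exp (- 2 * sqrt (D i))\<close>.\<close>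

lemma (in prob_space) prob_all_small_ge:
  fixes X :: "'i \<Rightarrow> 'a \<Rightarrow> real" and a :: "'j \<Rightarrow> 'a \<Rightarrow> real" and b :: "'i \<Rightarrow> 'j \<Rightarrow> real"
  assumes I: "finite I" and ind: "indep_vars (\<lambda>_. borel) a I"
    and dist: "\<And>J. J \<in> I \<Longrightarrow> distributed M lborel (a J) std_normal_density"
    and T: "finite T"
    and D: "\<And>i. i \<in> T \<Longrightarrow> 0 \<le> D i" "\<And>i. i \<in> T \<Longrightarrow> D i \<le> 1 / 4"
    and var: "\<And>l. (\<Sum>J\<in>I. (\<Sum>i\<in>T. l i * b i J)\<^sup>2) \<le> (\<Sum>i\<in>T. D i * (l i)\<^sup>2)"
  shows "exp (- 2 * (\<Sum>i\<in>T. sqrt (D i))) \<le> prob {\<omega> \<in> space M. \<forall>i\<in>T. \<bar>\<Sum>J\<in>I. b i J * a J \<omega>\<bar> \<le> 1}"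
proof -
  define X where "X = (\<lambda>i \<omega>. \<Sum>J\<in>I. b i J * a J \<omega>)"
  have a [measurable]: "random_variable borel (a J)" if "J \<in> I" for J
    using distributed_measurable[OF dist[OF that]] by simp
  have X [measurable]: "random_variable borel (X i)" for i
    unfolding X_def by measurable
  have char: "exp (- (\<Sum>i\<in>T. D i * (l i)\<^sup>2) / 2) \<le> expectation (\<lambda>\<omega>. cos (\<Sum>i\<in>T. l i * X i \<omega>))" for l
  proof -
    have "(\<Sum>i\<in>T. l i * X i \<omega>) = (\<Sum>J\<in>I. (\<Sum>i\<in>T. l i * b i J) * a J \<omega>)" for \<omega>
      unfolding X_def sum_distrib_left sum_distrib_right by (subst sum.swap) (simp add: mult.assoc)
    then have "expectation (\<lambda>\<omega>. cos (\<Sum>i\<in>T. l i * X i \<omega>)) = exp (- (\<Sum>J\<in>I. (\<Sum>i\<in>T. l i * b i J)\<^sup>2) / 2)"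
      using expectation_cos_linear[OF I ind dist] by simp
    then show ?thesis using var[of l] by simp
  qed
  have half: "exp (- 2 * x) \<le> 1 - x" if "0 \<le> x" "x \<le> 1/2" for x :: real
  proof -
    have "1 + 2 * x \<le> exp (2 * x)" by (rule exp_ge_add_one_self)
    then have "(1 - x) * (1 + 2 * x) \<le> (1 - x) * exp (2 * x)"
      using that by (intro mult_left_mono) auto
    moreover have "1 \<le> (1 - x) * (1 + 2 * x)"
      using that mult_nonneg_nonneg[of x "1 - 2 * x"] by (simp add: algebra_simps)
    ultimately have "1 \<le> (1 - x) * exp (2 * x)"
      by linarith
    then show ?thesis by (simp add: exp_minus field_simps)
  qed
  have "exp (- 2 * (\<Sum>i\<in>T. sqrt (D i))) = (\<Prod>i\<in>T. exp (- 2 * sqrt (D i)))"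
    by (simp add: sum_distrib_left exp_sum[OF T])
  also have "\<dots> \<le> (\<Prod>i\<in>T. tent_gauss (D i))"
  proof (rule prod_mono)
    fix i assume i: "i \<in> T"
    have "sqrt (D i) \<le> sqrt (1/4)" using D i by (intro real_sqrt_le_mono) auto
    then have "exp (- 2 * sqrt (D i)) \<le> 1 - sqrt (D i)"
      using D i by (intro half) (auto simp: real_sqrt_divide)
    also have "\<dots> \<le> tent_gauss (D i)" using D i by (intro tent_gauss_ge) auto
    finally show "0 \<le> exp (- 2 * sqrt (D i)) \<and> exp (- 2 * sqrt (D i)) \<le> tent_gauss (D i)" by simp
  qed
  also have "\<dots> \<le> expectation (\<lambda>\<omega>. \<Prod>i\<in>T. tent (X i \<omega>))"
    using expectation_prod_tent_cos_ge[OF T subset_refl X D(1) char] by simp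
  also have "\<dots> \<le> expectation (indicat_real {\<omega> \<in> space M. \<forall>i\<in>T. \<bar>X i \<omega>\<bar> \<le> 1})"
  proof (rule integral_mono)
    show "integrable M (\<lambda>\<omega>. \<Prod>i\<in>T. tent (X i \<omega>))"
      by (rule integrable_const_bound[where B=1])
         (auto simp: abs_prod tent_bounds intro!: AE_I2 prod_le_1)
    have "{\<omega> \<in> space M. \<forall>i\<in>T. \<bar>X i \<omega>\<bar> \<le> 1} \<in> events"
      using T by measurable
    then show "integrable M (indicat_real {\<omega> \<in> space M. \<forall>i\<in>T. \<bar>X i \<omega>\<bar> \<le> 1})"
      by (intro integrable_real_indicator) (auto simp: emeasure_eq_measure)
    fix \<omega> assume \<omega>: "\<omega> \<in> space M"
    show "(\<Prod>i\<in>T. tent (X i \<omega>)) \<le> indicat_real {\<omega> \<in> space M. \<forall>i\<in>T. \<bar>X i \<omega>\<bar> \<le> 1} \<omega>"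
    proof (cases "\<forall>i\<in>T. \<bar>X i \<omega>\<bar> \<le> 1")
      case True
      then show ?thesis using \<omega> by (auto intro!: prod_le_1 tent_bounds)
    next
      case False
      then obtain i where "i \<in> T" "tent (X i \<omega>) = 0" by (auto simp: tent_def max_def)
      then have "(\<Prod>i\<in>T. tent (X i \<omega>)) = 0" using T by auto
      then show ?thesis by simp
    qed
  qed
  also have "\<dots> = prob {\<omega> \<in> space M. \<forall>i\<in>T. \<bar>X i \<omega>\<bar> \<le> 1}"
    by (auto intro!: arg_cong[where f=prob])
  finally show ?thesis by (simp add: X_def)
qed

section \<open>Shifting a standard Gaussian vector\<close>

lemma nn_integral_std_normal_shift:
  assumes [measurable]: "f \<in> borel_measurable borel"
  shows "(\<integral>\<^sup>+y. f y \<partial>std_normal_distribution)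
       = (\<integral>\<^sup>+y. ennreal (exp (- (h * y + h\<^sup>2 / 2))) * f (y + h) \<partial>std_normal_distribution)"
proof -
  have dens: "std_normal_density (y + h) = std_normal_density y * exp (- (h * y + h\<^sup>2 / 2))" for y
    by (simp add: std_normal_density_def exp_add[symmetric] power2_sum field_simps)
  have "(\<integral>\<^sup>+y. f y \<partial>std_normal_distribution) = (\<integral>\<^sup>+y. ennreal (std_normal_density y) * f y \<partial>lborel)"
    by (subst nn_integral_density) auto
  also have "\<dots> = (\<integral>\<^sup>+y. ennreal (std_normal_density (y + h)) * f (y + h) \<partial>lborel)"
    by (subst nn_integral_real_affine[where c=1 and t=h]) (auto simp: add.commute)
  also have "\<dots> = (\<integral>\<^sup>+y. ennreal (std_normal_density y) * (ennreal (exp (- (h * y + h\<^sup>2 / 2))) * f (y + h)) \<partial>lborel)"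
    by (simp add: dens ennreal_mult' mult.assoc)
  also have "\<dots> = (\<integral>\<^sup>+y. ennreal (exp (- (h * y + h\<^sup>2 / 2))) * f (y + h) \<partial>std_normal_distribution)"
    by (subst nn_integral_density) auto
  finally show ?thesis .
qed

text \<open>The Cameron--Martin formula in finite dimension, one coordinate at a time.\<close>

lemma nn_integral_PiM_std_normal_shift:
  fixes h :: "'j \<Rightarrow> real"
  assumes "finite I" and "f \<in> borel_measurable (Pi\<^sub>M I (\<lambda>_. borel))"
  shows "(\<integral>\<^sup>+x. f x \<partial>Pi\<^sub>M I (\<lambda>_. std_normal_distribution))
       = (\<integral>\<^sup>+x. ennreal (exp (- (\<Sum>J\<in>I. h J * x J + (h J)\<^sup>2 / 2))) * f (\<lambda>J\<in>I. x J + h J)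
            \<partial>Pi\<^sub>M I (\<lambda>_. std_normal_distribution))"
  using assms
proof (induction I arbitrary: f rule: finite_induct)
  case empty
  then show ?case by (simp add: PiM_empty nn_integral_count_space_finite restrict_def)
next
  case (insert i I)
  interpret N: prob_space std_normal_distribution using prob_space_normal_density by auto
  interpret P: product_sigma_finite "\<lambda>_ :: 'j. std_normal_distribution" ..
  note [measurable] = insert.prems
  have S: "sets (Pi\<^sub>M K (\<lambda>_::'j. std_normal_distribution)) = sets (Pi\<^sub>M K (\<lambda>_. borel))" for K
    by (intro sets_PiM_cong) auto
  note [measurable_cong] = S
  define g where "g = (\<lambda>x. ennreal (exp (- (\<Sum>J\<in>insert i I. h J * x J + (h J)\<^sup>2 / 2))) * f (\<lambda>J\<in>insert i I. x J + h J))"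
  have g [measurable]: "g \<in> borel_measurable (Pi\<^sub>M (insert i I) (\<lambda>_. borel))"
    unfolding g_def by measurable
  have "(\<integral>\<^sup>+x. f x \<partial>Pi\<^sub>M (insert i I) (\<lambda>_. std_normal_distribution))
      = (\<integral>\<^sup>+x. (\<integral>\<^sup>+y. f (x(i := y)) \<partial>std_normal_distribution) \<partial>Pi\<^sub>M I (\<lambda>_. std_normal_distribution))"
    by (intro P.product_nn_integral_insert insert.hyps) (simp add: measurable_cong_sets[OF S refl] insert.prems)
  also have "\<dots> = (\<integral>\<^sup>+x. (\<integral>\<^sup>+y. ennreal (exp (- (h i * y + (h i)\<^sup>2 / 2))) * f (x(i := y + h i)) \<partial>std_normal_distribution)
       \<partial>Pi\<^sub>M I (\<lambda>_. std_normal_distribution))"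
  proof (rule nn_integral_cong, rule nn_integral_std_normal_shift)
    fix x assume "x \<in> space (Pi\<^sub>M I (\<lambda>_::'j. std_normal_distribution))"
    then have [simp]: "x \<in> space (Pi\<^sub>M I (\<lambda>_. borel))" by (simp add: space_PiM)
    show "(\<lambda>y. f (x(i := y))) \<in> borel_measurable borel" by measurable
  qed
  also have "\<dots> = (\<integral>\<^sup>+x. ennreal (exp (- (\<Sum>J\<in>I. h J * x J + (h J)\<^sup>2 / 2))) *
        (\<integral>\<^sup>+y. ennreal (exp (- (h i * y + (h i)\<^sup>2 / 2))) * f ((\<lambda>J\<in>I. x J + h J)(i := y + h i)) \<partial>std_normal_distribution)
       \<partial>Pi\<^sub>M I (\<lambda>_. std_normal_distribution))"
  proof (subst insert.IH)
    have u [measurable]: "(\<lambda>(x, y). x(i := y + h i)) \<in> measurable (Pi\<^sub>M I (\<lambda>_. borel) \<Otimes>\<^sub>M std_normal_distribution) (Pi\<^sub>M (insert i I) (\<lambda>_. borel :: real measure))"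
      unfolding case_prod_unfold
    proof (rule measurable_fun_upd[where J=I])
      show "(\<lambda>p. snd p + h i) \<in> measurable (Pi\<^sub>M I (\<lambda>_. borel) \<Otimes>\<^sub>M std_normal_distribution) borel"
        by (intro borel_measurable_add measurable_compose[OF measurable_snd]) auto
    qed auto
    have "(\<lambda>p. f (case p of (x, y) \<Rightarrow> x(i := y + h i))) \<in> borel_measurable (Pi\<^sub>M I (\<lambda>_. borel) \<Otimes>\<^sub>M std_normal_distribution)"
      by (rule measurable_compose[OF u insert.prems])
    then have m: "(\<lambda>(x, y). f (x(i := y + h i))) \<in> borel_measurable (Pi\<^sub>M I (\<lambda>_. borel) \<Otimes>\<^sub>M std_normal_distribution)"
      by (simp add: case_prod_unfold)
    show "(\<lambda>x. \<integral>\<^sup>+y. ennreal (exp (- (h i * y + (h i)\<^sup>2 / 2))) * f (x(i := y + h i)) \<partial>std_normal_distribution)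
        \<in> borel_measurable (Pi\<^sub>M I (\<lambda>_. borel))"
    proof (rule N.borel_measurable_nn_integral)
      have "(\<lambda>p. ennreal (exp (- (h i * snd p + (h i)\<^sup>2 / 2)))) \<in> borel_measurable (Pi\<^sub>M I (\<lambda>_. borel) \<Otimes>\<^sub>M std_normal_distribution)"
        by (rule measurable_compose[OF measurable_snd]) simp
      from borel_measurable_times_ennreal[OF this m]
      show "(\<lambda>(x, y). ennreal (exp (- (h i * y + (h i)\<^sup>2 / 2))) * f (x(i := y + h i)))
          \<in> borel_measurable (Pi\<^sub>M I (\<lambda>_. borel) \<Otimes>\<^sub>M std_normal_distribution)"
        by (simp add: case_prod_unfold)
    qed
  qed simp
  also have "\<dots> = (\<integral>\<^sup>+x. (\<integral>\<^sup>+y. g (x(i := y)) \<partial>std_normal_distribution) \<partial>Pi\<^sub>M I (\<lambda>_. std_normal_distribution))"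
  proof (intro nn_integral_cong)
    fix x assume "x \<in> space (Pi\<^sub>M I (\<lambda>_::'j. std_normal_distribution))"
    then have x[simp]: "x \<in> space (Pi\<^sub>M I (\<lambda>_. borel))" by (simp add: space_PiM)
    have *: "(\<lambda>J\<in>insert i I. (x(i := y)) J + h J) = (\<lambda>J\<in>I. x J + h J)(i := y + h i)" for y
      using insert.hyps by (auto simp: restrict_def fun_eq_iff)
    have [simp]: "(\<lambda>J\<in>I. x J + h J) \<in> space (Pi\<^sub>M I (\<lambda>_. borel))"
      by (simp add: space_PiM)
    have s: "(\<Sum>J\<in>I. h J * (x(i := y)) J + (h J)\<^sup>2 / 2) = (\<Sum>J\<in>I. h J * x J + (h J)\<^sup>2 / 2)" for y
      using insert.hyps by (intro sum.cong) auto
    have "g (x(i := y)) = ennreal (exp (- (\<Sum>J\<in>I. h J * x J + (h J)\<^sup>2 / 2))) *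
        (ennreal (exp (- (h i * y + (h i)\<^sup>2 / 2))) * f ((\<lambda>J\<in>I. x J + h J)(i := y + h i)))" for y
    proof -
      have "exp (- ((h i * y + (h i)\<^sup>2 / 2) + S)) = exp (- S) * exp (- (h i * y + (h i)\<^sup>2 / 2))" for S
        by (simp add: mult_exp_exp)
      then show ?thesis
        unfolding g_def * sum.insert[OF insert.hyps] s by (simp add: ennreal_mult' mult.assoc)
    qed
    then show "ennreal (exp (- (\<Sum>J\<in>I. h J * x J + (h J)\<^sup>2 / 2))) *
        (\<integral>\<^sup>+y. ennreal (exp (- (h i * y + (h i)\<^sup>2 / 2))) * f ((\<lambda>J\<in>I. x J + h J)(i := y + h i)) \<partial>std_normal_distribution)
       = (\<integral>\<^sup>+y. g (x(i := y)) \<partial>std_normal_distribution)"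
      by (simp only:) (rule nn_integral_cmult[symmetric], measurable)
  qed
  also have "\<dots> = (\<integral>\<^sup>+x. g x \<partial>Pi\<^sub>M (insert i I) (\<lambda>_. std_normal_distribution))"
    by (intro P.product_nn_integral_insert[symmetric] insert.hyps) (simp add: measurable_cong_sets[OF S refl])
  finally show ?case unfolding g_def .
qed

text \<open>The density in the shift formula is \<open>exp (- (\<Sum>J\<in>I. h J * x J) - (\<Sum>J\<in>I. (h J)\<^sup>2) / 2)\<close>, and the
bound \<open>c\<close> on the linear term over \<open>A\<close> bounds it from below where it is used.\<close>

lemma (in prob_space) prob_shift_ge:
  fixes a :: "'j \<Rightarrow> 'a \<Rightarrow> real" and h :: "'j \<Rightarrow> real"
  assumes I: "finite I" "I \<noteq> {}" and ind: "indep_vars (\<lambda>_. borel) a I"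
    and dist: "\<And>J. J \<in> I \<Longrightarrow> distributed M lborel (a J) std_normal_density"
    and A: "A \<in> sets (Pi\<^sub>M I (\<lambda>_. borel))" and B: "B \<in> sets (Pi\<^sub>M I (\<lambda>_. borel))"
    and AB: "\<And>x. x \<in> A \<Longrightarrow> (\<lambda>J\<in>I. x J + h J) \<in> B"
    and c: "\<And>x. x \<in> A \<Longrightarrow> (\<Sum>J\<in>I. h J * x J) \<le> c"
  shows "exp (- c - (\<Sum>J\<in>I. (h J)\<^sup>2) / 2) * prob {\<omega> \<in> space M. (\<lambda>J\<in>I. a J \<omega>) \<in> A}
     \<le> prob {\<omega> \<in> space M. (\<lambda>J\<in>I. a J \<omega>) \<in> B}"
proof -
  let ?N = "Pi\<^sub>M I (\<lambda>_. std_normal_distribution)"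
  have S: "sets ?N = sets (Pi\<^sub>M I (\<lambda>_. borel))"
    by (intro sets_PiM_cong) auto
  have a [measurable]: "random_variable borel (a J)" if "J \<in> I" for J
    using distributed_measurable[OF dist[OF that]] by simp
  have "distr M (Pi\<^sub>M I (\<lambda>_. borel)) (\<lambda>\<omega>. \<lambda>J\<in>I. a J \<omega>) = Pi\<^sub>M I (\<lambda>J. distr M borel (a J))"
    using ind indep_vars_iff_distr_eq_PiM'[where M'="\<lambda>_. borel", OF I(2) a] by simp
  also have "\<dots> = ?N"
  proof (rule PiM_cong)
    fix J assume "J \<in> I"
    have "distr M borel (a J) = distr M lborel (a J)" by (rule distr_cong) auto
    then show "distr M borel (a J) = std_normal_distribution"
      using distributed_distr_eq_density[OF dist[OF \<open>J \<in> I\<close>]] by simp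
  qed simp
  finally have D: "distr M (Pi\<^sub>M I (\<lambda>_. borel)) (\<lambda>\<omega>. \<lambda>J\<in>I. a J \<omega>) = ?N" .
  have em: "emeasure ?N C = emeasure M {\<omega> \<in> space M. (\<lambda>J\<in>I. a J \<omega>) \<in> C}" if "C \<in> sets (Pi\<^sub>M I (\<lambda>_. borel))" for C
    unfolding D[symmetric] using that
    by (subst emeasure_distr) (auto intro!: arg_cong[where f="emeasure M"] measurable_restrict)
  let ?k = "exp (- c - (\<Sum>J\<in>I. (h J)\<^sup>2) / 2)"
  have "ennreal ?k * emeasure ?N A = (\<integral>\<^sup>+x. ennreal ?k * indicator A x \<partial>?N)"
    using A by (simp add: nn_integral_cmult_indicator S)
  also have "\<dots> \<le> (\<integral>\<^sup>+x. ennreal (exp (- (\<Sum>J\<in>I. h J * x J + (h J)\<^sup>2 / 2))) * indicator B (\<lambda>J\<in>I. x J + h J) \<partial>?N)"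
  proof (rule nn_integral_mono)
    fix x
    show "ennreal ?k * indicator A x \<le> ennreal (exp (- (\<Sum>J\<in>I. h J * x J + (h J)\<^sup>2 / 2))) * indicator B (\<lambda>J\<in>I. x J + h J)"
    proof (cases "x \<in> A")
      case True
      have "- c - (\<Sum>J\<in>I. (h J)\<^sup>2) / 2 \<le> - (\<Sum>J\<in>I. h J * x J + (h J)\<^sup>2 / 2)"
        using c[OF True] by (simp add: sum.distrib sum_divide_distrib)
      then show ?thesis using AB[OF True] by (simp add: indicator_def ennreal_leI)
    qed (simp add: indicator_def)
  qed
  also have "\<dots> = (\<integral>\<^sup>+x. indicator B x \<partial>?N)"
    using nn_integral_PiM_std_normal_shift[OF I(1), of "indicator B" h] B by simp
  also have "\<dots> = emeasure ?N B" using B by (simp add: S)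
  finally have "ennreal (?k * prob {\<omega> \<in> space M. (\<lambda>J\<in>I. a J \<omega>) \<in> A}) \<le> ennreal (prob {\<omega> \<in> space M. (\<lambda>J\<in>I. a J \<omega>) \<in> B})"
    by (simp add: em A B emeasure_eq_measure ennreal_mult')
  then show ?thesis by (simp add: ennreal_le_iff)
qed

section \<open>The ensemble as a pairing with tensors\<close>

text \<open>The tensor power of order \<open>n\<close> of a space with a basis indexed by \<open>'l\<close> has a basis indexed by the words
of length \<open>n\<close> over \<open>'l\<close>. Words are extensional functions, so that products of sums expand over them
by distributivity.\<close>

definition words :: "nat \<Rightarrow> (nat \<Rightarrow> 'l) set" where
  "words n = (\<Pi>\<^sub>E k\<in>{..<n}. UNIV)"

definition type_of_word :: "nat \<Rightarrow> (nat \<Rightarrow> 3) \<Rightarrow> nat^3" where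
  "type_of_word n w = (\<chi> i. card {k\<in>{..<n}. w k = i})"

lemma finite_words [simp]: "finite (words n :: (nat \<Rightarrow> 'l::finite) set)"
  by (simp add: words_def finite_PiE)

lemma type_of_word_in: "type_of_word n w \<in> multi_indices n"
proof -
  have "(\<Sum>i\<in>UNIV. card {k\<in>{..<n}. w k = i}) = card (\<Union>i\<in>UNIV. {k\<in>{..<n}. w k = i})"
    by (subst card_UN_disjoint) auto
  also have "(\<Union>i\<in>UNIV. {k\<in>{..<n}. w k = i}) = {..<n}" by auto
  finally show ?thesis by (simp add: type_of_word_def multi_indices_def)
qed

lemma sum_words_prod:
  fixes g :: "nat \<Rightarrow> 'l::finite \<Rightarrow> real"
  shows "(\<Sum>w\<in>words n. \<Prod>k<n. g k (w k)) = (\<Prod>k<n. \<Sum>l\<in>UNIV. g k l)"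
  unfolding words_def by (subst prod_sum_PiE) auto

lemma prod_word_eq_power:
  fixes x :: "real^3"
  shows "(\<Prod>k<n. x $ w k) = (\<Prod>i\<in>UNIV. (x $ i) ^ (type_of_word n w $ i))"
proof -
  have "(\<Prod>i\<in>UNIV. (x $ i) ^ (type_of_word n w $ i)) = (\<Prod>i\<in>UNIV. \<Prod>k\<in>{k\<in>{..<n}. w k = i}. x $ w k)"
    by (intro prod.cong) (auto simp: type_of_word_def)
  also have "\<dots> = (\<Prod>k<n. x $ w k)"
    by (subst prod.group) auto
  finally show ?thesis by simp
qed


lemma type_of_word_upd:
  "type_of_word (Suc n) (w(n := i)) $ j = type_of_word n w $ j + (if j = i then 1 else 0)"
proof -
  have "{k\<in>{..<Suc n}. (w(n := i)) k = j} = {k\<in>{..<n}. w k = j} \<union> {k. k = n \<and> j = i}"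
    by (rule set_eqI, case_tac "x = n") auto
  then have "type_of_word (Suc n) (w(n := i)) $ j = card ({k\<in>{..<n}. w k = j} \<union> {k. k = n \<and> j = i})"
    by (simp add: type_of_word_def)
  also have "\<dots> = card {k\<in>{..<n}. w k = j} + card {k. k = n \<and> j = i}"
    by (rule card_Un_disjoint) auto
  finally show ?thesis by (simp add: type_of_word_def)
qed

lemma words_Suc: "words (Suc n) = (\<Union>i\<in>UNIV. (\<lambda>w. w(n := i)) ` words n)"
  unfolding words_def lessThan_Suc PiE_insert_eq by (auto simp: image_iff)

lemma inj_on_words_upd: "inj_on (\<lambda>w. w(n := i)) (words n)"
proof (rule inj_onI)
  fix v w :: "nat \<Rightarrow> 'a" assume v: "v \<in> words n" and w: "w \<in> words n" and e: "v(n := i) = w(n := i)"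
  have "v n = w n" using v w by (simp add: words_def PiE_def extensional_def)
  then show "v = w" using e by (metis fun_upd_triv fun_upd_upd)
qed

text \<open>The multinomial coefficient counts the words with given letter frequencies; the induction removes the last letter.\<close>

lemma card_words_of_type:
  "J \<in> multi_indices n \<Longrightarrow>
   card {w \<in> words n. type_of_word n w = J} * (\<Prod>i\<in>UNIV. fact (J $ i)) = fact n"
proof (induction n arbitrary: J)
  case 0
  then have "J = 0" by (simp add: multi_indices_def vec_eq_iff)
  then have "{w \<in> words 0. type_of_word 0 w = J} = {\<lambda>_. undefined}"
    by (auto simp: words_def type_of_word_def vec_eq_iff)
  then show ?case using \<open>J = 0\<close> by simp
next
  case (Suc n)
  define dec :: "3 \<Rightarrow> nat^3" where "dec i = (\<chi> j. if j = i then J $ j - 1 else J $ j)" for i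
  define C where "C m K = {w \<in> words m. type_of_word m w = K}" for m K
  have "type_of_word (Suc n) (w(n := i)) = J \<longleftrightarrow> J $ i > 0 \<and> type_of_word n w = dec i" for w i
  proof
    assume J: "type_of_word (Suc n) (w(n := i)) = J"
    have "J $ j = type_of_word n w $ j + (if j = i then 1 else 0)" for j
      unfolding J[symmetric] by (rule type_of_word_upd)
    then show "J $ i > 0 \<and> type_of_word n w = dec i"
      by (auto simp: dec_def vec_eq_iff)
  next
    assume *: "J $ i > 0 \<and> type_of_word n w = dec i"
    then show "type_of_word (Suc n) (w(n := i)) = J"
      by (auto simp: vec_eq_iff type_of_word_upd dec_def)
  qed
  then have C: "C (Suc n) J = (\<Union>i\<in>{i. J $ i > 0}. (\<lambda>w. w(n := i)) ` C n (dec i))"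
    unfolding C_def words_Suc by auto
  have inj: "inj_on (\<lambda>w. w(n := i)) (C n K)" for i K
    by (rule inj_on_subset[OF inj_on_words_upd]) (auto simp: C_def)
  have fin: "finite (C n K)" for K
    by (simp add: C_def)
  have "card (C (Suc n) J) = (\<Sum>i\<in>{i. J $ i > 0}. card ((\<lambda>w. w(n := i)) ` C n (dec i)))"
    unfolding C
  proof (rule card_UN_disjoint)
    show "\<forall>i\<in>{i. 0 < J $ i}. \<forall>j\<in>{i. 0 < J $ i}. i \<noteq> j \<longrightarrow>
       (\<lambda>w. w(n := i)) ` C n (dec i) \<inter> (\<lambda>w. w(n := j)) ` C n (dec j) = {}"
      by (auto dest!: fun_cong[where x=n])
  qed (auto simp: fin)
  then have "card (C (Suc n) J) * (\<Prod>i\<in>UNIV. fact (J $ i))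
     = (\<Sum>i\<in>{i. J $ i > 0}. card (C n (dec i)) * (\<Prod>i\<in>UNIV. fact (J $ i)))"
    by (simp only: card_image[OF inj] sum_distrib_right)
  also have "\<dots> = (\<Sum>i\<in>{i. J $ i > 0}. J $ i * fact n)"
  proof (rule sum.cong[OF refl])
    fix i assume "i \<in> {i. J $ i > 0}"
    then have i: "J $ i > 0" by simp
    have "dec i \<in> multi_indices n"
    proof -
      have "(\<Sum>j\<in>UNIV. J $ j) = (\<Sum>j\<in>UNIV. dec i $ j + (if j = i then 1 else 0))"
        using i by (intro sum.cong) (auto simp: dec_def)
      also have "\<dots> = (\<Sum>j\<in>UNIV. dec i $ j) + 1" by (simp add: sum.distrib)
      finally show ?thesis using Suc.prems by (simp add: multi_indices_def)
    qed
    note IH = Suc.IH[OF this]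
    have "(\<Prod>j\<in>UNIV. fact (J $ j)) = fact (J $ i) * (\<Prod>j\<in>UNIV - {i}. fact (J $ j) :: nat)"
      by (rule prod.remove) auto
    also have "(\<Prod>j\<in>UNIV - {i}. fact (J $ j) :: nat) = (\<Prod>j\<in>UNIV - {i}. fact (dec i $ j))"
      by (intro prod.cong) (auto simp: dec_def)
    also have "fact (J $ i) = J $ i * fact (dec i $ i)"
      using i by (simp add: dec_def fact_reduce)
    also have "J $ i * fact (dec i $ i) * (\<Prod>j\<in>UNIV - {i}. fact (dec i $ j)) = J $ i * (\<Prod>j\<in>UNIV. fact (dec i $ j))"
      unfolding mult.assoc by (subst prod.remove[of UNIV i "\<lambda>j. fact (dec i $ j)"]) auto
    finally show "card (C n (dec i)) * (\<Prod>i\<in>UNIV. fact (J $ i)) = J $ i * fact n"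
      using IH by (simp only: C_def mult.left_commute)
  qed
  also have "\<dots> = (\<Sum>i\<in>UNIV. J $ i) * fact n"
    unfolding sum_distrib_right by (rule sum.mono_neutral_left) auto
  finally show ?case using Suc.prems unfolding C_def by (simp only: multi_indices_def mem_Collect_eq fact_Suc of_nat_id)
qed

lemma real_card_words_of_type:
  assumes "J \<in> multi_indices n"
  shows "real (card {w \<in> words n. type_of_word n w = J}) = multinomial n J"
proof -
  have "real (card {w \<in> words n. type_of_word n w = J}) * (\<Prod>i\<in>UNIV. fact (J $ i)) = fact n"
    using arg_cong[OF card_words_of_type[OF assms], of real] by simp
  moreover have "(\<Prod>i\<in>UNIV. fact (J $ i) :: real) > 0" by (intro prod_pos) auto
  ultimately show ?thesis by (simp add: multinomial_def field_simps)
qed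

lemma multinomial_pos: "multinomial n J > 0"
  unfolding multinomial_def by (intro divide_pos_pos prod_pos) auto

text \<open>A tensor \<open>\<beta>\<close> defines the random variable \<open>\<Sum>J. tensor_coeff n \<beta> J * a J\<close>. The field at \<open>x\<close> is the
variable of the tensor power of \<open>x\<close>. The point of passing to tensors is that the variance of this
variable is at most the square of the Euclidean norm of \<open>\<beta>\<close>, and that inner products of decomposable
tensors are products of inner products.\<close>

definition tensor_coeff :: "nat \<Rightarrow> ((nat \<Rightarrow> 3) \<Rightarrow> real) \<Rightarrow> nat^3 \<Rightarrow> real" where
  "tensor_coeff n \<beta> J = (\<Sum>w\<in>{w \<in> words n. type_of_word n w = J}. \<beta> w) / sqrt (multinomial n J)"

text \<open>Cauchy--Schwarz on each class of words of equal type: the class has \<open>multinomial n J\<close> elements.\<close>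

lemma sum_tensor_coeff_sq_le:
  "(\<Sum>J\<in>multi_indices n. (tensor_coeff n \<beta> J)\<^sup>2) \<le> (\<Sum>w\<in>words n. (\<beta> w)\<^sup>2)"
proof -
  have "(\<Sum>J\<in>multi_indices n. (tensor_coeff n \<beta> J)\<^sup>2)
     \<le> (\<Sum>J\<in>multi_indices n. \<Sum>w\<in>{w \<in> words n. type_of_word n w = J}. (\<beta> w)\<^sup>2)"
  proof (rule sum_mono)
    fix J assume J: "J \<in> multi_indices n"
    have "(\<Sum>w\<in>{w \<in> words n. type_of_word n w = J}. \<beta> w)\<^sup>2
      \<le> (\<Sum>w\<in>{w \<in> words n. type_of_word n w = J}. (\<beta> w)\<^sup>2) * multinomial n J"
      using Cauchy_Schwarz_ineq_sum[of \<beta> "\<lambda>_. 1" "{w \<in> words n. type_of_word n w = J}"]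
      by (simp add: real_card_words_of_type[OF J])
    then show "(tensor_coeff n \<beta> J)\<^sup>2 \<le> (\<Sum>w\<in>{w \<in> words n. type_of_word n w = J}. (\<beta> w)\<^sup>2)"
      using multinomial_pos[of n J] by (simp add: tensor_coeff_def power_divide pos_divide_le_eq less_imp_le)
  qed
  also have "\<dots> = (\<Sum>w\<in>words n. (\<beta> w)\<^sup>2)"
    by (rule sum.group) (auto simp: finite_multi_indices type_of_word_in)
  finally show ?thesis .
qed

lemma kostlan_eq_tensor_coeff:
  "kostlan n a x = (\<Sum>J\<in>multi_indices n. tensor_coeff n (\<lambda>w. \<Prod>k<n. x $ w k) J * a J)"
  unfolding kostlan_def
proof (rule sum.cong[OF refl])
  fix J assume J: "J \<in> multi_indices n"
  have "(\<Sum>w\<in>{w \<in> words n. type_of_word n w = J}. \<Prod>k<n. x $ w k)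
      = (\<Sum>w\<in>{w \<in> words n. type_of_word n w = J}. \<Prod>i\<in>UNIV. (x $ i) ^ (J $ i))"
    by (intro sum.cong) (auto simp: prod_word_eq_power)
  also have "\<dots> = multinomial n J * (\<Prod>i\<in>UNIV. (x $ i) ^ (J $ i))"
    by (simp add: real_card_words_of_type[OF J])
  finally show "sqrt (multinomial n J) * a J * (\<Prod>i\<in>UNIV. x $ i ^ J $ i) =
        tensor_coeff n (\<lambda>w. \<Prod>k<n. x $ w k) J * a J"
    using real_div_sqrt[of "multinomial n J"] multinomial_pos[of n J]
    by (simp only: tensor_coeff_def times_divide_eq_left[symmetric] less_imp_le mult_ac)
qed

lemma tensor_coeff_sum:
  "tensor_coeff n (\<lambda>w. \<Sum>i\<in>T. c i * \<beta> i w) J = (\<Sum>i\<in>T. c i * tensor_coeff n (\<beta> i) J)"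
  unfolding tensor_coeff_def
  by (subst sum.swap) (simp add: sum_distrib_left sum_divide_distrib)

text \<open>The reproducing property: the coefficients used here represent the function \<open>(x \<bullet> y) ^ n\<close> of \<open>x\<close>,
and pairing them with coefficients \<open>b\<close> evaluates the polynomial of \<open>b\<close> at \<open>y\<close>.\<close>

lemma kostlan_kernel:
  "kostlan n (\<lambda>J. sqrt (multinomial n J) * (\<Prod>i\<in>UNIV. (y $ i) ^ (J $ i))) x = (x \<bullet> y) ^ n"
proof -
  have "(x \<bullet> y) ^ n = (\<Sum>w\<in>words n. \<Prod>k<n. x $ w k * y $ w k)"
    by (subst sum_words_prod[of "\<lambda>_ i. x $ i * y $ i"]) (simp add: inner_vec_def)
  also have "\<dots> = (\<Sum>J\<in>multi_indices n. \<Sum>w\<in>{w \<in> words n. type_of_word n w = J}. \<Prod>k<n. x $ w k * y $ w k)"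
    by (rule sum.group[symmetric]) (auto simp: finite_multi_indices type_of_word_in)
  also have "\<dots> = (\<Sum>J\<in>multi_indices n. multinomial n J * ((\<Prod>i\<in>UNIV. (x $ i) ^ (J $ i)) * (\<Prod>i\<in>UNIV. (y $ i) ^ (J $ i))))"
  proof (rule sum.cong[OF refl])
    fix J assume J: "J \<in> multi_indices n"
    have "(\<Sum>w\<in>{w \<in> words n. type_of_word n w = J}. \<Prod>k<n. x $ w k * y $ w k)
      = (\<Sum>w\<in>{w \<in> words n. type_of_word n w = J}. (\<Prod>i\<in>UNIV. (x $ i) ^ (J $ i)) * (\<Prod>i\<in>UNIV. (y $ i) ^ (J $ i)))"
      by (intro sum.cong) (auto simp: prod.distrib prod_word_eq_power)
    then show "(\<Sum>w\<in>{w \<in> words n. type_of_word n w = J}. \<Prod>k<n. x $ w k * y $ w k) =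
      multinomial n J * ((\<Prod>i\<in>UNIV. (x $ i) ^ (J $ i)) * (\<Prod>i\<in>UNIV. (y $ i) ^ (J $ i)))"
      by (simp add: real_card_words_of_type[OF J])
  qed
  also have "\<dots> = kostlan n (\<lambda>J. sqrt (multinomial n J) * (\<Prod>i\<in>UNIV. (y $ i) ^ (J $ i))) x"
    unfolding kostlan_def
  proof (rule sum.cong[OF refl])
    fix J
    have "sqrt (multinomial n J) * (sqrt (multinomial n J) * v) * u = multinomial n J * (u * v)" for u v
      using multinomial_pos[of n J] by (simp flip: mult.assoc)
    then show "multinomial n J * ((\<Prod>i\<in>UNIV. (x $ i) ^ (J $ i)) * (\<Prod>i\<in>UNIV. (y $ i) ^ (J $ i))) =
      sqrt (multinomial n J) * (sqrt (multinomial n J) * (\<Prod>i\<in>UNIV. (y $ i) ^ (J $ i))) * (\<Prod>i\<in>UNIV. (x $ i) ^ (J $ i))"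
      by (simp only:)
  qed
  finally show ?thesis by simp
qed

section \<open>Jets of the field on tangent planes\<close>

text \<open>The letter \<open>None\<close> stands for the base point \<open>p\<close> and \<open>Some i\<close> for the projection of the \<open>i\<close>-th basis
vector to the tangent plane at \<open>p\<close>, in units of the correlation length. Using three spanning vectors of
the tangent plane avoids the choice of an orthonormal frame at each point.\<close>

definition letter :: "nat \<Rightarrow> real^3 \<Rightarrow> 3 option \<Rightarrow> real^3" where
  "letter n p a = (case a of None \<Rightarrow> p | Some i \<Rightarrow> (axis i 1 - p $ i *\<^sub>R p) /\<^sub>R sqrt (real n))"

definition exponent_of_word :: "nat \<Rightarrow> (nat \<Rightarrow> 3 option) \<Rightarrow> 3 \<Rightarrow> nat" where
  "exponent_of_word n v = (\<lambda>i. card {k\<in>{..<n}. v k = Some i})"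

definition exponents :: "nat \<Rightarrow> (3 \<Rightarrow> nat) set" where
  "exponents n = exponent_of_word n ` words n"

text \<open>The coefficient of the monomial with exponent \<open>\<alpha>\<close> in \<open>y\<close> of the tensor power of
\<open>letter n p None + (\<Sum>i\<in>UNIV. y i *\<^sub>R letter n p (Some i))\<close>.\<close>

definition jet :: "nat \<Rightarrow> real^3 \<Rightarrow> (3 \<Rightarrow> nat) \<Rightarrow> (nat \<Rightarrow> 3) \<Rightarrow> real" where
  "jet n p \<alpha> w = (\<Sum>v\<in>{v \<in> words n. exponent_of_word n v = \<alpha>}. \<Prod>k<n. letter n p (v k) $ w k)"

lemma finite_exponents [simp]: "finite (exponents n)"
  by (simp add: exponents_def)

lemma sum_option_UNIV: "(\<Sum>a\<in>UNIV. g a) = g None + (\<Sum>i\<in>UNIV. g (Some i :: 'l::finite option))"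
  unfolding UNIV_option_conv by (subst sum.insert) (auto simp: sum.reindex)

text \<open>The inner product is a sum over pairs of words of products of inner products of letters. Bounding
it by the sum of absolute values over all pairs of words gives a quantity that factorises; this loses
nothing that matters because the sum of the absolute values over the letters is itself close to
\<open>\<bar>p \<bullet> q\<bar>\<close>.\<close>

lemma jet_inner_le:
  "\<bar>\<Sum>w\<in>words n. jet n p \<alpha> w * jet n q \<beta> w\<bar>
     \<le> (\<Sum>a\<in>UNIV. \<Sum>b\<in>UNIV. \<bar>letter n p a \<bullet> letter n q b\<bar>) ^ n"
proof -
  let ?V = "\<lambda>\<alpha>. {v \<in> words n. exponent_of_word n v = \<alpha>}"
  have "(\<Sum>w\<in>words n. jet n p \<alpha> w * jet n q \<beta> w)
     = (\<Sum>w\<in>words n. \<Sum>v\<in>?V \<alpha>. \<Sum>v'\<in>?V \<beta>. \<Prod>k<n. letter n p (v k) $ w k * letter n q (v' k) $ w k)"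
    by (simp add: jet_def sum_product prod.distrib)
  also have "\<dots> = (\<Sum>v\<in>?V \<alpha>. \<Sum>v'\<in>?V \<beta>. \<Sum>w\<in>words n. \<Prod>k<n. letter n p (v k) $ w k * letter n q (v' k) $ w k)"
    by (subst sum.swap, rule sum.cong[OF refl], rule sum.swap)
  also have "\<dots> = (\<Sum>v\<in>?V \<alpha>. \<Sum>v'\<in>?V \<beta>. \<Prod>k<n. letter n p (v k) \<bullet> letter n q (v' k))"
    by (subst sum_words_prod[where g="\<lambda>k l. letter n p (v k) $ l * letter n q (v' k) $ l" for v v'])
       (simp add: inner_vec_def)
  finally have "\<bar>\<Sum>w\<in>words n. jet n p \<alpha> w * jet n q \<beta> w\<bar>
      = \<bar>\<Sum>v\<in>?V \<alpha>. \<Sum>v'\<in>?V \<beta>. \<Prod>k<n. letter n p (v k) \<bullet> letter n q (v' k)\<bar>"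
    by (rule arg_cong)
  also have "\<dots> \<le> (\<Sum>v\<in>?V \<alpha>. \<Sum>v'\<in>?V \<beta>. \<Prod>k<n. \<bar>letter n p (v k) \<bullet> letter n q (v' k)\<bar>)"
    unfolding abs_prod[symmetric] by (rule order_trans[OF sum_abs sum_mono]) (rule sum_abs)
  also have "\<dots> \<le> (\<Sum>v\<in>?V \<alpha>. \<Sum>v'\<in>words n. \<Prod>k<n. \<bar>letter n p (v k) \<bullet> letter n q (v' k)\<bar>)"
  proof (rule sum_mono)
    fix v
    show "(\<Sum>v'\<in>?V \<beta>. \<Prod>k<n. \<bar>letter n p (v k) \<bullet> letter n q (v' k)\<bar>) \<le> (\<Sum>v'\<in>words n. \<Prod>k<n. \<bar>letter n p (v k) \<bullet> letter n q (v' k)\<bar>)"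
    proof (rule sum_mono2)
      show "finite (words n :: (nat \<Rightarrow> 3 option) set)" by (rule finite_words)
      show "?V \<beta> \<subseteq> words n" by blast
      show "0 \<le> (\<Prod>k<n. \<bar>letter n p (v k) \<bullet> letter n q (v' k)\<bar>)" for v' by (rule prod_nonneg) (rule abs_ge_zero)
    qed
  qed
  also have "\<dots> \<le> (\<Sum>v\<in>words n. \<Sum>v'\<in>words n. \<Prod>k<n. \<bar>letter n p (v k) \<bullet> letter n q (v' k)\<bar>)"
  proof (rule sum_mono2)
    show "finite (words n :: (nat \<Rightarrow> 3 option) set)" by (rule finite_words)
    show "?V \<alpha> \<subseteq> words n" by blast
    show "0 \<le> (\<Sum>v'\<in>words n. \<Prod>k<n. \<bar>letter n p (v k) \<bullet> letter n q (v' k)\<bar>)" for v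
      by (rule sum_nonneg, rule prod_nonneg, rule abs_ge_zero)
  qed
  also have "\<dots> = (\<Sum>v\<in>words n. \<Prod>k<n. \<Sum>b\<in>UNIV. \<bar>letter n p (v k) \<bullet> letter n q b\<bar>)"
    by (subst sum_words_prod[where g="\<lambda>k b. \<bar>letter n p (v k) \<bullet> letter n q b\<bar>" for v]) simp
  also have "\<dots> = (\<Prod>k<n. \<Sum>a\<in>UNIV. \<Sum>b\<in>UNIV. \<bar>letter n p a \<bullet> letter n q b\<bar>)"
    by (rule sum_words_prod)
  finally show ?thesis unfolding prod_constant card_lessThan .
qed

lemma norm_tangent_sq:
  fixes p y :: "real^3"
  assumes "norm p = 1"
  shows "(norm (y - (y \<bullet> p) *\<^sub>R p))\<^sup>2 = (norm y)\<^sup>2 - (y \<bullet> p)\<^sup>2"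
proof -
  have "p \<bullet> p = 1" using assms by (simp add: dot_square_norm)
  then show ?thesis
    unfolding power2_norm_eq_inner
    by (simp add: inner_diff_left inner_diff_right inner_commute power2_eq_square
        algebra_simps)
qed

text \<open>With \<open>s\<close> the sine of the angle between \<open>p\<close> and \<open>q\<close> and \<open>r = 1 / sqrt n\<close>, the sum over the letters is at
most \<open>\<bar>p \<bullet> q\<bar> + 6 * r * s + 9 * r\<^sup>2\<close>: the letters \<open>Some i\<close> are tangential, so the mixed terms carry a
factor \<open>s\<close>, which can be absorbed by \<open>\<bar>p \<bullet> q\<bar> \<le> 1 - s\<^sup>2 / 2\<close> at the cost of \<open>36 * r\<^sup>2\<close>.\<close>

lemma letter_sum_le:
  fixes p q :: "real^3"
  assumes p: "p \<in> S2" and q: "q \<in> S2" and n: "n > 0"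
  shows "(\<Sum>a\<in>UNIV. \<Sum>b\<in>UNIV. \<bar>letter n p a \<bullet> letter n q b\<bar>) ^ n
     \<le> exp 45 * exp (- real n * (1 - (p \<bullet> q)\<^sup>2) / 4)"
proof -
  define c where "c = p \<bullet> q"
  define s where "s = sqrt (1 - c\<^sup>2)"
  define r where "r = 1 / sqrt (real n)"
  have np: "norm p = 1" "norm q = 1" using p q by auto
  have c: "\<bar>c\<bar> \<le> 1" unfolding c_def using abs_inner_S2[OF p q] .
  then have c2: "c\<^sup>2 \<le> 1" by (simp add: abs_square_le_1)
  then have s: "s \<ge> 0" "s\<^sup>2 = 1 - c\<^sup>2" by (auto simp: s_def)
  have r: "r > 0" "r\<^sup>2 = 1 / real n" using n by (auto simp: r_def power_divide)
  have tang: "\<bar>x \<bullet> letter n y (Some i)\<bar> \<le> r * s" if xy: "norm x = 1" "norm y = 1" "(x \<bullet> y)\<^sup>2 = c\<^sup>2" for x y i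
  proof -
    have "x \<bullet> letter n y (Some i) = r * ((x - (x \<bullet> y) *\<^sub>R y) $ i)"
      by (simp add: letter_def r_def inner_diff_right inner_axis algebra_simps divide_inverse)
    also have "\<bar>\<dots>\<bar> = r * \<bar>(x - (x \<bullet> y) *\<^sub>R y) $ i\<bar>" using r by (simp add: abs_mult)
    also have "\<dots> \<le> r * norm (x - (x \<bullet> y) *\<^sub>R y)"
      using r by (intro mult_left_mono component_le_norm_cart) auto
    also have "norm (x - (x \<bullet> y) *\<^sub>R y) = s"
      using norm_tangent_sq[OF xy(2), of x] xy s by (metis norm_ge_zero power2_eq_imp_eq power_one)
    finally show ?thesis .
  qed
  have nl: "norm (letter n y (Some i)) \<le> r" if "norm y = 1" for y i
  proof -
    have "(norm (axis i 1 - y $ i *\<^sub>R y))\<^sup>2 \<le> 1"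
      using norm_tangent_sq[OF that, of "axis i 1"] by (simp add: inner_axis' norm_axis_1)
    then have "norm (axis i 1 - y $ i *\<^sub>R y) \<le> 1" by (simp add: power_le_one_iff abs_square_le_1)
    then show ?thesis using r by (simp add: letter_def r_def divide_inverse mult_left_le)
  qed
  have tt: "\<bar>letter n p (Some i) \<bullet> letter n q (Some j)\<bar> \<le> r\<^sup>2" for i j
  proof -
    have "\<bar>letter n p (Some i) \<bullet> letter n q (Some j)\<bar> \<le> norm (letter n p (Some i)) * norm (letter n q (Some j))"
      by (rule Cauchy_Schwarz_ineq2)
    also have "\<dots> \<le> r * r" using nl np r by (intro mult_mono) auto
    finally show ?thesis by (simp add: power2_eq_square)
  qed
  have "(\<Sum>a\<in>UNIV. \<Sum>b\<in>UNIV. \<bar>letter n p a \<bullet> letter n q b\<bar>)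
     = \<bar>p \<bullet> q\<bar> + (\<Sum>j\<in>UNIV. \<bar>p \<bullet> letter n q (Some j)\<bar>) + (\<Sum>i\<in>UNIV. \<bar>q \<bullet> letter n p (Some i)\<bar>)
       + (\<Sum>i\<in>UNIV. \<Sum>j\<in>UNIV. \<bar>letter n p (Some i) \<bullet> letter n q (Some j)\<bar>)"
    by (simp add: sum_option_UNIV sum.distrib inner_commute) (simp add: letter_def)
  also have "\<dots> \<le> \<bar>c\<bar> + (\<Sum>j\<in>(UNIV::3 set). r * s) + (\<Sum>i\<in>(UNIV::3 set). r * s) + (\<Sum>i\<in>(UNIV::3 set). \<Sum>j\<in>(UNIV::3 set). r\<^sup>2)"
    by (intro add_mono sum_mono tang tt) (auto simp: np c_def inner_commute)
  also have "\<dots> = \<bar>c\<bar> + 6 * (r * s) + 9 * r\<^sup>2" by simp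
  also have "\<bar>c\<bar> \<le> 1 - s\<^sup>2 / 2"
  proof -
    have "\<bar>c\<bar> * 2 \<le> 1 + c\<^sup>2" using zero_le_power2[of "1 - \<bar>c\<bar>"] by (simp add: power2_diff)
    then show ?thesis unfolding s(2) by (simp add: field_simps)
  qed
  also have "6 * (r * s) \<le> s\<^sup>2 / 4 + 36 * r\<^sup>2"
    using zero_le_power2[of "s / 2 - 6 * r"] by (simp add: power2_diff power_divide power_mult_distrib mult_ac)
  finally have "(\<Sum>a\<in>UNIV. \<Sum>b\<in>UNIV. \<bar>letter n p a \<bullet> letter n q b\<bar>) \<le> 1 + (45 * r\<^sup>2 - s\<^sup>2 / 4)"
    by simp
  also have "\<dots> \<le> exp (45 * r\<^sup>2 - s\<^sup>2 / 4)" by (rule exp_ge_add_one_self)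
  finally have "(\<Sum>a\<in>UNIV. \<Sum>b\<in>UNIV. \<bar>letter n p a \<bullet> letter n q b\<bar>) ^ n \<le> exp (45 * r\<^sup>2 - s\<^sup>2 / 4) ^ n"
    by (intro power_mono sum_nonneg) auto
  also have "\<dots> = exp (45 * (real n * r\<^sup>2) - real n * s\<^sup>2 / 4)"
    by (simp only: exp_of_nat_mult[symmetric] right_diff_distrib mult.left_commute times_divide_eq_right)
  also have "45 * (real n * r\<^sup>2) - real n * s\<^sup>2 / 4 = 45 + - real n * (1 - (p \<bullet> q)\<^sup>2) / 4"
    using n by (simp add: r(2) s(2) c_def)
  also have "exp \<dots> = exp 45 * exp (- real n * (1 - (p \<bullet> q)\<^sup>2) / 4)"
    by (rule exp_add)
  finally show ?thesis .
qed

text \<open>The Gaussian profile, on the scale of the correlation length, of the covariance bounds.\<close>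

definition near :: "nat \<Rightarrow> real^3 \<Rightarrow> real" where
  "near n y = exp (- real n * (norm y)\<^sup>2 / 8)"

text \<open>The sine of the angle is comparable to the smaller of the distances of \<open>q\<close> from \<open>p\<close> and from \<open>- p\<close>.\<close>

lemma exp_sin_sq_le_near:
  assumes p: "p \<in> S2" and q: "q \<in> S2"
  shows "exp (- real n * (1 - (p \<bullet> q)\<^sup>2) / 4) \<le> near n (q - p) + near n (q - (- p))"
proof -
  define c where "c = p \<bullet> q"
  have c: "- 1 \<le> c" "c \<le> 1" unfolding c_def using abs_inner_S2[OF p q] by auto
  have np: "p \<bullet> p = 1" "q \<bullet> q = 1" using p q by (auto simp: dot_square_norm)
  have m: "(norm (q - p))\<^sup>2 = 2 - 2 * c" and a: "(norm (q - (- p)))\<^sup>2 = 2 + 2 * c"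
    using np by (simp_all add: power2_norm_eq_inner c_def inner_diff_left inner_diff_right
         inner_add_left inner_add_right inner_commute)
  show ?thesis
  proof (cases "c \<ge> 0")
    case True
    have "(1 - c\<^sup>2) \<ge> 1 - c" using c True by (simp add: power2_eq_square mult_left_le)
    then have "real n * (1 - c) \<le> real n * (1 - c\<^sup>2)" by (intro mult_left_mono) auto
    then have "exp (- real n * (1 - c\<^sup>2) / 4) \<le> near n (q - p)"
      unfolding near_def m exp_le_cancel_iff by (simp add: field_simps)
    then show ?thesis by (simp add: near_def c_def add_increasing2)
  next
    case False
    have "c * c \<le> - c * 1" using c False mult_left_mono_neg[of "-1" c c] by simp
    then have "(1 - c\<^sup>2) \<ge> 1 + c" by (simp add: power2_eq_square)
    then have "real n * (1 + c) \<le> real n * (1 - c\<^sup>2)" by (intro mult_left_mono) auto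
    then have "exp (- real n * (1 - c\<^sup>2) / 4) \<le> near n (q - (- p))"
      unfolding near_def a exp_le_cancel_iff by (simp add: field_simps)
    then show ?thesis by (simp add: near_def c_def add_increasing)
  qed
qed

text \<open>The Taylor expansion: \<open>x\<close> is the multiple by \<open>x \<bullet> p\<close> of a point \<open>p + u\<close> of the tangent plane at \<open>p\<close>,
the numbers \<open>z i\<close> are the coordinates of \<open>u\<close> in units of \<open>1 / sqrt n\<close>, and projecting the basis vectors to
the tangent plane does not change \<open>u\<close>.\<close>

lemma tensor_eq_sum_jet:
  fixes x p :: "real^3"
  assumes p: "p \<in> S2" and n: "n > 0" and c: "x \<bullet> p \<noteq> 0"
  defines "z \<equiv> \<lambda>i. sqrt (real n) * (x $ i / (x \<bullet> p) - p $ i)"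
  shows "(\<Prod>k<n. x $ w k) = (x \<bullet> p) ^ n * (\<Sum>\<alpha>\<in>exponents n. (\<Prod>i\<in>UNIV. z i ^ \<alpha> i) * jet n p \<alpha> w)"
proof -
  define c where "c = x \<bullet> p"
  define \<zeta> where "\<zeta> a = (case a of None \<Rightarrow> 1 | Some i \<Rightarrow> z i)" for a
  have sn: "sqrt (real n) \<noteq> 0" using n by simp
  have pp: "p \<bullet> p = 1" using p by (auto simp: dot_square_norm)
  have "(\<Sum>i\<in>UNIV. (x $ i / c - p $ i) * p $ i) = 0"
  proof -
    have "(\<Sum>i\<in>UNIV. (x $ i / c - p $ i) * p $ i) = (\<Sum>i\<in>UNIV. x $ i * p $ i) / c - (\<Sum>i\<in>UNIV. p $ i * p $ i)"
      by (simp add: left_diff_distrib sum_subtractf sum_divide_distrib)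
    also have "\<dots> = c / c - 1" using pp by (simp add: c_def inner_vec_def)
    finally show ?thesis using c by (simp add: c_def)
  qed
  then have orth: "(\<Sum>i\<in>UNIV. (x $ i / c - p $ i) * (p $ i * y)) = 0" for y
    by (simp add: mult.assoc[symmetric] flip: sum_distrib_right)
  \<comment> \<open>The factors \<open>sqrt n\<close> in the coordinates and \<open>1 / sqrt n\<close> in the letters cancel.\<close>
  have zi: "z i * (y / sqrt (real n)) = (x $ i / c - p $ i) * y" for i y
    using sn by (simp add: z_def c_def)
  have lin: "x $ j = c * (\<Sum>a\<in>UNIV. \<zeta> a * letter n p a $ j)" for j
  proof -
    have "(\<Sum>a\<in>UNIV. \<zeta> a * letter n p a $ j) = p $ j + (\<Sum>i\<in>UNIV. z i * ((axis i 1 $ j - p $ i * p $ j) / sqrt (real n)))"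
      by (simp add: sum_option_UNIV \<zeta>_def letter_def divide_inverse mult_ac)
    also have "\<dots> = p $ j + (\<Sum>i\<in>UNIV. (x $ i / c - p $ i) * axis i 1 $ j - (x $ i / c - p $ i) * (p $ i * p $ j))"
      by (simp only: zi right_diff_distrib)
    also have "\<dots> = p $ j + (\<Sum>i\<in>UNIV. (x $ i / c - p $ i) * axis i 1 $ j)"
      by (simp only: sum_subtractf orth)
    also have "\<dots> = x $ j / c" by (simp add: axis_def if_distrib cong: if_cong)
    finally show ?thesis using c by (simp add: c_def)
  qed
  have \<zeta>prod: "(\<Prod>k<n. \<zeta> (v k)) = (\<Prod>i\<in>UNIV. z i ^ exponent_of_word n v i)" for v
  proof -
    have "(\<Prod>i\<in>UNIV. z i ^ exponent_of_word n v i) = (\<Prod>a\<in>UNIV. \<Prod>k\<in>{k\<in>{..<n}. v k = a}. \<zeta> (v k))"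
    proof -
      have "(\<Prod>a\<in>UNIV. \<Prod>k\<in>{k\<in>{..<n}. v k = a}. \<zeta> (v k)) = (\<Prod>a\<in>UNIV. \<zeta> a ^ card {k\<in>{..<n}. v k = a})"
        by (intro prod.cong) auto
      also have "\<dots> = (\<Prod>i\<in>UNIV. z i ^ exponent_of_word n v i)"
        unfolding UNIV_option_conv by (subst prod.insert) (auto simp: prod.reindex \<zeta>_def exponent_of_word_def)
      finally show ?thesis by simp
    qed
    also have "\<dots> = (\<Prod>k<n. \<zeta> (v k))" by (rule prod.group) auto
    finally show ?thesis by simp
  qed
  have "(\<Prod>k<n. x $ w k) = (\<Prod>k<n. c * (\<Sum>a\<in>UNIV. \<zeta> a * letter n p a $ w k))"
    using lin by simp
  also have "\<dots> = c ^ n * (\<Prod>k<n. \<Sum>a\<in>UNIV. \<zeta> a * letter n p a $ w k)"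
    by (simp add: prod.distrib)
  also have "(\<Prod>k<n. \<Sum>a\<in>UNIV. \<zeta> a * letter n p a $ w k) = (\<Sum>v\<in>words n. \<Prod>k<n. \<zeta> (v k) * letter n p (v k) $ w k)"
    by (rule sum_words_prod[symmetric])
  also have "\<dots> = (\<Sum>v\<in>words n. (\<Prod>i\<in>UNIV. z i ^ exponent_of_word n v i) * (\<Prod>k<n. letter n p (v k) $ w k))"
    by (simp add: prod.distrib \<zeta>prod)
  also have "\<dots> = (\<Sum>\<alpha>\<in>exponents n. \<Sum>v\<in>{v\<in>words n. exponent_of_word n v = \<alpha>}.
       (\<Prod>i\<in>UNIV. z i ^ exponent_of_word n v i) * (\<Prod>k<n. letter n p (v k) $ w k))"
    unfolding exponents_def by (rule sum.image_gen) simp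
  also have "\<dots> = (\<Sum>\<alpha>\<in>exponents n. (\<Prod>i\<in>UNIV. z i ^ \<alpha> i) * jet n p \<alpha> w)"
    unfolding jet_def sum_distrib_left by (intro sum.cong) auto
  finally show ?thesis by (simp add: c_def)
qed

lemma sum_exponents_le:
  fixes \<theta> :: real
  assumes "0 \<le> \<theta>" "\<theta> < 1"
  shows "(\<Sum>\<alpha>\<in>exponents n. \<Prod>i\<in>UNIV. \<theta> ^ \<alpha> i) \<le> (1 / (1 - \<theta>)) ^ 3"
proof -
  have "exponents n \<subseteq> (\<Pi>\<^sub>E i\<in>UNIV. {..n})"
  proof -
    have "exponent_of_word n v i \<le> n" for v i
      using card_mono[of "{..<n}" "{k\<in>{..<n}. v k = Some i}"] by (auto simp: exponent_of_word_def)
    then show ?thesis by (auto simp: exponents_def)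
  qed
  then have "(\<Sum>\<alpha>\<in>exponents n. \<Prod>i\<in>UNIV. \<theta> ^ \<alpha> i) \<le> (\<Sum>\<alpha>\<in>(\<Pi>\<^sub>E i\<in>(UNIV::3 set). {..n}). \<Prod>i\<in>UNIV. \<theta> ^ \<alpha> i)"
    using assms by (intro sum_mono2 finite_PiE prod_nonneg) auto
  also have "\<dots> = (\<Prod>i\<in>(UNIV::3 set). \<Sum>k\<le>n. \<theta> ^ k)"
    by (rule prod_sum_PiE[symmetric]) auto
  also have "\<dots> = (\<Sum>k\<le>n. \<theta> ^ k) ^ 3" by simp
  also have "\<dots> \<le> (1 / (1 - \<theta>)) ^ 3"
  proof (rule power_mono)
    have "(\<Sum>k\<le>n. \<theta> ^ k) \<le> (\<Sum>k. \<theta> ^ k)"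
      using assms by (intro sum_le_suminf) (auto simp: summable_geometric_iff)
    then show "(\<Sum>k\<le>n. \<theta> ^ k) \<le> 1 / (1 - \<theta>)"
      using assms by (simp add: suminf_geometric)
  qed (use assms in \<open>auto intro: sum_nonneg\<close>)
  finally show ?thesis .
qed

section \<open>Small balls and shifts for the ensemble\<close>

text \<open>The radius \<open>1 / (16 * sqrt n)\<close> makes the rescaled coordinates at most \<open>1 / 8\<close>, while the jets
grow at most by a factor \<open>4\<close> per degree; the remaining geometric series of ratio \<open>1 / 2\<close> in three variables
sums to at most \<open>8\<close>.\<close>

lemma kostlan_le_of_jets:
  assumes x: "x \<in> S2" and p: "p \<in> S2" and n: "n > 0"
    and d: "norm (x - p) \<le> 1 / (16 * sqrt (real n))"
    and jets: "\<And>\<alpha>. \<alpha> \<in> exponents n \<Longrightarrow>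
       \<bar>\<Sum>J\<in>multi_indices n. tensor_coeff n (jet n p \<alpha>) J * a J\<bar> \<le> B * (\<Prod>i\<in>UNIV. 4 ^ \<alpha> i)"
  shows "\<bar>kostlan n a x\<bar> \<le> 8 * B"
proof -
  define c where "c = x \<bullet> p"
  define z where "z i = sqrt (real n) * (x $ i / c - p $ i)" for i
  define X where "X \<alpha> = (\<Sum>J\<in>multi_indices n. tensor_coeff n (jet n p \<alpha>) J * a J)" for \<alpha>
  have sn: "sqrt (real n) \<ge> 1" using n by simp
  have nn: "x \<bullet> x = 1" "p \<bullet> p = 1" using x p by (auto simp: dot_square_norm)
  have dd: "(norm (x - p))\<^sup>2 = 2 - 2 * c"
    unfolding power2_norm_eq_inner by (simp add: nn c_def inner_diff_left inner_diff_right inner_commute)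
  have d1: "norm (x - p) \<le> 1"
  proof -
    have "1 \<le> 16 * sqrt (real n)" using sn by linarith
    then have "1 / (16 * sqrt (real n)) \<le> 1" by (intro divide_le_eq_1_pos[THEN iffD2]) (use n in auto)
    then show ?thesis using d by linarith
  qed
  then have c12: "c \<ge> 1 / 2" using dd power_le_one[OF norm_ge_zero d1, of 2] by simp
  have c1: "c \<le> 1" using dd zero_le_power2[of "norm (x - p)"] by simp
  have u: "norm (x /\<^sub>R c - p) \<le> 2 * norm (x - p)"
  proof (rule power2_le_imp_le)
    have e: "(norm (x /\<^sub>R c - p))\<^sup>2 = 1 / c\<^sup>2 - 1"
      unfolding power2_norm_eq_inner using c12
      by (simp add: nn c_def[symmetric] inner_diff_left inner_diff_right inner_commute[of p x])
         (simp add: power2_eq_square divide_simps)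
    \<comment> \<open>This is \<open>(1 - c\<^sup>2) / c\<^sup>2 \<le> 4 * (2 - 2 * c)\<close>, valid because \<open>c \<ge> 1 / 2\<close>.\<close>
    have "(1 - c) * (1 + c) \<le> (1 - c) * (8 * c\<^sup>2)"
    proof (rule mult_left_mono)
      have "c * (1/2) \<le> c * c" using c12 by (intro mult_left_mono) auto
      then show "1 + c \<le> 8 * c\<^sup>2" using c12 unfolding power2_eq_square by linarith
    qed (use c1 in simp)
    then have "1 - c\<^sup>2 \<le> (8 - 8 * c) * c\<^sup>2" by (simp add: power2_eq_square algebra_simps)
    then have "(1 - c\<^sup>2) / c\<^sup>2 \<le> 8 - 8 * c" using c12 by (simp add: pos_divide_le_eq)
    moreover have "(1 - c\<^sup>2) / c\<^sup>2 = 1 / c\<^sup>2 - 1" using c12 by (simp add: diff_divide_distrib)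
    ultimately show "(norm (x /\<^sub>R c - p))\<^sup>2 \<le> (2 * norm (x - p))\<^sup>2"
      unfolding e power_mult_distrib dd by simp
  qed simp
  have z: "\<bar>z i\<bar> \<le> 1 / 8" for i
  proof -
    have "z i = sqrt (real n) * ((x /\<^sub>R c - p) $ i)" by (simp add: z_def divide_inverse mult.commute)
    then have "\<bar>z i\<bar> = sqrt (real n) * \<bar>(x /\<^sub>R c - p) $ i\<bar>" by (simp add: abs_mult)
    also have "\<dots> \<le> sqrt (real n) * (2 * (1 / (16 * sqrt (real n))))"
    proof (rule mult_left_mono)
      show "\<bar>(x /\<^sub>R c - p) $ i\<bar> \<le> 2 * (1 / (16 * sqrt (real n)))"
        by (rule order_trans[OF component_le_norm_cart order_trans[OF u mult_left_mono[OF d]]]) simp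
    qed simp
    also have "\<dots> = 1 / 8" using n by simp
    finally show ?thesis .
  qed
  have "(\<lambda>w. \<Prod>k<n. x $ w k) = (\<lambda>w. \<Sum>\<alpha>\<in>exponents n. (c ^ n * (\<Prod>i\<in>UNIV. z i ^ \<alpha> i)) * jet n p \<alpha> w)"
    using tensor_eq_sum_jet[OF p n, of x] c12
    by (simp add: c_def[symmetric] z_def[symmetric] sum_distrib_left mult.assoc fun_eq_iff)
  then have "kostlan n a x = (\<Sum>J\<in>multi_indices n. \<Sum>\<alpha>\<in>exponents n.
      c ^ n * (\<Prod>i\<in>UNIV. z i ^ \<alpha> i) * (tensor_coeff n (jet n p \<alpha>) J * a J))"
    by (simp only: kostlan_eq_tensor_coeff tensor_coeff_sum) (simp only: sum_distrib_right mult.assoc)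
  also have "\<dots> = (\<Sum>\<alpha>\<in>exponents n. c ^ n * (\<Prod>i\<in>UNIV. z i ^ \<alpha> i) * X \<alpha>)"
    unfolding X_def sum_distrib_left by (rule sum.swap)
  finally have "\<bar>kostlan n a x\<bar> = \<bar>\<Sum>\<alpha>\<in>exponents n. c ^ n * (\<Prod>i\<in>UNIV. z i ^ \<alpha> i) * X \<alpha>\<bar>" by simp
  also have "\<dots> \<le> (\<Sum>\<alpha>\<in>exponents n. \<bar>c ^ n * (\<Prod>i\<in>UNIV. z i ^ \<alpha> i) * X \<alpha>\<bar>)" by (rule sum_abs)
  also have "\<dots> \<le> (\<Sum>\<alpha>\<in>exponents n. B * (\<Prod>i\<in>UNIV. (1/2) ^ \<alpha> i))"
  proof (rule sum_mono)
    fix \<alpha> assume \<alpha>: "\<alpha> \<in> exponents n"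
    have "\<bar>c ^ n * (\<Prod>i\<in>UNIV. z i ^ \<alpha> i) * X \<alpha>\<bar> = (c ^ n) * (\<Prod>i\<in>UNIV. \<bar>z i\<bar> ^ \<alpha> i) * \<bar>X \<alpha>\<bar>"
      using c12 by (simp add: abs_mult abs_prod power_abs)
    also have "\<dots> \<le> 1 * (\<Prod>i\<in>UNIV. (1/8) ^ \<alpha> i) * (B * (\<Prod>i\<in>UNIV. 4 ^ \<alpha> i))"
      using c12 c1 z jets[OF \<alpha>] unfolding X_def
      by (intro mult_mono prod_mono conjI power_mono power_le_one zero_le_power prod_nonneg mult_nonneg_nonneg) auto
    also have "\<dots> = B * (\<Prod>i\<in>UNIV. (1/8) ^ \<alpha> i * 4 ^ \<alpha> i)"
      by (simp only: prod.distrib mult_1 mult_ac)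
    also have "\<dots> = B * (\<Prod>i\<in>UNIV. (1/2) ^ \<alpha> i)"
      by (simp add: power_mult_distrib[symmetric])
    finally show "\<bar>c ^ n * (\<Prod>i\<in>UNIV. z i ^ \<alpha> i) * X \<alpha>\<bar> \<le> B * (\<Prod>i\<in>UNIV. (1/2) ^ \<alpha> i)" .
  qed
  also have "\<dots> = B * (\<Sum>\<alpha>\<in>exponents n. \<Prod>i\<in>UNIV. (1/2) ^ \<alpha> i)" by (simp add: sum_distrib_left)
  also have "\<dots> \<le> B * 8"
  proof (rule mult_left_mono)
    show "(\<Sum>\<alpha>\<in>exponents n. \<Prod>i\<in>UNIV. (1/2) ^ \<alpha> i) \<le> (8::real)"
      using sum_exponents_le[of "1/2" n] by simp
    have "exponents n \<noteq> {}" by (auto simp: exponents_def words_def PiE_eq_empty_iff)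
    then obtain \<alpha> where "\<alpha> \<in> exponents n" by auto
    then have "0 \<le> B * (\<Prod>i\<in>UNIV. 4 ^ \<alpha> i)" using jets by (meson abs_ge_zero order_trans)
    moreover have "(\<Prod>i\<in>UNIV. 4 ^ \<alpha> i) > (0::real)" by (intro prod_pos) auto
    ultimately show "0 \<le> B" by (simp add: zero_le_mult_iff)
  qed
  finally show ?thesis by simp
qed

text \<open>Up to a constant factor, the row sum at \<open>p\<close> of the covariance bounds. The covariance of an even field is as large at the antipode of \<open>p\<close> as at \<open>p\<close> itself, hence the second term.\<close>

definition crowding :: "nat \<Rightarrow> (real^3) set \<Rightarrow> real^3 \<Rightarrow> real" where
  "crowding n P p = (\<Sum>q\<in>P. near n (q - p) + near n (q - (- p)))"

lemma near_sym: "near n (q - p) = near n (p - q)" "near n (q - (- p)) = near n (p - (- q))"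
  by (simp_all add: near_def norm_minus_commute add.commute)

lemma near_nonneg: "near n y \<ge> 0" by (simp add: near_def)

text \<open>Diagonal domination by the estimate \<open>2 * \<bar>l t * l t'\<bar> \<le> (l t)\<^sup>2 + (l t')\<^sup>2\<close>: by symmetry the diagonal
entry at \<open>t\<close> is the sum of the bounds in its row. The row sum over the exponents is finite because of
the weights, the row sum over the points is the crowding, and one weight remains as the decay in the
degree.\<close>

lemma jet_combination_variance_le:
  fixes l :: "(real^3) \<times> (3 \<Rightarrow> nat) \<Rightarrow> real"
  assumes P: "finite P" "P \<subseteq> S2" and n: "n > 0"
    and C: "\<And>p. p \<in> P \<Longrightarrow> crowding n P p \<le> C"
  shows "(\<Sum>J\<in>multi_indices n. (\<Sum>t\<in>P \<times> exponents n.
            l t * (\<kappa> * (\<Prod>i\<in>UNIV. (1/4) ^ snd t i) * tensor_coeff n (jet n (fst t) (snd t)) J))\<^sup>2)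
     \<le> (\<Sum>t\<in>P \<times> exponents n. 8 * exp 45 * C * \<kappa>\<^sup>2 * (\<Prod>i\<in>UNIV. (1/4) ^ snd t i) * (l t)\<^sup>2)"
proof -
  define T where "T = P \<times> exponents n"
  have T: "finite T" using P by (simp add: T_def)
  define g :: "(real^3) \<times> (3 \<Rightarrow> nat) \<Rightarrow> real" where "g t = (\<Prod>i\<in>UNIV. (1/4) ^ snd t i)" for t
  have g: "g t \<ge> 0" for t unfolding g_def by (intro prod_nonneg) auto
  define N where "N p q = exp 45 * (near n (q - p) + near n (q - (- p)))" for p q
  have N: "N p q \<ge> 0" "N p q = N q p" for p q
    using near_sym[of n q p] by (auto simp: N_def near_nonneg)
  define m where "m t = l t * (\<kappa> * g t)" for t
  have inner: "\<bar>\<Sum>w\<in>words n. jet n (fst t) (snd t) w * jet n (fst t') (snd t') w\<bar> \<le> N (fst t) (fst t')"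
    if "t \<in> T" "t' \<in> T" for t t'
  proof -
    have S: "fst t \<in> S2" "fst t' \<in> S2" using that P by (auto simp: T_def)
    have "\<bar>\<Sum>w\<in>words n. jet n (fst t) (snd t) w * jet n (fst t') (snd t') w\<bar>
      \<le> exp 45 * exp (- real n * (1 - (fst t \<bullet> fst t')\<^sup>2) / 4)"
      by (rule order_trans[OF jet_inner_le letter_sum_le[OF S n]])
    also have "\<dots> \<le> N (fst t) (fst t')"
      unfolding N_def by (intro mult_left_mono exp_sin_sq_le_near S) auto
    finally show ?thesis .
  qed
  have "(\<Sum>J\<in>multi_indices n. (\<Sum>t\<in>T. l t * (\<kappa> * g t * tensor_coeff n (jet n (fst t) (snd t)) J))\<^sup>2)
      = (\<Sum>J\<in>multi_indices n. (tensor_coeff n (\<lambda>w. \<Sum>t\<in>T. m t * jet n (fst t) (snd t) w) J)\<^sup>2)"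
    by (simp only: tensor_coeff_sum) (simp only: m_def mult.assoc)
  also have "\<dots> \<le> (\<Sum>w\<in>words n. (\<Sum>t\<in>T. m t * jet n (fst t) (snd t) w)\<^sup>2)"
    by (rule sum_tensor_coeff_sq_le)
  also have "\<dots> = (\<Sum>w\<in>words n. \<Sum>t\<in>T. \<Sum>t'\<in>T. m t * m t' * (jet n (fst t) (snd t) w * jet n (fst t') (snd t') w))"
    by (simp add: power2_eq_square sum_product mult_ac)
  also have "\<dots> = (\<Sum>t\<in>T. \<Sum>w\<in>words n. \<Sum>t'\<in>T. m t * m t' * (jet n (fst t) (snd t) w * jet n (fst t') (snd t') w))"
    by (rule sum.swap)
  also have "\<dots> = (\<Sum>t\<in>T. \<Sum>t'\<in>T. m t * m t' * (\<Sum>w\<in>words n. jet n (fst t) (snd t) w * jet n (fst t') (snd t') w))"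
    unfolding sum_distrib_left by (rule sum.cong[OF refl], rule sum.swap)
  also have "\<dots> \<le> (\<Sum>t\<in>T. \<Sum>t'\<in>T. \<kappa>\<^sup>2 * (g t * g t' * N (fst t) (fst t') * (((l t)\<^sup>2 + (l t')\<^sup>2) / 2)))"
  proof (intro sum_mono)
    fix t t' assume t: "t \<in> T" "t' \<in> T"
    have "m t * m t' * (\<Sum>w\<in>words n. jet n (fst t) (snd t) w * jet n (fst t') (snd t') w)
      \<le> \<bar>m t * m t'\<bar> * \<bar>\<Sum>w\<in>words n. jet n (fst t) (snd t) w * jet n (fst t') (snd t') w\<bar>"
      by (simp only: abs_mult[symmetric] abs_ge_self)
    also have "\<dots> \<le> \<bar>m t * m t'\<bar> * N (fst t) (fst t')"
      by (intro mult_left_mono inner t) auto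
    also have "\<bar>m t * m t'\<bar> = \<kappa>\<^sup>2 * (g t * g t') * \<bar>l t * l t'\<bar>"
      using g by (simp add: m_def abs_mult power2_eq_square mult_ac)
    also have "\<kappa>\<^sup>2 * (g t * g t') * \<bar>l t * l t'\<bar> * N (fst t) (fst t')
       \<le> \<kappa>\<^sup>2 * (g t * g t') * (((l t)\<^sup>2 + (l t')\<^sup>2) / 2) * N (fst t) (fst t')"
    proof (intro mult_right_mono mult_left_mono)
      show "\<bar>l t * l t'\<bar> \<le> ((l t)\<^sup>2 + (l t')\<^sup>2) / 2"
        using zero_le_power2[of "\<bar>l t\<bar> - \<bar>l t'\<bar>"] by (simp add: power2_diff abs_mult)
    qed (auto simp: g N)
    finally show "m t * m t' * (\<Sum>w\<in>words n. jet n (fst t) (snd t) w * jet n (fst t') (snd t') w)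
       \<le> \<kappa>\<^sup>2 * (g t * g t' * N (fst t) (fst t') * (((l t)\<^sup>2 + (l t')\<^sup>2) / 2))"
      by (simp only: mult_ac)
  qed
  also have "\<dots> = \<kappa>\<^sup>2 * ((\<Sum>t\<in>T. \<Sum>t'\<in>T. g t * g t' * N (fst t) (fst t') * (l t)\<^sup>2) / 2
                    + (\<Sum>t\<in>T. \<Sum>t'\<in>T. g t * g t' * N (fst t) (fst t') * (l t')\<^sup>2) / 2)"
    by (simp add: sum_distrib_left sum_divide_distrib sum.distrib[symmetric] add_divide_distrib distrib_left)
  also have "(\<Sum>t\<in>T. \<Sum>t'\<in>T. g t * g t' * N (fst t) (fst t') * (l t')\<^sup>2)
      = (\<Sum>t\<in>T. \<Sum>t'\<in>T. g t * g t' * N (fst t) (fst t') * (l t)\<^sup>2)"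
    by (subst sum.swap) (simp only: N(2) mult.commute[of "g _" "g _"])
  also have "\<kappa>\<^sup>2 * (X / 2 + X / 2) = \<kappa>\<^sup>2 * X" for X by simp
  also have "\<kappa>\<^sup>2 * (\<Sum>t\<in>T. \<Sum>t'\<in>T. g t * g t' * N (fst t) (fst t') * (l t)\<^sup>2)
      = (\<Sum>t\<in>T. \<kappa>\<^sup>2 * g t * (l t)\<^sup>2 * (\<Sum>t'\<in>T. N (fst t) (fst t') * g t'))"
    by (simp only: sum_distrib_left mult_ac)
  also have "\<dots> \<le> (\<Sum>t\<in>T. \<kappa>\<^sup>2 * g t * (l t)\<^sup>2 * (8 * exp 45 * C))"
  proof (rule sum_mono, rule mult_left_mono)
    fix t assume t: "t \<in> T"
    have "(\<Sum>t'\<in>T. N (fst t) (fst t') * g t') = (\<Sum>q\<in>P. \<Sum>\<alpha>\<in>exponents n. N (fst t) q * (\<Prod>i\<in>UNIV. (1/4) ^ \<alpha> i))"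
      unfolding T_def g_def by (simp add: sum.cartesian_product case_prod_unfold)
    also have "\<dots> = (\<Sum>q\<in>P. N (fst t) q) * (\<Sum>\<alpha>\<in>exponents n. \<Prod>i\<in>UNIV. (1/4) ^ \<alpha> i)"
      by (simp add: sum_product)
    also have "\<dots> \<le> (\<Sum>q\<in>P. N (fst t) q) * 8"
    proof (rule mult_left_mono)
      have "(\<Sum>\<alpha>\<in>exponents n. \<Prod>i\<in>UNIV. (1/4) ^ \<alpha> i) \<le> (4/3::real) ^ 3"
        using sum_exponents_le[of "1/4" n] by simp
      also have "\<dots> \<le> 8" by (simp add: power3_eq_cube)
      finally show "(\<Sum>\<alpha>\<in>exponents n. \<Prod>i\<in>UNIV. (1/4) ^ \<alpha> i) \<le> (8::real)" .
    qed (intro sum_nonneg N)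
    also have "(\<Sum>q\<in>P. N (fst t) q) = exp 45 * crowding n P (fst t)"
      by (simp add: N_def crowding_def sum_distrib_left)
    also have "exp 45 * crowding n P (fst t) * 8 \<le> exp 45 * C * 8"
      using C[of "fst t"] t by (auto simp: T_def)
    finally show "(\<Sum>t'\<in>T. N (fst t) (fst t') * g t') \<le> 8 * exp 45 * C" by simp
  qed (simp add: g)
  finally show ?thesis unfolding T_def[symmetric] g_def by (simp only: mult_ac)
qed

lemma multi_indices_nonempty: "multi_indices n \<noteq> {}"
  using type_of_word_in[of n "\<lambda>_. 0"] by blast

text \<open>Only the coefficients in \<open>multi_indices n\<close> are random variables. Setting the others to \<open>0\<close> gives a
measurable map to the space of all coefficient functions, whose topology is that of pointwise convergence.\<close>

definition cut :: "nat \<Rightarrow> (nat^3 \<Rightarrow> real) \<Rightarrow> nat^3 \<Rightarrow> real" where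
  "cut n b = (\<lambda>J. if J \<in> multi_indices n then b J else 0)"

lemma kostlan_cut [simp]: "kostlan n (cut n b) = kostlan n b"
  by (rule ext) (auto simp: kostlan_def cut_def intro!: sum.cong)

lemma kostlan_restrict [simp]: "kostlan n (\<lambda>J\<in>multi_indices n. b J) = kostlan n b"
  by (rule ext) (auto simp: kostlan_def intro!: sum.cong)

lemma kostlan_add: "kostlan n (\<lambda>J. b J + h J) x = kostlan n b x + kostlan n h x"
  by (simp add: kostlan_def sum.distrib[symmetric] algebra_simps)

lemma kostlan_sum: "kostlan n (\<lambda>J. c * (\<Sum>p\<in>P. g p J)) x = c * (\<Sum>p\<in>P. kostlan n (g p) x)"
  unfolding kostlan_def sum_distrib_left sum_distrib_right
  by (subst sum.swap) (simp add: mult_ac)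

lemma continuous_kostlan_coeffs: "continuous_on A (\<lambda>b. kostlan n b x)"
  unfolding kostlan_def by (intro continuous_intros continuous_on_product_then_coordinatewise[OF continuous_on_id])

lemma closed_kostlan_ge: "closed {b. \<forall>x\<in>E. \<tau> \<le> \<sigma> * kostlan n b x}"
  unfolding Collect_ball_eq
  by (intro closed_INT ballI closed_Collect_le continuous_intros continuous_kostlan_coeffs)

lemma measurable_cut_PiM: "cut n \<in> borel_measurable (Pi\<^sub>M (multi_indices n) (\<lambda>_. borel))"
proof (rule measurable_coordinatewise_then_product)
  fix J
  show "(\<lambda>b. cut n b J) \<in> borel_measurable (Pi\<^sub>M (multi_indices n) (\<lambda>_. borel))"
    by (cases "J \<in> multi_indices n") (simp_all add: cut_def measurable_component_singleton)
qed

lemma measurable_cut_coeffs: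
  assumes "kostlan_coeffs n M a"
  shows "(\<lambda>\<omega>. cut n (\<lambda>J. a J \<omega>)) \<in> borel_measurable M"
proof (rule measurable_coordinatewise_then_product)
  fix J
  show "(\<lambda>\<omega>. cut n (\<lambda>J. a J \<omega>) J) \<in> borel_measurable M"
  proof (cases "J \<in> multi_indices n")
    case True
    then have "a J \<in> measurable M borel"
      using assms distributed_measurable[of M lborel "a J"] by (auto simp: kostlan_coeffs_def)
    then show ?thesis using True by (simp add: cut_def)
  qed (simp add: cut_def)
qed

lemma sets_coeffs:
  assumes "kostlan_coeffs n M a" and S: "S \<in> sets borel" and "\<And>b. cut n b \<in> S \<longleftrightarrow> b \<in> S"
  shows "{\<omega> \<in> space M. (\<lambda>J. a J \<omega>) \<in> S} \<in> sets M"
  using measurable_sets[OF measurable_cut_coeffs[OF assms(1)] S] assms(3)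
  by (simp add: vimage_def Int_def conj_commute)

text \<open>The scaling of the jets in \<open>prob_kostlan_small_ge\<close> makes the diagonal entries equal to a quarter of the
weights; this is the resulting bound on the field.\<close>

definition ball_level :: "real \<Rightarrow> real" where
  "ball_level C = 8 * sqrt (32 * exp 45 * C)"

text \<open>The variables are the jets at the points of \<open>P\<close>, of degree \<open>k\<close> with weight \<open>4 powr (- k)\<close>. The square roots of the diagonal
entries are then summable over the degrees, so that the exponent in the small ball inequality is a
constant times \<open>card P\<close>.\<close>

lemma prob_kostlan_small_ge:
  assumes K: "kostlan_coeffs n M a" and n: "n > 0" and P: "finite P" "P \<subseteq> S2" and E: "E \<subseteq> S2"
    and C: "C > 0" "\<And>p. p \<in> P \<Longrightarrow> crowding n P p \<le> C"
    and cover: "\<And>x. x \<in> E \<Longrightarrow> \<exists>p\<in>P. norm (x - p) \<le> 1 / (16 * sqrt (real n))"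
  shows "exp (- 8 * real (card P)) \<le> measure M {\<omega> \<in> space M. \<forall>x\<in>E. \<bar>kostlan n (\<lambda>J. a J \<omega>) x\<bar> \<le> ball_level C}"
proof -
  interpret prob_space M using K by (simp add: kostlan_coeffs_def)
  \<comment> \<open>This scaling makes the diagonal entries of \<open>jet_combination_variance_le\<close> a quarter of the weights.\<close>
  define \<kappa> where "\<kappa> = 1 / sqrt (32 * exp 45 * C)"
  have s0: "sqrt (32 * exp 45 * C) > 0" using C by simp
  have \<kappa>: "\<kappa> > 0" "8 * exp 45 * C * \<kappa>\<^sup>2 = 1 / 4"
    using C by (simp_all add: \<kappa>_def power_divide)
  define T where "T = P \<times> exponents n"
  define g :: "(real^3) \<times> (3 \<Rightarrow> nat) \<Rightarrow> real" where "g t = (\<Prod>i\<in>UNIV. (1/4) ^ snd t i)" for t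
  define D where "D t = g t / 4" for t
  define b where "b t J = \<kappa> * g t * tensor_coeff n (jet n (fst t) (snd t)) J" for t J
  have g01: "0 \<le> g t" "g t \<le> 1" for t
    unfolding g_def by (auto intro!: prod_nonneg prod_le_1 power_le_one)
  have "exp (- 2 * (\<Sum>t\<in>T. sqrt (D t)))
      \<le> prob {\<omega> \<in> space M. \<forall>t\<in>T. \<bar>\<Sum>J\<in>multi_indices n. b t J * a J \<omega>\<bar> \<le> 1}"
  proof (rule prob_all_small_ge)
    show "finite (multi_indices n)" by (rule finite_multi_indices)
    show "indep_vars (\<lambda>_. borel) a (multi_indices n)" using K by (simp add: kostlan_coeffs_def)
    show "distributed M lborel (a J) std_normal_density" if "J \<in> multi_indices n" for J
      using K that by (simp add: kostlan_coeffs_def)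
    show "finite T" using P by (simp add: T_def)
    show "0 \<le> D t" "D t \<le> 1/4" for t using g01[of t] by (auto simp: D_def)
    show "(\<Sum>J\<in>multi_indices n. (\<Sum>t\<in>T. l t * b t J)\<^sup>2) \<le> (\<Sum>t\<in>T. D t * (l t)\<^sup>2)" for l
      using jet_combination_variance_le[OF P n C(2), of l \<kappa>] unfolding \<kappa>(2) by (simp add: b_def g_def T_def D_def)
  qed
  also have "\<dots> \<le> prob {\<omega> \<in> space M. \<forall>x\<in>E. \<bar>kostlan n (\<lambda>J. a J \<omega>) x\<bar> \<le> ball_level C}"
  proof (rule finite_measure_mono)
    show "{\<omega> \<in> space M. \<forall>t\<in>T. \<bar>\<Sum>J\<in>multi_indices n. b t J * a J \<omega>\<bar> \<le> 1}
        \<subseteq> {\<omega> \<in> space M. \<forall>x\<in>E. \<bar>kostlan n (\<lambda>J. a J \<omega>) x\<bar> \<le> ball_level C}"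
    proof safe
      fix \<omega> x assume \<omega>: "\<omega> \<in> space M" "\<forall>t\<in>T. \<bar>\<Sum>J\<in>multi_indices n. b t J * a J \<omega>\<bar> \<le> 1" and x: "x \<in> E"
      obtain p where p: "p \<in> P" "norm (x - p) \<le> 1 / (16 * sqrt (real n))" using cover[OF x] by blast
      have "\<bar>kostlan n (\<lambda>J. a J \<omega>) x\<bar> \<le> 8 * (1 / \<kappa>)"
      proof (rule kostlan_le_of_jets[OF _ _ n p(2)])
        fix \<alpha> assume \<alpha>: "\<alpha> \<in> exponents n"
        have "(\<Sum>J\<in>multi_indices n. b (p, \<alpha>) J * a J \<omega>)
          = \<kappa> * (\<Prod>i\<in>UNIV. (1/4) ^ \<alpha> i) * (\<Sum>J\<in>multi_indices n. tensor_coeff n (jet n p \<alpha>) J * a J \<omega>)"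
          by (simp add: b_def g_def sum_distrib_left mult.assoc)
        moreover have "\<bar>\<Sum>J\<in>multi_indices n. b (p, \<alpha>) J * a J \<omega>\<bar> \<le> 1"
          using \<omega>(2) p(1) \<alpha> by (auto simp: T_def)
        ultimately have *: "\<kappa> * (\<Prod>i\<in>UNIV. (1/4) ^ \<alpha> i) * \<bar>\<Sum>J\<in>multi_indices n. tensor_coeff n (jet n p \<alpha>) J * a J \<omega>\<bar> \<le> 1"
          using \<kappa>(1) by (simp add: abs_mult abs_prod)
        have q: "(\<Prod>i\<in>UNIV. 4 ^ \<alpha> i) * (\<Prod>i\<in>UNIV. (1/4) ^ \<alpha> i) = (1::real)"
          by (simp add: prod.distrib[symmetric] power_mult_distrib[symmetric])
        have "(\<Prod>i\<in>UNIV. 4 ^ \<alpha> i) / \<kappa> * (\<kappa> * (\<Prod>i\<in>UNIV. (1/4) ^ \<alpha> i) * \<bar>\<Sum>J\<in>multi_indices n. tensor_coeff n (jet n p \<alpha>) J * a J \<omega>\<bar>)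
           \<le> (\<Prod>i\<in>UNIV. 4 ^ \<alpha> i) / \<kappa> * 1"
          using * \<kappa>(1) by (intro mult_left_mono) (auto intro!: divide_nonneg_pos prod_nonneg)
        moreover have "(\<Prod>i\<in>UNIV. 4 ^ \<alpha> i) / \<kappa> * (\<kappa> * (\<Prod>i\<in>UNIV. (1/4) ^ \<alpha> i) * y) = y" for y
          using q \<kappa>(1) by (simp add: mult.assoc[symmetric])
        ultimately show "\<bar>\<Sum>J\<in>multi_indices n. tensor_coeff n (jet n p \<alpha>) J * a J \<omega>\<bar> \<le> 1 / \<kappa> * (\<Prod>i\<in>UNIV. 4 ^ \<alpha> i)"
          by simp
      qed (use x p E P in auto)
      also have "8 * (1 / \<kappa>) = ball_level C" by (simp add: \<kappa>_def ball_level_def)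
      finally show "\<bar>kostlan n (\<lambda>J. a J \<omega>) x\<bar> \<le> ball_level C" .
    qed
    have "closed ({b. \<forall>x\<in>E. - ball_level C \<le> 1 * kostlan n b x} \<inter> {b. \<forall>x\<in>E. - ball_level C \<le> (- 1) * kostlan n b x})"
      by (intro closed_Int closed_kostlan_ge)
    then have "{\<omega> \<in> space M. (\<lambda>J. a J \<omega>) \<in> {b. \<forall>x\<in>E. - ball_level C \<le> 1 * kostlan n b x} \<inter> {b. \<forall>x\<in>E. - ball_level C \<le> (- 1) * kostlan n b x}} \<in> events"
      by (intro sets_coeffs[OF K] borel_closed) simp_all
    then show "{\<omega> \<in> space M. \<forall>x\<in>E. \<bar>kostlan n (\<lambda>J. a J \<omega>) x\<bar> \<le> ball_level C} \<in> events"
      by (rule back_subst[where P="\<lambda>S. S \<in> events"]) (auto simp: abs_le_iff; fastforce)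
  qed
  finally have "exp (- 2 * (\<Sum>t\<in>T. sqrt (D t)))
      \<le> prob {\<omega> \<in> space M. \<forall>x\<in>E. \<bar>kostlan n (\<lambda>J. a J \<omega>) x\<bar> \<le> ball_level C}" .
  moreover have "(\<Sum>t\<in>T. sqrt (D t)) \<le> 4 * real (card P)"
  proof -
    have "sqrt (g t) = (\<Prod>i\<in>UNIV. (1/2) ^ snd t i)" for t
    proof (rule real_sqrt_unique)
      show "(\<Prod>i\<in>UNIV. (1/2) ^ snd t i)\<^sup>2 = g t"
        by (simp add: g_def prod_power_distrib[symmetric] power_mult[symmetric] mult.commute power2_eq_square prod.distrib[symmetric] power_mult_distrib[symmetric])
    qed (auto intro: prod_nonneg)
    then have "(\<Sum>t\<in>T. sqrt (D t)) = (\<Sum>t\<in>T. (\<Prod>i\<in>UNIV. (1/2) ^ snd t i) / 2)"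
      by (simp add: D_def real_sqrt_divide)
    also have "\<dots> = (\<Sum>p\<in>P. \<Sum>\<alpha>\<in>exponents n. (\<Prod>i\<in>UNIV. (1/2) ^ \<alpha> i) / 2)"
      unfolding T_def sum.cartesian_product case_prod_unfold ..
    also have "\<dots> = (\<Sum>p\<in>P. (\<Sum>\<alpha>\<in>exponents n. \<Prod>i\<in>UNIV. (1/2) ^ \<alpha> i) / 2)"
      unfolding sum_divide_distrib ..
    also have "\<dots> \<le> (\<Sum>p\<in>P. 8 / 2)"
      using sum_exponents_le[of "1/2" n] by (intro sum_mono divide_right_mono) auto
    finally show ?thesis by simp
  qed
  ultimately show ?thesis by (smt (verit) exp_le_cancel_iff)
qed

text \<open>The covariance of the field itself has the same Gaussian bound as the jets.\<close>

lemma kernel_power_le_near: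
  assumes p: "p \<in> S2" and q: "q \<in> S2" and n: "even n"
  shows "(p \<bullet> q) ^ n \<le> near n (q - p) + near n (q - (- p))"
proof -
  define c where "c = p \<bullet> q"
  obtain m where m: "n = 2 * m" using n by blast
  have c: "c\<^sup>2 \<le> 1" using abs_inner_S2[OF p q] by (simp add: c_def abs_square_le_1)
  have "c ^ n = (c\<^sup>2) ^ m" by (simp add: m power_mult)
  also have "\<dots> \<le> exp (c\<^sup>2 - 1) ^ m"
    using exp_ge_add_one_self[of "c\<^sup>2 - 1"] by (intro power_mono) auto
  also have "\<dots> = exp (real m * (c\<^sup>2 - 1))" by (simp add: exp_of_nat_mult)
  also have "\<dots> \<le> exp (- real n * (1 - c\<^sup>2) / 4)"
    using c mult_nonneg_nonneg[of "real m" "1 - c\<^sup>2"] by (simp add: m algebra_simps)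
  also have "\<dots> \<le> near n (q - p) + near n (q - (- p))"
    unfolding c_def by (rule exp_sin_sq_le_near[OF p q])
  finally show ?thesis by (simp add: c_def)
qed

text \<open>The shift is \<open>s\<close> times the function \<open>\<Sum>p\<in>P. (x \<bullet> p) ^ n\<close>, which is at least \<open>1 / 2\<close> on \<open>E\<close>; the factor
\<open>s\<close> compensates the bound \<open>ball_level C\<close> on the unshifted field and adds the level \<open>\<tau>\<close>. The linear term
of the shift formula is \<open>s\<close> times a sum of values of the field at points of \<open>P\<close>, hence bounded on the
event that the field is small on \<open>E\<close>. The sign \<open>\<sigma>\<close> selects the direction of the shift.\<close>

lemma prob_kostlan_beyond_ge:
  assumes K: "kostlan_coeffs n M a" and n: "n > 0" "even n"
    and P: "finite P" "P \<subseteq> E" and E: "E \<subseteq> S2"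
    and C: "C > 0" "\<And>p. p \<in> P \<Longrightarrow> crowding n P p \<le> C"
    and cover: "\<And>x. x \<in> E \<Longrightarrow> \<exists>p\<in>P. norm (x - p) \<le> 1 / (16 * sqrt (real n))"
    and \<sigma>: "\<bar>\<sigma>\<bar> = 1" and \<tau>: "\<tau> \<ge> 0"
  defines "s \<equiv> 2 * (ball_level C + \<tau>)"
  shows "exp (- (8 + ball_level C * s + s\<^sup>2 * C / 2) * real (card P))
      \<le> measure M {\<omega> \<in> space M. \<forall>x\<in>E. \<tau> \<le> \<sigma> * kostlan n (\<lambda>J. a J \<omega>) x}"
proof -
  interpret prob_space M using K by (simp add: kostlan_coeffs_def)
  let ?I = "multi_indices n"
  define B where "B = ball_level C"
  have B: "B \<ge> 0" using C by (simp add: B_def ball_level_def)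
  have s: "s \<ge> 0" "s = 2 * (B + \<tau>)" using B \<tau> by (auto simp: s_def B_def)
  have \<sigma>2: "\<sigma> * \<sigma> = 1" using \<sigma> by (metis abs_mult_self_eq mult_1)
  define \<phi> where "\<phi> p J = sqrt (multinomial n J) * (\<Prod>i\<in>UNIV. (p $ i) ^ (J $ i))" for p :: "real^3" and J
  define h where "h J = \<sigma> * s * (\<Sum>p\<in>P. \<phi> p J)" for J
  have ker: "kostlan n (\<phi> p) x = (x \<bullet> p) ^ n" for p x
    unfolding \<phi>_def by (rule kostlan_kernel)
  have pair: "(\<Sum>J\<in>?I. \<phi> p J * b J) = kostlan n b p" for p b
    unfolding \<phi>_def kostlan_def by (simp add: mult_ac)
  have fh: "kostlan n h x = \<sigma> * s * (\<Sum>p\<in>P. (x \<bullet> p) ^ n)" for x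
    unfolding h_def[abs_def] kostlan_sum ker ..
  have hb: "(\<Sum>J\<in>?I. h J * b J) = \<sigma> * s * (\<Sum>p\<in>P. kostlan n b p)" for b
  proof -
    have "(\<Sum>J\<in>?I. h J * b J) = \<sigma> * s * (\<Sum>J\<in>?I. \<Sum>p\<in>P. \<phi> p J * b J)"
      unfolding h_def sum_distrib_left sum_distrib_right by (simp add: mult.assoc)
    also have "(\<Sum>J\<in>?I. \<Sum>p\<in>P. \<phi> p J * b J) = (\<Sum>p\<in>P. kostlan n b p)"
      by (subst sum.swap) (simp only: pair)
    finally show ?thesis .
  qed
  have hh: "(\<Sum>J\<in>?I. (h J)\<^sup>2) \<le> s\<^sup>2 * C * real (card P)"
  proof -
    have "(\<Sum>J\<in>?I. (h J)\<^sup>2) = \<sigma> * s * (\<Sum>p\<in>P. \<sigma> * s * (\<Sum>q\<in>P. (p \<bullet> q) ^ n))"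
      unfolding power2_eq_square hb fh ..
    also have "\<dots> = (\<sigma> * \<sigma>) * (s\<^sup>2 * (\<Sum>p\<in>P. \<Sum>q\<in>P. (p \<bullet> q) ^ n))"
      by (simp add: sum_distrib_left power2_eq_square mult_ac)
    also have "\<dots> = s\<^sup>2 * (\<Sum>p\<in>P. \<Sum>q\<in>P. (p \<bullet> q) ^ n)" using \<sigma>2 by simp
    also have "\<dots> \<le> s\<^sup>2 * (\<Sum>p\<in>P. C)"
    proof (intro mult_left_mono sum_mono)
      fix p assume p: "p \<in> P"
      have "(\<Sum>q\<in>P. (p \<bullet> q) ^ n) \<le> crowding n P p"
        unfolding crowding_def using p P E n by (intro sum_mono kernel_power_le_near) auto
      then show "(\<Sum>q\<in>P. (p \<bullet> q) ^ n) \<le> C" using C(2)[OF p] by simp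
    qed simp
    finally show ?thesis by (simp add: mult_ac)
  qed
  define A where "A = {b \<in> space (Pi\<^sub>M ?I (\<lambda>_. borel)). \<forall>x\<in>E. \<bar>kostlan n b x\<bar> \<le> B}"
  define G where "G = {b \<in> space (Pi\<^sub>M ?I (\<lambda>_. borel)). \<forall>x\<in>E. \<tau> \<le> \<sigma> * kostlan n b x}"
  have sets: "{b \<in> space (Pi\<^sub>M ?I (\<lambda>_. borel)). \<forall>x\<in>E. u \<le> v * kostlan n b x} \<in> sets (Pi\<^sub>M ?I (\<lambda>_. borel))" for u v
    using measurable_sets[OF measurable_cut_PiM[of n] borel_closed[OF closed_kostlan_ge[of E u v n]]]
    by (simp add: vimage_def Int_def conj_commute)
  have cutsp: "(\<lambda>J\<in>?I. b J) \<in> space (Pi\<^sub>M ?I (\<lambda>_. borel :: real measure))" for b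
    by (simp add: space_PiM)
  have AG: "(\<lambda>J\<in>?I. b J + h J) \<in> G" if b: "b \<in> A" for b
  proof -
    have "\<tau> \<le> \<sigma> * kostlan n (\<lambda>J. b J + h J) x" if x: "x \<in> E" for x
    proof -
      have pos: "(x \<bullet> p) ^ n \<ge> 0" for p using n by (simp add: zero_le_even_power)
      obtain p where p: "p \<in> P" "norm (x - p) \<le> 1 / (16 * sqrt (real n))" using cover[OF x] by blast
      have nn: "x \<bullet> x = 1" "p \<bullet> p = 1" using x p E P by (auto simp: dot_square_norm)
      have dd: "(norm (x - p))\<^sup>2 = 2 - 2 * (x \<bullet> p)"
        unfolding power2_norm_eq_inner by (simp add: nn inner_diff_left inner_diff_right inner_commute)
      have "(norm (x - p))\<^sup>2 \<le> (1 / (16 * sqrt (real n)))\<^sup>2" by (intro power_mono p) auto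
      also have "\<dots> = 1 / (256 * real n)" by (simp add: power_divide power_mult_distrib)
      finally have "x \<bullet> p - 1 \<ge> - (1 / (512 * real n))" unfolding dd by simp
      moreover have "1 / (512 * real n) \<le> 1" using n by (simp add: divide_simps)
      ultimately have "1 + real n * (x \<bullet> p - 1) \<le> (1 + (x \<bullet> p - 1)) ^ n"
        by (intro Bernoulli_inequality) linarith
      moreover have "real n * (x \<bullet> p - 1) \<ge> real n * (- (1 / (512 * real n)))"
        using \<open>x \<bullet> p - 1 \<ge> - (1 / (512 * real n))\<close> by (intro mult_left_mono) auto
      moreover have "real n * (- (1 / (512 * real n))) = - (1 / 512)" using n by simp
      ultimately have "1 / 2 \<le> (x \<bullet> p) ^ n" by simp
      also have "\<dots> \<le> (\<Sum>p\<in>P. (x \<bullet> p) ^ n)"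
        using member_le_sum[of p P "\<lambda>p. (x \<bullet> p) ^ n"] p P pos by simp
      finally have "s * (1 / 2) \<le> s * (\<Sum>p\<in>P. (x \<bullet> p) ^ n)" using s by (intro mult_left_mono) auto
      moreover have "\<sigma> * kostlan n (\<lambda>J. b J + h J) x = \<sigma> * kostlan n b x + (\<sigma> * \<sigma>) * (s * (\<Sum>p\<in>P. (x \<bullet> p) ^ n))"
        unfolding kostlan_add fh by (simp add: algebra_simps)
      moreover have "\<sigma> * kostlan n b x \<ge> - B"
      proof -
        have "\<bar>\<sigma> * kostlan n b x\<bar> \<le> B" using b x \<sigma> by (simp add: A_def abs_mult)
        then show ?thesis by linarith
      qed
      ultimately show ?thesis using \<sigma>2 s by simp
    qed
    then show ?thesis using cutsp by (simp add: G_def)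
  qed
  have "exp (- (B * s * real (card P)) - (\<Sum>J\<in>?I. (h J)\<^sup>2) / 2) * prob {\<omega> \<in> space M. (\<lambda>J\<in>?I. a J \<omega>) \<in> A}
     \<le> prob {\<omega> \<in> space M. (\<lambda>J\<in>?I. a J \<omega>) \<in> G}"
  proof (rule prob_shift_ge[OF finite_multi_indices multi_indices_nonempty])
    show "indep_vars (\<lambda>_. borel) a ?I" using K by (simp add: kostlan_coeffs_def)
    show "distributed M lborel (a J) std_normal_density" if "J \<in> ?I" for J
      using K that by (simp add: kostlan_coeffs_def)
    show "G \<in> sets (Pi\<^sub>M ?I (\<lambda>_. borel))" unfolding G_def by (rule sets)
    have "A = {b \<in> space (Pi\<^sub>M ?I (\<lambda>_. borel)). \<forall>x\<in>E. - B \<le> 1 * kostlan n b x} \<inter> {b \<in> space (Pi\<^sub>M ?I (\<lambda>_. borel)). \<forall>x\<in>E. - B \<le> (- 1) * kostlan n b x}"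
      by (fastforce simp: A_def abs_le_iff)
    then show "A \<in> sets (Pi\<^sub>M ?I (\<lambda>_. borel))" using sets[of "- B" 1] sets[of "- B" "- 1"] by auto
    show "(\<lambda>J\<in>?I. b J + h J) \<in> G" if "b \<in> A" for b by (rule AG[OF that])
    show "(\<Sum>J\<in>?I. h J * b J) \<le> B * s * real (card P)" if "b \<in> A" for b
    proof -
      have "\<bar>\<sigma> * s * (\<Sum>p\<in>P. kostlan n b p)\<bar> = s * \<bar>\<Sum>p\<in>P. kostlan n b p\<bar>"
        using s \<sigma> by (simp add: abs_mult)
      also have "\<dots> \<le> s * (\<Sum>p\<in>P. \<bar>kostlan n b p\<bar>)" using s by (intro mult_left_mono sum_abs) auto
      also have "\<dots> \<le> s * (\<Sum>p\<in>P. B)"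
        using s that P by (intro mult_left_mono sum_mono) (auto simp: A_def)
      finally show ?thesis unfolding hb by (simp add: mult_ac)
    qed
  qed
  also have "{\<omega> \<in> space M. (\<lambda>J\<in>?I. a J \<omega>) \<in> G} = {\<omega> \<in> space M. \<forall>x\<in>E. \<tau> \<le> \<sigma> * kostlan n (\<lambda>J. a J \<omega>) x}"
    using cutsp by (simp add: G_def)
  also have "{\<omega> \<in> space M. (\<lambda>J\<in>?I. a J \<omega>) \<in> A} = {\<omega> \<in> space M. \<forall>x\<in>E. \<bar>kostlan n (\<lambda>J. a J \<omega>) x\<bar> \<le> B}"
    using cutsp by (simp add: A_def)
  finally have 1: "exp (- (B * s * real (card P)) - (\<Sum>J\<in>?I. (h J)\<^sup>2) / 2) * prob {\<omega> \<in> space M. \<forall>x\<in>E. \<bar>kostlan n (\<lambda>J. a J \<omega>) x\<bar> \<le> B}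
     \<le> prob {\<omega> \<in> space M. \<forall>x\<in>E. \<tau> \<le> \<sigma> * kostlan n (\<lambda>J. a J \<omega>) x}" .
  have "exp (- (8 + B * s + s\<^sup>2 * C / 2) * real (card P))
      = exp (- (B * s * real (card P)) - s\<^sup>2 * C * real (card P) / 2) * exp (- 8 * real (card P))"
    by (simp add: exp_add[symmetric] algebra_simps)
  also have "\<dots> \<le> exp (- (B * s * real (card P)) - (\<Sum>J\<in>?I. (h J)\<^sup>2) / 2) * prob {\<omega> \<in> space M. \<forall>x\<in>E. \<bar>kostlan n (\<lambda>J. a J \<omega>) x\<bar> \<le> B}"
    unfolding B_def using hh P E
    by (intro mult_mono prob_kostlan_small_ge[OF K n(1) P(1) _ E C cover]) auto
  finally show ?thesis using 1 by (simp add: B_def)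
qed

section \<open>Separated nets\<close>

lemma sum_power_nat_abs_le:
  fixes x :: real
  assumes x: "0 \<le> x" "x < 1" and S: "finite (S :: int set)"
  shows "(\<Sum>k\<in>S. x ^ nat \<bar>k\<bar>) \<le> 2 / (1 - x)"
proof -
  have geo: "(\<Sum>k\<in>T. x ^ nat \<bar>k\<bar>) \<le> 1 / (1 - x)" if T: "finite T" "inj_on (\<lambda>k. nat \<bar>k\<bar>) T" for T :: "int set"
  proof -
    have "(\<Sum>k\<in>T. x ^ nat \<bar>k\<bar>) = (\<Sum>j\<in>(\<lambda>k. nat \<bar>k\<bar>) ` T. x ^ j)"
      by (simp add: sum.reindex[OF T(2)])
    also have "\<dots> \<le> (\<Sum>j. x ^ j)"
      using x T(1) by (intro sum_le_suminf) (auto simp: summable_geometric_iff)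
    finally show ?thesis using x by (simp add: suminf_geometric)
  qed
  have "(\<Sum>k\<in>S. x ^ nat \<bar>k\<bar>) = (\<Sum>k\<in>S \<inter> {0..}. x ^ nat \<bar>k\<bar>) + (\<Sum>k\<in>S \<inter> {..<0}. x ^ nat \<bar>k\<bar>)"
    using S by (subst sum.union_disjoint[symmetric]) (auto intro!: sum.cong)
  also have "\<dots> \<le> 1 / (1 - x) + 1 / (1 - x)"
    using S by (intro add_mono geo) (auto simp: inj_on_def)
  finally show ?thesis by simp
qed

lemma norm_sq_vec: "(norm y)\<^sup>2 = (\<Sum>i\<in>UNIV. (y $ i)\<^sup>2)" for y :: "real^'n"
  by (simp add: norm_vec_def L2_set_def sum_nonneg)

text \<open>Points with separation \<open>1 / (16 * sqrt n)\<close> lie in different cells of a cubic grid of side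
\<open>(1 / 32) / sqrt n\<close>, since the diagonal of a cell is less than twice its side. The constant bounds the
one-dimensional sums of the Gaussian profile over such a grid.\<close>

definition grid_const :: real where
  "grid_const = exp (3 * (1/32)\<^sup>2 / 8) * (2 / (1 - exp (- ((1/32)\<^sup>2 / 4))))"

lemma grid_const_pos: "grid_const > 0"
  unfolding grid_const_def by (intro mult_pos_pos divide_pos_pos) auto

text \<open>The Gaussian profile is a product over the coordinates, so the sum over occupied grid cells is bounded by
the cube of a one-dimensional sum, which is compared to a geometric series.\<close>

lemma sum_near_le:
  fixes P :: "(real^3) set"
  assumes P: "finite P" and n: "n > 0"
    and sep: "\<And>p q. p \<in> P \<Longrightarrow> q \<in> P \<Longrightarrow> p \<noteq> q \<Longrightarrow> 1 / (16 * sqrt (real n)) \<le> norm (p - q)"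
  shows "(\<Sum>q\<in>P. near n (q - z)) \<le> grid_const ^ 3"
proof -
  define \<eta> :: real where "\<eta> = 1/32"
  define x where "x = exp (- (\<eta>\<^sup>2 / 4))"
  define A where "A = exp (3 * \<eta>\<^sup>2 / 8)"
  have x: "0 \<le> x" "x < 1" by (auto simp: x_def \<eta>_def)
  have sn: "sqrt (real n) > 0" using n by simp
  define t where "t q i = (q $ i - z $ i) * sqrt (real n) / \<eta>" for q and i :: 3
  define k where "k q i = \<lfloor>t q i\<rfloor>" for q i
  define S where "S = (\<Union>i\<in>UNIV. (\<lambda>q. k q i) ` P)"
  have S: "finite S" using P by (simp add: S_def)
  have inj: "inj_on k P"
  proof (rule inj_onI, rule ccontr)
    fix p q assume pq: "p \<in> P" "q \<in> P" "k p = k q" "p \<noteq> q"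
    have "\<bar>(p - q) $ i\<bar> < \<eta> / sqrt (real n)" for i
    proof -
      have "\<lfloor>t p i\<rfloor> = \<lfloor>t q i\<rfloor>" using pq(3) by (simp add: k_def fun_eq_iff)
      then have "\<bar>t p i - t q i\<bar> < 1" by linarith
      moreover have "t p i - t q i = (p - q) $ i * (sqrt (real n) / \<eta>)"
        by (simp add: t_def \<eta>_def algebra_simps)
      ultimately have "\<bar>(p - q) $ i\<bar> * (sqrt (real n) / \<eta>) < 1"
        using sn by (simp add: abs_mult \<eta>_def)
      then show ?thesis using sn by (simp add: \<eta>_def field_simps)
    qed
    then have "\<bar>(p - q) $ i\<bar> \<le> \<bar>\<eta> / sqrt (real n)\<bar>" for i
      by (meson abs_ge_self less_imp_le order_trans)
    then have "(norm (p - q))\<^sup>2 \<le> (\<Sum>i\<in>(UNIV::3 set). (\<eta> / sqrt (real n))\<^sup>2)"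
      unfolding norm_sq_vec by (intro sum_mono abs_le_square_iff[THEN iffD1])
    also have "\<dots> < (2 * \<eta> / sqrt (real n))\<^sup>2" using n by (simp add: power_divide power_mult_distrib \<eta>_def field_simps)
    finally have "norm (p - q) < 2 * \<eta> / sqrt (real n)"
      by (rule power2_less_imp_less) (simp add: \<eta>_def)
    then show False using sep[OF pq(1,2,4)] by (simp add: \<eta>_def)
  qed
  have "near n (q - z) \<le> (\<Prod>i\<in>UNIV. A * x ^ nat \<bar>k q i\<bar>)" for q
  proof -
    have "near n (q - z) = (\<Prod>i\<in>UNIV. exp (- (\<eta>\<^sup>2 * (t q i)\<^sup>2 / 8)))"
    proof -
      have "(norm (q - z))\<^sup>2 = (\<Sum>i\<in>UNIV. (q $ i - z $ i)\<^sup>2)"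
        by (simp add: norm_sq_vec)
      moreover have "real n * (q $ i - z $ i)\<^sup>2 = \<eta>\<^sup>2 * (t q i)\<^sup>2" for i
        by (simp add: t_def power_mult_distrib power_divide \<eta>_def)
      ultimately have "real n * (norm (q - z))\<^sup>2 = (\<Sum>i\<in>UNIV. \<eta>\<^sup>2 * (t q i)\<^sup>2)"
        by (simp add: sum_distrib_left)
      then show ?thesis
        by (simp add: near_def exp_sum[symmetric] sum_divide_distrib sum_negf)
    qed
    also have "\<dots> \<le> (\<Prod>i\<in>UNIV. A * x ^ nat \<bar>k q i\<bar>)"
    proof (rule prod_mono, rule conjI)
      fix i :: 3
      have "\<bar>real_of_int (k q i)\<bar> \<le> \<bar>t q i\<bar> + 1" unfolding k_def by linarith
      moreover have "2 * \<bar>t q i\<bar> - 1 \<le> (t q i)\<^sup>2"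
        using zero_le_power2[of "\<bar>t q i\<bar> - 1"] by (simp add: power2_diff)
      ultimately have "2 * \<bar>real_of_int (k q i)\<bar> - 3 \<le> (t q i)\<^sup>2" by linarith
      then have "\<eta>\<^sup>2 * (2 * \<bar>real_of_int (k q i)\<bar> - 3) \<le> \<eta>\<^sup>2 * (t q i)\<^sup>2"
        by (intro mult_left_mono) auto
      then have "exp (- (\<eta>\<^sup>2 * (t q i)\<^sup>2 / 8)) \<le> exp (3 * \<eta>\<^sup>2 / 8 + \<bar>real_of_int (k q i)\<bar> * (- (\<eta>\<^sup>2 / 4)))"
        by (simp add: algebra_simps)
      also have "\<dots> = A * x ^ nat \<bar>k q i\<bar>"
        unfolding A_def x_def exp_of_nat_mult[symmetric] exp_add[symmetric] by simp
      finally show "exp (- (\<eta>\<^sup>2 * (t q i)\<^sup>2 / 8)) \<le> A * x ^ nat \<bar>k q i\<bar>" .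
    qed simp
    finally show ?thesis .
  qed
  then have "(\<Sum>q\<in>P. near n (q - z)) \<le> (\<Sum>q\<in>P. \<Prod>i\<in>UNIV. A * x ^ nat \<bar>k q i\<bar>)"
    by (rule sum_mono)
  also have "\<dots> = (\<Sum>\<kappa>\<in>k ` P. \<Prod>i\<in>UNIV. A * x ^ nat \<bar>\<kappa> i\<bar>)"
    by (simp add: sum.reindex[OF inj])
  also have "\<dots> \<le> (\<Sum>\<kappa>\<in>(\<Pi>\<^sub>E i\<in>(UNIV::3 set). S). \<Prod>i\<in>UNIV. A * x ^ nat \<bar>\<kappa> i\<bar>)"
  proof (rule sum_mono2)
    show "finite ((\<Pi>\<^sub>E i\<in>UNIV. S) :: (3 \<Rightarrow> int) set)" using S by (intro finite_PiE) auto
    show "k ` P \<subseteq> (\<Pi>\<^sub>E i\<in>UNIV. S)" by (auto simp: S_def)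
    show "0 \<le> (\<Prod>i\<in>UNIV. A * x ^ nat \<bar>\<kappa> i\<bar>)" for \<kappa> :: "3 \<Rightarrow> int"
      using x by (intro prod_nonneg) (auto simp: A_def)
  qed
  also have "\<dots> = (\<Prod>i\<in>(UNIV::3 set). \<Sum>k\<in>S. A * x ^ nat \<bar>k\<bar>)"
    using S by (intro prod_sum_PiE[symmetric]) auto
  also have "\<dots> = (A * (\<Sum>k\<in>S. x ^ nat \<bar>k\<bar>)) ^ 3" by (simp add: sum_distrib_left)
  also have "\<dots> \<le> (A * (2 / (1 - x))) ^ 3"
    using x by (intro power_mono mult_left_mono sum_power_nat_abs_le S mult_nonneg_nonneg sum_nonneg) (auto simp: A_def)
  finally show ?thesis by (simp add: grid_const_def A_def x_def \<eta>_def)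
qed

lemma crowding_le:
  assumes "finite P" "n > 0"
    and "\<And>p q. p \<in> P \<Longrightarrow> q \<in> P \<Longrightarrow> p \<noteq> q \<Longrightarrow> 1 / (16 * sqrt (real n)) \<le> norm (p - q)"
  shows "crowding n P p \<le> 2 * grid_const ^ 3"
  using sum_near_le[OF assms, of p] sum_near_le[OF assms, of "- p"]
  by (simp add: crowding_def sum.distrib)

text \<open>A separated subset has at most one point in each of the small sets \<open>A j\<close>, so there is one of
maximal cardinality, and maximality makes it a net.\<close>

lemma exists_separated_net:
  fixes E :: "'a::real_normed_vector set"
  assumes I: "finite I" and E: "E \<subseteq> (\<Union>j\<in>I. A j)"
    and A: "\<And>j x y. j \<in> I \<Longrightarrow> x \<in> A j \<Longrightarrow> y \<in> A j \<Longrightarrow> norm (x - y) < d"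
  shows "\<exists>P. finite P \<and> P \<subseteq> E \<and> card P \<le> card I \<and>
     (\<forall>p\<in>P. \<forall>q\<in>P. p \<noteq> q \<longrightarrow> d \<le> norm (p - q)) \<and> (\<forall>x\<in>E. \<exists>p\<in>P. norm (x - p) \<le> d)"
proof -
  define sep where "sep P \<longleftrightarrow> finite P \<and> P \<subseteq> E \<and> (\<forall>p\<in>P. \<forall>q\<in>P. p \<noteq> q \<longrightarrow> d \<le> norm (p - q))" for P
  have bound: "card P \<le> card I" if P: "sep P" for P
  proof -
    have "\<exists>j. j \<in> I \<and> p \<in> A j" if "p \<in> P" for p using that P E by (auto simp: sep_def)
    then obtain f where f: "\<And>p. p \<in> P \<Longrightarrow> f p \<in> I \<and> p \<in> A (f p)" by metis
    have "inj_on f P"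
    proof (rule inj_onI, rule ccontr)
      fix p q assume "p \<in> P" "q \<in> P" "f p = f q" "p \<noteq> q"
      then have "norm (p - q) < d" "d \<le> norm (p - q)"
        using f[of p] f[of q] A[of "f p" p q] P by (auto simp: sep_def)
      then show False by simp
    qed
    then show ?thesis using f I by (intro card_inj_on_le) auto
  qed
  have "sep {}" by (simp add: sep_def)
  then obtain P where P: "sep P" "\<And>Q. sep Q \<Longrightarrow> card Q \<le> card P"
    using ex_has_greatest_nat[of sep "{}" card "Suc (card I)"] bound by (auto simp: less_Suc_eq_le)
  have "\<exists>p\<in>P. norm (x - p) \<le> d" if x: "x \<in> E" for x
  proof (rule ccontr)
    assume "\<not> ?thesis"
    then have far: "\<And>p. p \<in> P \<Longrightarrow> d < norm (x - p)" by force
    have "x \<notin> P"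
    proof
      assume "x \<in> P"
      obtain j where "j \<in> I" "x \<in> A j" using E x by blast
      then show False using far[OF \<open>x \<in> P\<close>] A[of j x x] by simp
    qed
    moreover have "sep (insert x P)"
      using P(1) x far by (auto simp: sep_def norm_minus_commute less_imp_le)
    ultimately show False using P(2)[of "insert x P"] P(1) by (simp add: sep_def)
  qed
  then show ?thesis using P(1) bound[OF P(1)] by (auto simp: sep_def)
qed

section \<open>Semicontinuity of components and measurability\<close>

lemma tendsto_kostlan:
  assumes b: "b \<longlonglongrightarrow> b'" and x: "x \<longlonglongrightarrow> x'"
  shows "(\<lambda>k. kostlan n (b k) (x k)) \<longlonglongrightarrow> kostlan n b' x'"
proof -
  have bJ: "(\<lambda>k. b k J) \<longlonglongrightarrow> b' J" for J
  proof -
    have "continuous_on UNIV (\<lambda>c :: nat^3 \<Rightarrow> real. c J)"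
      by (rule continuous_on_product_then_coordinatewise[OF continuous_on_id])
    from continuous_on_tendsto_compose[OF this b] show ?thesis by simp
  qed
  show ?thesis
    unfolding kostlan_def by (intro tendsto_intros bJ x)
qed

lemma excursion_limit:
  assumes "b \<longlonglongrightarrow> b'" "x \<longlonglongrightarrow> x'" "\<And>k. x k \<in> excursion n (b k) t"
  shows "x' \<in> excursion n b' t"
proof -
  have "x' \<in> S2"
    by (rule closed_sequentially[OF closed_sphere _ assms(2)]) (use assms(3) in \<open>auto simp: excursion_def\<close>)
  moreover have "kostlan n b' x' \<le> t"
    by (rule LIMSEQ_le_const2[OF tendsto_kostlan[OF assms(1,2)]]) (use assms(3) in \<open>auto simp: excursion_def\<close>)
  ultimately show ?thesis by (simp add: excursion_def)
qed

lemma compact_subseq: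
  fixes K :: "'a::metric_space set" and x :: "nat \<Rightarrow> 'a"
  assumes "compact K" "\<And>k. x k \<in> K"
  obtains l r where "strict_mono r" "(\<lambda>k. x (r k)) \<longlonglongrightarrow> l"
  using seq_compactE[OF compact_imp_seq_compact[OF assms(1)], of x] assms(2)
  unfolding comp_def by blast

lemma compact_S2_subseq:
  fixes x :: "nat \<Rightarrow> real^3"
  assumes "\<And>k. x k \<in> S2"
  obtains l r where "strict_mono r" "(\<lambda>k. x (r k)) \<longlonglongrightarrow> l"
  using compact_subseq[OF compact_sphere assms] .

text \<open>Along a subsequence, points chosen in the components converge; \<open>W\<close> is the component of the limit.
By the Sura--Bura theorem \<open>W\<close> has arbitrarily small relatively clopen neighbourhoods in the limiting
excursion set. Such a neighbourhood and its complement have disjoint open neighbourhoods that contain all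
excursion sets of the subsequence from some index on, so the connected sets \<open>V k\<close> cannot leave it.\<close>

lemma components_upper_semicontinuous:
  assumes b: "b \<longlonglongrightarrow> b'" and V: "\<And>k. V k \<in> components (excursion n (b k) t)"
  obtains W r where "W \<in> components (excursion n b' t)" "strict_mono r"
    "\<And>(s :: nat \<Rightarrow> nat) y l. strict_mono s \<Longrightarrow> (\<And>k. y k \<in> V (r (s k))) \<Longrightarrow> y \<longlonglongrightarrow> l \<Longrightarrow> l \<in> W"
proof -
  let ?U = "excursion n b' t"
  have Vsub: "V k \<subseteq> excursion n (b k) t" for k using V in_components_subset by blast
  have US: "excursion n c t \<subseteq> S2" for c by (auto simp: excursion_def)
  have "\<exists>x. x \<in> V k" for k using in_components_nonempty[OF V[of k]] by blast
  then obtain x where x: "\<And>k. x k \<in> V k" by metis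
  have xU: "x k \<in> excursion n (b k) t" for k by (rule subsetD[OF Vsub x])
  have xS: "x k \<in> S2" for k by (rule subsetD[OF US xU])
  obtain x' r where r: "strict_mono r" "(\<lambda>k. x (r k)) \<longlonglongrightarrow> x'"
    by (rule compact_S2_subseq[OF xS])
  have br: "(\<lambda>k. b (r k)) \<longlonglongrightarrow> b'"
    using LIMSEQ_subseq_LIMSEQ[OF b r(1)] by (simp add: comp_def)
  have x'U: "x' \<in> ?U"
    by (rule excursion_limit[OF br r(2)]) (rule xU)
  define W where "W = connected_component_set ?U x'"
  have W: "W \<in> components ?U" "x' \<in> W" using x'U by (auto simp: W_def components_def)
  have cW: "compact W" using W(1) compact_components[OF compact_excursion] by blast
  have lim: "l \<in> W" if s: "strict_mono s" and y: "\<And>k. y k \<in> V (r (s k))" and l: "y \<longlonglongrightarrow> l" for s :: "nat \<Rightarrow> nat" and y l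
  proof (rule ccontr)
    assume "l \<notin> W"
    obtain O1 where O1: "open O1" "W \<subseteq> O1" "l \<notin> closure O1"
    proof -
      obtain A B where "open A" "open B" "W \<subseteq> A" "l \<in> B" "A \<inter> B = {}"
        using separation_normal[of W "{l}"] compact_imp_closed[OF cW] \<open>l \<notin> W\<close> by auto
      then have "B \<inter> closure A = {}"
        using open_Int_closure_eq_empty[of B A] by (simp add: Int_commute)
      then show ?thesis using that[of A] \<open>open A\<close> \<open>W \<subseteq> A\<close> \<open>l \<in> B\<close> by (simp add: disjoint_iff)
    qed
    obtain K where K: "openin (top_of_set ?U) K" "compact K" "W \<subseteq> K" "K \<subseteq> O1"
      using Sura_Bura_clopen_subset[OF closed_imp_locally_compact[OF compact_imp_closed[OF compact_excursion]] W(1) cW O1(1,2)] by blast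
    obtain G where G: "open G" "K = ?U \<inter> G" using K(1) by (auto simp: openin_open)
    have "compact (?U - K)"
      using G compact_diff[OF compact_excursion[of n b' t] G(1)] by (simp add: Diff_Int_distrib2 Diff_Int)
    then obtain A B where AB: "open A" "open B" "K \<subseteq> A" "?U - K \<subseteq> B" "A \<inter> B = {}"
      using separation_normal[of K "?U - K"] compact_imp_closed K(2) by (metis Diff_disjoint)
    \<comment> \<open>The neighbourhood \<open>A'\<close> of the clopen piece \<open>K\<close> stays away from the supposed limit \<open>l\<close>.\<close>
    define A' where "A' = A \<inter> O1"
    have A': "open A'" "K \<subseteq> A'" "A' \<inter> B = {}" "l \<notin> closure A'"
      using AB K O1 closure_mono[of A' O1] by (auto simp: A'_def)
    have "\<forall>\<^sub>F k in sequentially. excursion n (b (r (s k))) t \<subseteq> A' \<union> B"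
    proof (rule ccontr)
      assume "\<not> ?thesis"
      from not_eventually_sequentiallyD[OF this] obtain q :: "nat \<Rightarrow> nat"
        where q: "strict_mono q" "\<forall>k. \<not> excursion n (b (r (s (q k)))) t \<subseteq> A' \<union> B"
        by blast
      then have "\<exists>z. z \<in> excursion n (b (r (s (q k)))) t \<and> z \<notin> A' \<union> B" for k by blast
      then obtain z where z: "\<And>k. z k \<in> excursion n (b (r (s (q k)))) t" "\<And>k. z k \<notin> A' \<union> B" by metis
      have zS: "z k \<in> S2" for k by (rule subsetD[OF US z(1)])
      obtain z' p where p: "strict_mono p" "(\<lambda>k. z (p k)) \<longlonglongrightarrow> z'"
        by (rule compact_S2_subseq[OF zS])
      have "(\<lambda>k. b (r (s (q (p k))))) \<longlonglongrightarrow> b'"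
        using LIMSEQ_subseq_LIMSEQ[OF br strict_mono_o[OF s strict_mono_o[OF q(1) p(1)]]] by (simp add: comp_def)
      then have "z' \<in> ?U" by (rule excursion_limit[OF _ p(2)]) (rule z(1))
      then have "z' \<in> A' \<union> B" using A' AB by blast
      moreover have "z' \<notin> A' \<union> B"
        using closed_sequentially[OF _ _ p(2), of "- (A' \<union> B)"] A'(1) AB(2) z(2) by auto
      ultimately show False by simp
    qed
    moreover have "\<forall>\<^sub>F k in sequentially. x (r (s k)) \<in> A'"
    proof -
      have "(\<lambda>k. x (r (s k))) \<longlonglongrightarrow> x'"
        using LIMSEQ_subseq_LIMSEQ[OF r(2) s] by (simp add: comp_def)
      then show ?thesis using A' W K by (intro topological_tendstoD) auto
    qed
    ultimately have "\<forall>\<^sub>F k in sequentially. y k \<in> A'"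
    proof eventually_elim
      case (elim k)
      have c: "connected (V (r (s k)))" using V in_components_connected by blast
      have sub: "V (r (s k)) \<subseteq> A' \<union> B" using elim(1) Vsub by blast
      have "B \<inter> V (r (s k)) = {}"
        using connectedD[OF c A'(1) AB(2)] A'(3) sub x elim(2) by blast
      then show "y k \<in> A'" using y sub by blast
    qed
    then have "l \<in> closure A'"
      using l by (intro Lim_in_closed_set[OF closed_closure _ sequentially_bot l]) (auto elim!: eventually_mono simp: closure_subset[THEN subsetD])
    then show False using A'(4) by simp
  qed
  show ?thesis using that[OF W(1) r(1) lim] .
qed

lemma sph_dist_nonneg: "x \<in> S2 \<Longrightarrow> y \<in> S2 \<Longrightarrow> sph_dist x y \<ge> 0"
  using abs_inner_S2[of x y] by (auto simp: sph_dist_def abs_le_iff intro!: arccos_lbound)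

lemma sph_diameter_ge: "A \<subseteq> S2 \<Longrightarrow> x \<in> A \<Longrightarrow> y \<in> A \<Longrightarrow> sph_dist x y \<le> sph_diameter A"
  using cSUP_upper[OF _ bdd_above_sph_dist[of A], of "(x, y)"] by (auto simp: sph_diameter_def)

lemma sph_diameter_nonneg: "A \<subseteq> S2 \<Longrightarrow> sph_diameter A \<ge> 0"
proof (cases "A = {}")
  case False
  assume A: "A \<subseteq> S2"
  obtain x where "x \<in> A" using False by blast
  then show ?thesis using sph_diameter_ge[OF A, of x x] sph_dist_nonneg[of x x] A by force
qed (simp add: sph_diameter_def)

lemma sph_diameter_attained:
  assumes "compact A" "A \<subseteq> S2" "A \<noteq> {}"
  obtains x y where "x \<in> A" "y \<in> A" "sph_dist x y = sph_diameter A"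
proof -
  obtain p where p: "p \<in> A \<times> A" "\<And>q. q \<in> A \<times> A \<Longrightarrow> (\<lambda>(x, y). sph_dist x y) q \<le> (\<lambda>(x, y). sph_dist x y) p"
    using continuous_attains_sup[of "A \<times> A" "\<lambda>(x, y). sph_dist x y"]
      continuous_on_subset[OF continuous_sph_dist, of "A \<times> A"] assms compact_Times by blast
  have "sph_diameter A \<le> sph_dist (fst p) (snd p)"
    using assms p(2) by (auto simp: sph_diameter_def case_prod_unfold intro!: cSUP_least)
  then show ?thesis
    using that[of "fst p" "snd p"] p(1) sph_diameter_ge[OF assms(2), of "fst p" "snd p"] by force
qed

lemma sph_area_nonneg: "sph_area A \<ge> 0" by (simp add: sph_area_def)

definition solid_cone :: "(real^3) set \<Rightarrow> (real^3) set" where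
  "solid_cone A = {r *\<^sub>R x | r x. 0 \<le> r \<and> r \<le> 1 \<and> x \<in> A}"

lemma sph_area_eq: "sph_area A = 3 * measure lebesgue (solid_cone A)"
  unfolding sph_area_def solid_cone_def ..

lemma compact_solid_cone:
  assumes "compact A" shows "compact (solid_cone A)"
proof -
  have "solid_cone A = (\<lambda>p. fst p *\<^sub>R snd p) ` ({0..1} \<times> A)"
    by (force simp: solid_cone_def)
  moreover have "compact ((\<lambda>p. fst p *\<^sub>R snd p) ` ({0..1::real} \<times> A))"
    using assms by (intro compact_continuous_image continuous_intros compact_Times) auto
  ultimately show ?thesis by simp
qed

lemma component_compact:
  "V \<in> components (excursion n b t) \<Longrightarrow> compact V \<and> V \<subseteq> S2 \<and> V \<noteq> {}"
  using compact_components[OF compact_excursion] in_components_subset in_components_nonempty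
  by (force simp: excursion_def)

text \<open>The diameter is attained at two points, whose limits lie in \<open>W\<close>. For the area, the compact cone over \<open>W\<close>
has an open neighbourhood of almost the same volume, and by compactness it contains the cone over some
\<open>V k\<close>.\<close>

lemma component_limit:
  assumes b: "b \<longlonglongrightarrow> b'" and q: "q \<longlonglongrightarrow> q'"
    and V: "\<And>k. V k \<in> components (excursion n (b k) t)"
    and d: "\<And>k. q k \<le> sph_diameter (V k)" and \<epsilon>: "\<And>k. \<epsilon> \<le> sph_area (V k)"
  shows "\<exists>W\<in>components (excursion n b' t). q' \<le> sph_diameter W \<and> \<epsilon> \<le> sph_area W"
proof -
  obtain W r where W: "W \<in> components (excursion n b' t)" and r: "strict_mono r"
    and lim: "\<And>(s :: nat \<Rightarrow> nat) y l. strict_mono s \<Longrightarrow> (\<And>k. y k \<in> V (r (s k))) \<Longrightarrow> y \<longlonglongrightarrow> l \<Longrightarrow> l \<in> W"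
    using components_upper_semicontinuous[OF b V] by metis
  have Vc: "compact (V k)" "V k \<subseteq> S2" "V k \<noteq> {}" for k using component_compact[OF V] by auto
  have Wc: "compact W" "W \<subseteq> S2" using component_compact[OF W] by auto
  have "q' \<le> sph_diameter W"
  proof -
    have "\<exists>p. p \<in> V (r k) \<times> V (r k) \<and> q (r k) \<le> sph_dist (fst p) (snd p)" for k
      using sph_diameter_attained[OF Vc, of "r k"] d[of "r k"] by (metis SigmaI fst_conv snd_conv)
    then obtain p where p: "\<And>k. p k \<in> V (r k) \<times> V (r k)" "\<And>k. q (r k) \<le> sph_dist (fst (p k)) (snd (p k))"
      by metis
    obtain l s where s: "strict_mono s" "(\<lambda>k. p (s k)) \<longlonglongrightarrow> l"
    proof -
      have "compact (S2 \<times> S2 :: ((real^3) \<times> (real^3)) set)" by (intro compact_Times) auto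
      moreover have "p k \<in> S2 \<times> S2" for k using p(1)[of k] Vc(2)[of "r k"] by (auto simp: mem_Times_iff)
      ultimately show ?thesis by (rule compact_subseq) (rule that)
    qed
    have pV: "fst (p (s k)) \<in> V (r (s k))" "snd (p (s k)) \<in> V (r (s k))" for k
      using p(1)[of "s k"] by (simp_all add: mem_Times_iff)
    have lW: "fst l \<in> W" "snd l \<in> W"
      by (rule lim[OF s(1) pV(1) tendsto_fst[OF s(2)]], rule lim[OF s(1) pV(2) tendsto_snd[OF s(2)]])
    have "(\<lambda>k. (\<lambda>(x, y). sph_dist x y) (p (s k))) \<longlonglongrightarrow> (\<lambda>(x, y). sph_dist x y) l"
    proof (rule continuous_on_tendsto_compose[OF continuous_sph_dist s(2)])
      show "l \<in> S2 \<times> S2" using lW Wc by (auto simp: mem_Times_iff)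
      show "\<forall>\<^sub>F k in sequentially. p (s k) \<in> S2 \<times> S2" using p(1) Vc(2) by (intro always_eventually) (auto simp: mem_Times_iff subset_iff)
    qed
    moreover have "(\<lambda>k. q (r (s k))) \<longlonglongrightarrow> q'"
      using LIMSEQ_subseq_LIMSEQ[OF q strict_mono_o[OF r s(1)]] by (simp add: comp_def)
    ultimately have "q' \<le> sph_dist (fst l) (snd l)"
      using p(2) by (intro LIMSEQ_le) (auto simp: case_prod_unfold)
    also have "\<dots> \<le> sph_diameter W" using lW Wc by (intro sph_diameter_ge)
    finally show ?thesis .
  qed
  moreover have "\<epsilon> \<le> sph_area W"
  proof (rule ccontr)
    assume "\<not> ?thesis"
    then have e: "3 * measure lebesgue (solid_cone W) < \<epsilon>" by (simp add: sph_area_eq)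
    have cW: "compact (solid_cone W)" using Wc by (intro compact_solid_cone)
    define \<delta> where "\<delta> = \<epsilon> / 3 - measure lebesgue (solid_cone W)"
    have \<delta>: "\<delta> > 0" using e by (simp add: \<delta>_def)
    have cL: "solid_cone W \<in> lmeasurable" using cW by (rule lmeasurable_compact)
    obtain T where T: "open T" "solid_cone W \<subseteq> T" "T - solid_cone W \<in> lmeasurable" "emeasure lebesgue (T - solid_cone W) < ennreal \<delta>"
      using sets_lebesgue_outer_open[OF fmeasurableD[OF cL] \<delta>] by blast
    have "T = solid_cone W \<union> (T - solid_cone W)" using T(2) by blast
    then have TL: "T \<in> lmeasurable" using cL T(3) by (metis fmeasurable.Un)
    have "measure lebesgue T \<le> measure lebesgue (solid_cone W) + measure lebesgue (T - solid_cone W)"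
      using measure_Un_le[of "solid_cone W" lebesgue "T - solid_cone W"] cL T(2,3) by (simp add: fmeasurableD Un_absorb1)
    also have "measure lebesgue (T - solid_cone W) < \<delta>"
      using T(3,4) \<delta> by (simp add: emeasure_eq_measure2 ennreal_less_iff)
    finally have mT: "measure lebesgue T < \<epsilon> / 3" by (simp add: \<delta>_def)
    have "\<exists>k. solid_cone (V (r k)) \<subseteq> T"
    proof (rule ccontr)
      assume "\<not> ?thesis"
      then have "\<exists>p. fst p \<in> {0..1} \<and> snd p \<in> V (r k) \<and> fst p *\<^sub>R snd p \<notin> T" for k
        by (force simp: solid_cone_def subset_iff)
      then obtain p where p: "\<And>k. fst (p k) \<in> {0..1::real} \<and> snd (p k) \<in> V (r k) \<and> fst (p k) *\<^sub>R snd (p k) \<notin> T"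
        by metis
      obtain l s where s: "strict_mono s" "(\<lambda>k. p (s k)) \<longlonglongrightarrow> l"
      proof -
        have "compact ({0..1} \<times> S2 :: (real \<times> (real^3)) set)" by (intro compact_Times) auto
        moreover have "p k \<in> {0..1} \<times> S2" for k using p[of k] Vc(2) by (force simp: mem_Times_iff)
        ultimately show ?thesis by (rule compact_subseq) (rule that)
      qed
      have "snd l \<in> W" using lim[OF s(1) _ tendsto_snd[OF s(2)]] p by blast
      moreover have "fst l \<in> {0..1}"
        by (rule closed_sequentially[OF closed_atLeastAtMost _ tendsto_fst[OF s(2)]]) (use p in blast)
      ultimately have "fst l *\<^sub>R snd l \<in> T" using T(2) by (force simp: solid_cone_def)
      moreover have "fst l *\<^sub>R snd l \<in> - T"
        by (rule closed_sequentially[OF _ _ tendsto_scaleR[OF tendsto_fst[OF s(2)] tendsto_snd[OF s(2)]]])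
           (use p T(1) in auto)
      ultimately show False by simp
    qed
    then obtain k where "solid_cone (V (r k)) \<subseteq> T" by blast
    then have "measure lebesgue (solid_cone (V (r k))) \<le> measure lebesgue T"
      using TL lmeasurable_compact[OF compact_solid_cone[OF Vc(1)]] by (intro measure_mono_fmeasurable fmeasurableD)
    then show False using mT \<epsilon>[of "r k"] by (simp add: sph_area_eq)
  qed
  ultimately show ?thesis using W by blast
qed

definition coeffs_with_big_component :: "nat \<Rightarrow> real \<Rightarrow> real \<Rightarrow> real \<Rightarrow> (nat^3 \<Rightarrow> real) set" where
  "coeffs_with_big_component n t q \<epsilon> =
     {b. \<exists>V\<in>components (excursion n b t). q \<le> sph_diameter V \<and> \<epsilon> \<le> sph_area V}"

lemma closed_coeffs_with_big_component: "closed (coeffs_with_big_component n t q \<epsilon>)"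
  unfolding closed_sequential_limits
proof (intro allI impI, elim conjE)
  fix b b' assume b: "\<forall>k. b k \<in> coeffs_with_big_component n t q \<epsilon>" "b \<longlonglongrightarrow> b'"
  then have "\<exists>V. V \<in> components (excursion n (b k) t) \<and> q \<le> sph_diameter V \<and> \<epsilon> \<le> sph_area V" for k
    by (auto simp: coeffs_with_big_component_def)
  then obtain V where "\<And>k. V k \<in> components (excursion n (b k) t) \<and> q \<le> sph_diameter (V k) \<and> \<epsilon> \<le> sph_area (V k)"
    by metis
  then show "b' \<in> coeffs_with_big_component n t q \<epsilon>"
    using component_limit[OF b(2) tendsto_const[of q], of V] by (auto simp: coeffs_with_big_component_def)
qed

text \<open>The first alternative on the right says that the excursion set is empty. Otherwise let \<open>D\<close> be the
largest diameter. By \<open>component_limit\<close>, applied to a constant sequence of coefficients, the diameters of the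
components of area at least \<open>\<epsilon>\<close> do not accumulate at \<open>D\<close> unless one of them equals \<open>D\<close>; so if no such
component has diameter \<open>D\<close>, a rational number separates \<open>D\<close> from their diameters.\<close>

lemma all_largest_components_small_iff:
  assumes "\<epsilon> > 0"
  shows "(\<forall>V\<in>largest_components (excursion n b t). sph_area V < \<epsilon>) \<longleftrightarrow>
     b \<notin> coeffs_with_big_component n t 0 0 \<or> (\<exists>q\<in>\<rat>. b \<in> coeffs_with_big_component n t q 0 - coeffs_with_big_component n t q \<epsilon>)"
proof (cases "excursion n b t = {}")
  case True
  then have "largest_components (excursion n b t) = {{}}" by (simp add: largest_components_def)
  moreover have "{r *\<^sub>R x |r x. 0 \<le> r \<and> r \<le> 1 \<and> x \<in> ({} :: (real^3) set)} = {}" by simp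
  ultimately show ?thesis using True assms by (simp add: coeffs_with_big_component_def sph_area_def)
next
  case False
  let ?U = "excursion n b t"
  have US: "?U \<subseteq> S2" by (auto simp: excursion_def)
  obtain V0 where V0: "V0 \<in> largest_components ?U"
    using largest_components_nonempty[OF compact_excursion US] by blast
  have lc: "V \<in> largest_components ?U \<longleftrightarrow> V \<in> components ?U \<and> (\<forall>W\<in>components ?U. sph_diameter W \<le> sph_diameter V)" for V
    using False by (simp add: largest_components_def)
  define D where "D = sph_diameter V0"
  have D: "W \<in> components ?U \<Longrightarrow> sph_diameter W \<le> D" for W using V0 lc by (simp add: D_def)
  have V0c: "V0 \<in> components ?U" using V0 lc by simp
  have q0: "b \<in> coeffs_with_big_component n t q 0 \<longleftrightarrow> q \<le> D" for q
    using V0c D order_trans by (auto simp: coeffs_with_big_component_def sph_area_nonneg D_def)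
  have "D \<ge> 0" unfolding D_def using component_compact[OF V0c] by (intro sph_diameter_nonneg) auto
  then have n0: "b \<in> coeffs_with_big_component n t 0 0" using q0 by simp
  have big: "(\<forall>V\<in>largest_components ?U. sph_area V < \<epsilon>) \<longleftrightarrow> b \<notin> coeffs_with_big_component n t D \<epsilon>"
  proof -
    have "V \<in> largest_components ?U \<longleftrightarrow> V \<in> components ?U \<and> D \<le> sph_diameter V" for V
      using lc V0 D by (metis D_def order_trans order_antisym)
    then show ?thesis by (simp add: coeffs_with_big_component_def) (metis not_le)
  qed
  show ?thesis
  proof
    assume L: "\<forall>V\<in>largest_components ?U. sph_area V < \<epsilon>"
    have "\<exists>k::nat. b \<notin> coeffs_with_big_component n t (D - 1 / real (Suc k)) \<epsilon>"
    proof (rule ccontr)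
      assume "\<not> ?thesis"
      then have "\<forall>k. \<exists>V. V \<in> components ?U \<and> D - 1 / real (Suc k) \<le> sph_diameter V \<and> \<epsilon> \<le> sph_area V"
        by (auto simp: coeffs_with_big_component_def)
      then obtain V where V: "\<And>k. V k \<in> components ?U \<and> D - 1 / real (Suc k) \<le> sph_diameter (V k) \<and> \<epsilon> \<le> sph_area (V k)"
        by metis
      have "(\<lambda>k. D - 1 / real (Suc k)) \<longlonglongrightarrow> D - 0"
        using LIMSEQ_inverse_real_of_nat by (intro tendsto_diff tendsto_const) (simp add: inverse_eq_divide)
      then have "\<exists>W\<in>components ?U. D - 0 \<le> sph_diameter W \<and> \<epsilon> \<le> sph_area W"
        using component_limit[OF tendsto_const, of "\<lambda>k. D - 1 / real (Suc k)" "D - 0" V n b t \<epsilon>] V by blast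
      then show False using L big by (simp add: coeffs_with_big_component_def)
    qed
    then obtain k :: nat where k: "b \<notin> coeffs_with_big_component n t (D - 1 / real (Suc k)) \<epsilon>" by blast
    have "D - 1 / real (Suc k) < D" by simp
    then obtain q where q: "q \<in> \<rat>" "D - 1 / real (Suc k) < q" "q < D" using Rats_dense_in_real by blast
    have "b \<notin> coeffs_with_big_component n t q \<epsilon>" using k q by (force simp: coeffs_with_big_component_def)
    then show "b \<notin> coeffs_with_big_component n t 0 0 \<or> (\<exists>q\<in>\<rat>. b \<in> coeffs_with_big_component n t q 0 - coeffs_with_big_component n t q \<epsilon>)"
      using q(1) q0[of q] less_imp_le[OF q(3)] by blast
  next
    assume "b \<notin> coeffs_with_big_component n t 0 0 \<or> (\<exists>q\<in>\<rat>. b \<in> coeffs_with_big_component n t q 0 - coeffs_with_big_component n t q \<epsilon>)"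
    then obtain q where "q \<le> D" "b \<notin> coeffs_with_big_component n t q \<epsilon>" using n0 q0 by auto
    then have "b \<notin> coeffs_with_big_component n t D \<epsilon>" by (force simp: coeffs_with_big_component_def)
    then show "\<forall>V\<in>largest_components ?U. sph_area V < \<epsilon>" using big by simp
  qed
qed

lemma excursion_cut [simp]: "excursion n (cut n b) t = excursion n b t"
  by (simp add: excursion_def)

lemma sets_largest_components_small:
  assumes "\<epsilon> > 0" "kostlan_coeffs n M a"
  shows "{\<omega> \<in> space M. \<forall>V\<in>largest_components (excursion n (\<lambda>J. a J \<omega>) t). sph_area V < \<epsilon>} \<in> sets M"
proof -
  define S where "S = - coeffs_with_big_component n t 0 0 \<union> (\<Union>q\<in>\<rat>. coeffs_with_big_component n t q 0 - coeffs_with_big_component n t q \<epsilon>)"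
  have H: "coeffs_with_big_component n t q \<epsilon>' \<in> sets borel" for q \<epsilon>'
    by (intro borel_closed closed_coeffs_with_big_component)
  have "(\<Union>q\<in>\<rat>. coeffs_with_big_component n t q 0 - coeffs_with_big_component n t q \<epsilon>) \<in> sets borel"
    by (rule sets.countable_UN''[OF countable_rat]) (rule sets.Diff[OF H H])
  then have "S \<in> sets borel"
    unfolding S_def by (rule sets.Un[OF borel_comp[OF H]])
  moreover have "cut n b \<in> S \<longleftrightarrow> b \<in> S" for b
    by (simp add: S_def coeffs_with_big_component_def)
  moreover have "b \<in> S \<longleftrightarrow> (\<forall>V\<in>largest_components (excursion n b t). sph_area V < \<epsilon>)" for b
    unfolding all_largest_components_small_iff[OF assms(1)] by (auto simp: S_def)
  ultimately show ?thesis using sets_coeffs[OF assms(2), of S] by simp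
qed

section \<open>Nets on the sphere and on a grid of circles\<close>

definition arc :: "nat \<Rightarrow> nat \<Rightarrow> real set" where
  "arc m j = {2 * pi * real j / real m .. 2 * pi * (real j + 1) / real m}"

lemma arc_diff: "s \<in> arc m j \<Longrightarrow> t \<in> arc m j \<Longrightarrow> \<bar>s - t\<bar> \<le> 2 * pi / real m"
  by (auto simp: arc_def distrib_left add_divide_distrib)

lemma ex_arc:
  assumes t: "0 \<le> t" "t < 2 * pi" and m: "m > 0"
  shows "\<exists>j<m. t \<in> arc m j"
proof -
  define u where "u = t * real m / (2 * pi)"
  have u: "0 \<le> u" "u < real m" using t m by (simp_all add: u_def pos_divide_less_eq mult.commute)
  have t_eq: "t = 2 * pi * u / real m" using m by (simp add: u_def)
  have f: "real (nat \<lfloor>u\<rfloor>) \<le> u" "u \<le> real (nat \<lfloor>u\<rfloor>) + 1" using u by linarith+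
  have "nat \<lfloor>u\<rfloor> < m" using u by linarith
  moreover have "t \<in> arc m (nat \<lfloor>u\<rfloor>)"
    unfolding arc_def t_eq using f by (auto intro!: divide_right_mono mult_left_mono)
  ultimately show ?thesis by blast
qed

lemma abs_cos_diff_le: "\<bar>cos s - cos t\<bar> \<le> \<bar>s - t\<bar>" for s t :: real
proof -
  have "\<bar>cos s - cos t\<bar> = 2 * \<bar>sin ((s + t) / 2)\<bar> * \<bar>sin ((t - s) / 2)\<bar>"
    by (simp add: cos_diff_cos abs_mult)
  also have "\<dots> \<le> 2 * 1 * \<bar>(t - s) / 2\<bar>"
    by (intro mult_mono abs_sin_x_le_abs_x) auto
  finally show ?thesis by (simp add: abs_minus_commute)
qed

lemma abs_sin_diff_le: "\<bar>sin s - sin t\<bar> \<le> \<bar>s - t\<bar>" for s t :: real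
  using abs_cos_diff_le[of "pi/2 - s" "pi/2 - t"] by (simp add: cos_diff abs_minus_commute)

lemma polar_angle:
  fixes a b :: real
  obtains \<theta> where "0 \<le> \<theta>" "\<theta> < 2 * pi" "a = sqrt (a\<^sup>2 + b\<^sup>2) * cos \<theta>" "b = sqrt (a\<^sup>2 + b\<^sup>2) * sin \<theta>"
proof (cases "a = 0 \<and> b = 0")
  case True
  then show ?thesis using that[of 0] by simp
next
  case False
  define \<rho> where "\<rho> = sqrt (a\<^sup>2 + b\<^sup>2)"
  have \<rho>: "\<rho> > 0" "\<rho>\<^sup>2 = a\<^sup>2 + b\<^sup>2" using False unfolding \<rho>_def by (simp_all add: sum_power2_gt_zero_iff)
  have "(a / \<rho>)\<^sup>2 + (b / \<rho>)\<^sup>2 = 1"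
    using \<rho>(1) by (simp only: power_divide add_divide_distrib[symmetric] \<rho>(2)[symmetric]) simp
  then obtain \<theta> where "0 \<le> \<theta>" "\<theta> < 2 * pi" "a / \<rho> = cos \<theta>" "b / \<rho> = sin \<theta>"
    using sincos_total_2pi by metis
  then have "a = \<rho> * cos \<theta>" "b = \<rho> * sin \<theta>" "0 \<le> \<theta>" "\<theta> < 2 * pi"
    using \<rho>(1) by (simp_all add: nonzero_divide_eq_eq mult.commute)
  then show ?thesis using that[of \<theta>] unfolding \<rho>_def by blast
qed

lemma abs_mult_diff_le:
  fixes a b c d :: real
  assumes "\<bar>a\<bar> \<le> 1" "\<bar>d\<bar> \<le> 1"
  shows "\<bar>a * b - c * d\<bar> \<le> \<bar>a - c\<bar> + \<bar>b - d\<bar>"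
proof -
  have "a * b - c * d = a * (b - d) + (a - c) * d" by (simp add: algebra_simps)
  then have "\<bar>a * b - c * d\<bar> \<le> \<bar>a\<bar> * \<bar>b - d\<bar> + \<bar>a - c\<bar> * \<bar>d\<bar>"
    by (metis abs_mult abs_triangle_ineq)
  also have "\<dots> \<le> 1 * \<bar>b - d\<bar> + \<bar>a - c\<bar> * 1"
    using assms by (intro add_mono mult_right_mono mult_left_mono) auto
  finally show ?thesis by simp
qed

text \<open>With \<open>m\<close> arcs per full turn, the pieces of the sphere and of the circles below have diameter at most
\<open>12 * pi / m\<close>; this has to be less than the separation of the net.\<close>

lemma ex_mesh_size:
  assumes "n > 0"
  obtains m :: nat where "m > 0" "12 * pi / real m < 1 / (16 * sqrt (real n))" "real m \<le> 1001 * sqrt (real n)"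
proof -
  define m where "m = nat \<lceil>1000 * sqrt (real n)\<rceil>"
  have sn: "sqrt (real n) \<ge> 1" using assms by simp
  have m: "1000 * sqrt (real n) \<le> real m" "real m \<le> 1000 * sqrt (real n) + 1"
    using sn unfolding m_def by linarith+
  have m0: "real m > 0" using m sn by linarith
  have "12 * pi * (16 * sqrt (real n)) < 1000 * sqrt (real n)"
    using pi_less_4 sn by (simp add: mult_strict_right_mono)
  also have "\<dots> \<le> real m" by (rule m)
  finally have "12 * pi / real m < 1 / (16 * sqrt (real n))"
    using m0 sn by (simp add: pos_divide_less_eq pos_less_divide_eq mult.commute)
  then show ?thesis using that[of m] m m0 sn by simp
qed

text \<open>Addition in the index type is modulo \<open>3\<close>, which names the other two coordinates relative to any \<open>i\<close>.\<close>

lemma sum_three_rotate: "(\<Sum>i\<in>UNIV. f i) = f i + f (i + 1) + (f (i + 2) :: real)" for i :: 3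
proof -
  have "i = 1 \<or> i = 2 \<or> i = 3" by (rule exhaust_3)
  moreover have wrap: "(4 :: 3) = 1" "(5 :: 3) = 2" by simp_all
  ultimately show ?thesis by (auto simp: sum_3 wrap)
qed

lemma norm_le_three:
  fixes x :: "real^3"
  shows "norm x \<le> \<bar>x $ i\<bar> + \<bar>x $ (i + 1)\<bar> + \<bar>x $ (i + 2)\<bar>"
  using norm_le_l1_cart[of x] sum_three_rotate[of "\<lambda>i. \<bar>x $ i\<bar>" i] by simp

lemma S2_three: "x \<in> S2 \<Longrightarrow> (x $ i)\<^sup>2 + (x $ (i + 1))\<^sup>2 + (x $ (i + 2))\<^sup>2 = 1"
  using norm_sq_vec[of x] sum_three_rotate[of "\<lambda>i. (x $ i)\<^sup>2" i] by simp

text \<open>Spherical coordinates are Lipschitz, so a grid of \<open>m * m\<close> angles cuts the sphere into small pieces.\<close>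

lemma sphere_net:
  assumes n: "n > 0"
  shows "\<exists>P. finite P \<and> P \<subseteq> S2 \<and> real (card P) \<le> 1001\<^sup>2 * real n \<and>
     (\<forall>p\<in>P. \<forall>q\<in>P. p \<noteq> q \<longrightarrow> 1 / (16 * sqrt (real n)) \<le> norm (p - q)) \<and>
     (\<forall>x\<in>S2. \<exists>p\<in>P. norm (x - p) \<le> 1 / (16 * sqrt (real n)))"
proof -
  obtain m :: nat where m: "m > 0" "12 * pi / real m < 1 / (16 * sqrt (real n))" "real m \<le> 1001 * sqrt (real n)"
    using ex_mesh_size[OF n] by blast
  define A :: "nat \<times> nat \<Rightarrow> (real^3) set" where
    "A = (\<lambda>(j, k). {x. \<exists>\<theta>\<in>arc m j. \<exists>\<phi>\<in>arc m k. x $ 1 = sin \<phi> \<and>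
        x $ (1 + 1) = cos \<phi> * cos \<theta> \<and> x $ (1 + 2) = cos \<phi> * sin \<theta>})"
  have cover: "S2 \<subseteq> (\<Union>jk\<in>{..<m} \<times> {..<m}. A jk)"
  proof
    fix x :: "real^3" assume x: "x \<in> S2"
    define \<rho> where "\<rho> = sqrt ((x $ (1+1))\<^sup>2 + (x $ (1+2))\<^sup>2)"
    obtain \<theta> where \<theta>: "0 \<le> \<theta>" "\<theta> < 2 * pi" "x $ (1+1) = \<rho> * cos \<theta>" "x $ (1+2) = \<rho> * sin \<theta>"
      using polar_angle[of "x $ (1+1)" "x $ (1+2)"] unfolding \<rho>_def by blast
    have "\<rho>\<^sup>2 + (x $ 1)\<^sup>2 = 1" using S2_three[OF x, of 1] by (simp add: \<rho>_def)
    then obtain \<phi> where \<phi>: "0 \<le> \<phi>" "\<phi> < 2 * pi" "\<rho> = cos \<phi>" "x $ 1 = sin \<phi>"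
      using sincos_total_2pi by metis
    obtain j k where "j < m" "\<theta> \<in> arc m j" "k < m" "\<phi> \<in> arc m k"
      using ex_arc[OF \<theta>(1,2) m(1)] ex_arc[OF \<phi>(1,2) m(1)] by blast
    then have "x \<in> A (j, k)" "(j, k) \<in> {..<m} \<times> {..<m}"
      unfolding A_def using \<theta>(3,4) \<phi>(3,4) by auto
    then show "x \<in> (\<Union>jk\<in>{..<m} \<times> {..<m}. A jk)" by blast
  qed
  have diam: "norm (x - y) < 1 / (16 * sqrt (real n))" if x: "x \<in> A jk" and y: "y \<in> A jk" for x y jk
  proof -
    obtain j k where jk: "jk = (j, k)" by fastforce
    obtain \<theta> \<phi> where x': "\<theta> \<in> arc m j" "\<phi> \<in> arc m k" "x $ 1 = sin \<phi>"
        "x $ (1 + 1) = cos \<phi> * cos \<theta>" "x $ (1 + 2) = cos \<phi> * sin \<theta>"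
      using x unfolding A_def jk by auto
    obtain \<theta>' \<phi>' where y': "\<theta>' \<in> arc m j" "\<phi>' \<in> arc m k" "y $ 1 = sin \<phi>'"
        "y $ (1 + 1) = cos \<phi>' * cos \<theta>'" "y $ (1 + 2) = cos \<phi>' * sin \<theta>'"
      using y unfolding A_def jk by auto
    have d: "\<bar>\<theta> - \<theta>'\<bar> \<le> 2 * pi / real m" "\<bar>\<phi> - \<phi>'\<bar> \<le> 2 * pi / real m"
      using arc_diff x' y' by blast+
    have "\<bar>sin \<phi> - sin \<phi>'\<bar> \<le> 2 * pi / real m" using abs_sin_diff_le[of \<phi> \<phi>'] d by linarith
    moreover have "\<bar>cos \<phi> * cos \<theta> - cos \<phi>' * cos \<theta>'\<bar> \<le> 2 * (2 * pi / real m)"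
      using abs_mult_diff_le[of "cos \<phi>" "cos \<theta>'" "cos \<theta>" "cos \<phi>'"] abs_cos_diff_le[of \<phi> \<phi>'] abs_cos_diff_le[of \<theta> \<theta>'] d
      by simp
    moreover have "\<bar>cos \<phi> * sin \<theta> - cos \<phi>' * sin \<theta>'\<bar> \<le> 2 * (2 * pi / real m)"
      using abs_mult_diff_le[of "cos \<phi>" "sin \<theta>'" "sin \<theta>" "cos \<phi>'"] abs_cos_diff_le[of \<phi> \<phi>'] abs_sin_diff_le[of \<theta> \<theta>'] d
      by simp
    ultimately have "norm (x - y) \<le> 2 * pi / real m + 2 * (2 * pi / real m) + 2 * (2 * pi / real m)"
      using norm_le_three[of "x - y" 1] unfolding vector_minus_component x'(3-5) y'(3-5) by linarith
    also have "\<dots> \<le> 12 * pi / real m" by (simp add: divide_right_mono)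
    finally show ?thesis using m(2) by linarith
  qed
  obtain P where P: "finite P" "P \<subseteq> S2" "card P \<le> card ({..<m} \<times> {..<m})"
    "\<forall>p\<in>P. \<forall>q\<in>P. p \<noteq> q \<longrightarrow> 1 / (16 * sqrt (real n)) \<le> norm (p - q)"
    "\<forall>x\<in>S2. \<exists>p\<in>P. norm (x - p) \<le> 1 / (16 * sqrt (real n))"
    using exists_separated_net[OF _ cover, of "1 / (16 * sqrt (real n))"] diam by auto
  have "real (card P) \<le> real (card ({..<m} \<times> {..<m}))" using P(3) by (simp only: of_nat_le_iff)
  also have "\<dots> = (real m)\<^sup>2" by (simp add: power2_eq_square)
  also have "\<dots> \<le> (1001 * sqrt (real n))\<^sup>2" using m by (intro power_mono) auto
  also have "\<dots> = 1001\<^sup>2 * real n" by (simp add: power_mult_distrib)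
  finally show ?thesis using P by blast
qed

definition grid_circles :: "nat \<Rightarrow> (real^3) set" where
  "grid_circles L = {x \<in> S2. \<exists>i. \<exists>k::int. x $ i = real_of_int k / real L}"

text \<open>There are at most \<open>3 * (2 * L + 1)\<close> circles, each cut into \<open>m\<close> arcs; their number is of the order of \<open>sqrt n\<close>.\<close>

lemma circles_net:
  assumes n: "n > 0" and L: "L > 0"
  shows "\<exists>P. finite P \<and> P \<subseteq> grid_circles L \<and> real (card P) \<le> 3 * (2 * real L + 1) * 1001 * sqrt (real n) \<and>
     (\<forall>p\<in>P. \<forall>q\<in>P. p \<noteq> q \<longrightarrow> 1 / (16 * sqrt (real n)) \<le> norm (p - q)) \<and>
     (\<forall>x\<in>grid_circles L. \<exists>p\<in>P. norm (x - p) \<le> 1 / (16 * sqrt (real n)))"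
proof -
  obtain m :: nat where m: "m > 0" "12 * pi / real m < 1 / (16 * sqrt (real n))" "real m \<le> 1001 * sqrt (real n)"
    using ex_mesh_size[OF n] by blast
  define \<rho> where "\<rho> k = sqrt (1 - (real_of_int k / real L)\<^sup>2)" for k
  define A :: "3 \<times> int \<times> nat \<Rightarrow> (real^3) set" where
    "A = (\<lambda>(i, k, j). {x. x $ i = real_of_int k / real L \<and>
        (\<exists>\<theta>\<in>arc m j. x $ (i + 1) = \<rho> k * cos \<theta> \<and> x $ (i + 2) = \<rho> k * sin \<theta>)})"
  define I where "I = (UNIV :: 3 set) \<times> {- int L..int L} \<times> {..<m}"
  have bound: "\<bar>k\<bar> \<le> int L" if "x \<in> S2" "x $ i = real_of_int k / real L" for x i k
  proof -
    have "\<bar>x $ i\<bar> \<le> 1" using component_le_norm_cart[of x i] that(1) by simp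
    then have "\<bar>real_of_int k\<bar> \<le> real L" using L unfolding that(2) by (simp add: abs_divide pos_divide_le_eq)
    then show ?thesis by linarith
  qed
  have cover: "grid_circles L \<subseteq> (\<Union>p\<in>I. A p)"
  proof
    fix x assume "x \<in> grid_circles L"
    then obtain i k where x: "x \<in> S2" "x $ i = real_of_int k / real L" by (auto simp: grid_circles_def)
    have "(x $ (i+1))\<^sup>2 + (x $ (i+2))\<^sup>2 = 1 - (x $ i)\<^sup>2" using S2_three[OF x(1), of i] by simp
    then have "sqrt ((x $ (i+1))\<^sup>2 + (x $ (i+2))\<^sup>2) = \<rho> k" by (simp add: \<rho>_def x(2))
    then obtain \<theta> where \<theta>: "0 \<le> \<theta>" "\<theta> < 2 * pi" "x $ (i+1) = \<rho> k * cos \<theta>" "x $ (i+2) = \<rho> k * sin \<theta>"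
      using polar_angle[of "x $ (i+1)" "x $ (i+2)"] by metis
    obtain j where j: "j < m" "\<theta> \<in> arc m j" using ex_arc[OF \<theta>(1,2) m(1)] by blast
    have "x \<in> A (i, k, j)" using x(2) \<theta>(3,4) j(2) by (auto simp: A_def)
    moreover have "(i, k, j) \<in> I" using bound[OF x] j(1) by (auto simp: I_def)
    ultimately show "x \<in> (\<Union>p\<in>I. A p)" by blast
  qed
  have diam: "norm (x - y) < 1 / (16 * sqrt (real n))" if p: "p \<in> I" and x: "x \<in> A p" and y: "y \<in> A p" for x y p
  proof -
    obtain i k j where ikj: "p = (i, k, j)" by (metis prod_cases3)
    have \<rho>: "\<bar>\<rho> k\<bar> \<le> 1"
    proof -
      have "\<bar>k\<bar> \<le> int L" using p by (auto simp: I_def ikj)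
      then have "\<bar>real_of_int k / real L\<bar> \<le> 1" using L by (simp add: abs_divide divide_le_eq_1)
      then have "(real_of_int k / real L)\<^sup>2 \<le> 1" by (simp add: abs_square_le_1)
      then show ?thesis by (simp add: \<rho>_def)
    qed
    obtain \<theta> where x': "\<theta> \<in> arc m j" "x $ i = real_of_int k / real L" "x $ (i + 1) = \<rho> k * cos \<theta>" "x $ (i + 2) = \<rho> k * sin \<theta>"
      using x unfolding A_def ikj by auto
    obtain \<theta>' where y': "\<theta>' \<in> arc m j" "y $ i = real_of_int k / real L" "y $ (i + 1) = \<rho> k * cos \<theta>'" "y $ (i + 2) = \<rho> k * sin \<theta>'"
      using y unfolding A_def ikj by auto
    have d: "\<bar>\<theta> - \<theta>'\<bar> \<le> 2 * pi / real m"
      using arc_diff x' y' by blast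
    have "\<bar>\<rho> k * cos \<theta> - \<rho> k * cos \<theta>'\<bar> \<le> 2 * pi / real m"
      using abs_mult_diff_le[OF \<rho>, of "cos \<theta>'" "cos \<theta>" "\<rho> k"] abs_cos_diff_le[of \<theta> \<theta>'] d by simp
    moreover have "\<bar>\<rho> k * sin \<theta> - \<rho> k * sin \<theta>'\<bar> \<le> 2 * pi / real m"
      using abs_mult_diff_le[OF \<rho>, of "sin \<theta>'" "sin \<theta>" "\<rho> k"] abs_sin_diff_le[of \<theta> \<theta>'] d by simp
    ultimately have "norm (x - y) \<le> 2 * pi / real m + 2 * pi / real m"
      using norm_le_three[of "x - y" i] unfolding vector_minus_component x'(2-4) y'(2-4) by simp
    also have "\<dots> \<le> 12 * pi / real m" by (simp add: divide_right_mono)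
    finally show ?thesis using m(2) by linarith
  qed
  have "finite I" by (simp add: I_def)
  obtain P where P: "finite P" "P \<subseteq> grid_circles L" "card P \<le> card I"
    "\<forall>p\<in>P. \<forall>q\<in>P. p \<noteq> q \<longrightarrow> 1 / (16 * sqrt (real n)) \<le> norm (p - q)"
    "\<forall>x\<in>grid_circles L. \<exists>p\<in>P. norm (x - p) \<le> 1 / (16 * sqrt (real n))"
    using exists_separated_net[OF \<open>finite I\<close> cover, of "1 / (16 * sqrt (real n))"] diam by auto
  have "real (card P) \<le> real (card I)" using P(3) by (simp only: of_nat_le_iff)
  also have "\<dots> = 3 * (2 * real L + 1) * real m"
    by (simp add: I_def card_cartesian_product nat_add_distrib distrib_left distrib_right)
  also have "\<dots> \<le> 3 * (2 * real L + 1) * (1001 * sqrt (real n))"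
    by (rule mult_left_mono[OF m(3)]) simp
  finally have "real (card P) \<le> 3 * (2 * real L + 1) * 1001 * sqrt (real n)" by (simp only: mult.assoc)
  then show ?thesis using P by blast
qed

section \<open>Components that avoid the grid of circles\<close>

text \<open>The cone over a set of diameter \<open>\<eta>\<close> stays close to one radius, and is covered by about \<open>1 / \<eta>\<close> balls of
radius \<open>2 * \<eta>\<close> along it.\<close>

lemma sph_area_le:
  assumes A: "A \<subseteq> S2" and d: "\<And>x y. x \<in> A \<Longrightarrow> y \<in> A \<Longrightarrow> norm (x - y) \<le> \<eta>"
    and \<eta>: "0 < \<eta>" "\<eta> \<le> 1"
  shows "sph_area A \<le> 64 * pi * \<eta>\<^sup>2"
proof (cases "A = {}")
  case True
  then have "solid_cone A = {}" by (simp add: solid_cone_def)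
  then show ?thesis by (simp add: sph_area_eq)
next
  case False
  then obtain x0 where x0: "x0 \<in> A" by blast
  define N where "N = nat \<lfloor>1 / \<eta>\<rfloor>"
  have N: "real N \<le> 1 / \<eta>" using \<eta> unfolding N_def by simp
  define c where "c j = (real j * \<eta>) *\<^sub>R x0" for j
  have "solid_cone A \<subseteq> (\<Union>j\<le>N. cball (c j) (2 * \<eta>))"
  proof
    fix z assume "z \<in> solid_cone A"
    then obtain r x where z: "z = r *\<^sub>R x" "0 \<le> r" "r \<le> 1" "x \<in> A" by (auto simp: solid_cone_def)
    define j where "j = nat \<lfloor>r / \<eta>\<rfloor>"
    have rj: "real j \<le> r / \<eta>" "r / \<eta> \<le> real j + 1" using z \<eta> unfolding j_def by (simp, linarith)
    have j1: "real j * \<eta> \<le> r" "r \<le> real j * \<eta> + \<eta>"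
      using rj \<eta> by (simp_all add: pos_le_divide_eq pos_divide_le_eq distrib_right)
    have "r / \<eta> \<le> 1 / \<eta>" using z \<eta> by (simp add: divide_right_mono)
    then have "j \<le> N" unfolding j_def N_def by (intro nat_mono floor_mono)
    moreover have "z \<in> cball (c j) (2 * \<eta>)"
    proof -
      have "z - c j = (r - real j * \<eta>) *\<^sub>R x + (real j * \<eta>) *\<^sub>R (x - x0)"
        by (simp add: z c_def algebra_simps)
      then have "norm (z - c j) \<le> norm ((r - real j * \<eta>) *\<^sub>R x) + norm ((real j * \<eta>) *\<^sub>R (x - x0))"
        by (metis norm_triangle_ineq)
      also have "\<dots> = \<bar>r - real j * \<eta>\<bar> + (real j * \<eta>) * norm (x - x0)"
        using z(4) A \<eta> by (auto simp: subset_iff)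
      also have "\<dots> \<le> \<eta> + 1 * \<eta>"
        using j1 z d[OF z(4) x0] \<eta> by (intro add_mono mult_mono) auto
      finally show ?thesis by (simp add: dist_norm norm_minus_commute)
    qed
    ultimately show "z \<in> (\<Union>j\<le>N. cball (c j) (2 * \<eta>))" by blast
  qed
  moreover have U: "(\<Union>j\<le>N. cball (c j) (2 * \<eta>)) \<in> lmeasurable" by (intro fmeasurable.finite_UN) auto
  ultimately have "measure lebesgue (solid_cone A) \<le> measure lebesgue (\<Union>j\<le>N. cball (c j) (2 * \<eta>))"
    unfolding measure_def by (intro enn2real_mono emeasure_mono) (auto simp: fmeasurable_def)
  also have "\<dots> \<le> (\<Sum>j\<le>N. measure lebesgue (cball (c j) (2 * \<eta>)))"
    by (rule measure_UNION_le) auto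
  also have "\<dots> = (real N + 1) * (4 / 3 * pi * (2 * \<eta>) ^ 3)"
  proof -
    have "measure lebesgue (cball (c j) (2 * \<eta>)) = 4 / 3 * pi * (2 * \<eta>) ^ 3" for j
      using content_cball[of "2 * \<eta>" "c j"] \<eta> by (simp add: measure_completion unit_ball_vol_3)
    then show ?thesis by (simp only: sum_constant card_atMost) simp
  qed
  also have "\<dots> \<le> (1 / \<eta> + 1) * (4 / 3 * pi * (2 * \<eta>) ^ 3)"
    using N \<eta> by (intro mult_right_mono add_mono) auto
  also have "\<dots> = 32 / 3 * pi * (\<eta>\<^sup>2 + \<eta> * \<eta>\<^sup>2)"
    using \<eta> by (simp add: power2_eq_square power3_eq_cube field_simps)
  also have "\<dots> \<le> 32 / 3 * pi * (\<eta>\<^sup>2 + 1 * \<eta>\<^sup>2)"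
    using \<eta> by (intro mult_left_mono add_mono mult_right_mono) auto
  finally show ?thesis by (simp add: sph_area_eq)
qed

text \<open>By the intermediate value theorem each coordinate stays between two consecutive multiples of \<open>1 / L\<close>.\<close>

lemma connected_off_circles_small:
  assumes V: "connected V" "V \<subseteq> S2" "V \<inter> grid_circles L = {}" and L: "L > 0"
    and x: "x \<in> V" and y: "y \<in> V"
  shows "norm (x - y) \<le> 3 / real L"
proof -
  have *: "\<lfloor>v $ i * real L\<rfloor> \<le> \<lfloor>w $ i * real L\<rfloor>" if v: "v \<in> V" and w: "w \<in> V" for v w i
  proof (rule ccontr)
    assume n: "\<not> ?thesis"
    define k where "k = \<lfloor>v $ i * real L\<rfloor>"
    have "w $ i * real L \<le> real_of_int k" "real_of_int k \<le> v $ i * real L" using n unfolding k_def by linarith+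
    then have "w $ i \<le> real_of_int k / real L" "real_of_int k / real L \<le> v $ i"
      using L by (simp_all add: pos_le_divide_eq pos_divide_le_eq)
    then obtain z where "z \<in> V" "z $ i = real_of_int k / real L"
      using connected_ivt_component_cart[OF V(1) w v] by blast
    then have "z \<in> V \<inter> grid_circles L" using V(2) by (auto simp: grid_circles_def)
    then show False using V(3) by blast
  qed
  have "\<bar>(x - y) $ i\<bar> \<le> 1 / real L" for i
  proof -
    have "\<lfloor>x $ i * real L\<rfloor> = \<lfloor>y $ i * real L\<rfloor>" using *[OF x y, of i] *[OF y x, of i] by simp
    then have "\<bar>x $ i * real L - y $ i * real L\<bar> \<le> 1" by linarith
    then have "\<bar>(x - y) $ i\<bar> * real L \<le> 1" using L by (simp add: abs_mult left_diff_distrib[symmetric])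
    then show ?thesis using L by (simp add: pos_le_divide_eq)
  qed
  then have "norm (x - y) \<le> (\<Sum>i\<in>(UNIV::3 set). 1 / real L)"
    by (intro order_trans[OF norm_le_l1_cart sum_mono])
  then show ?thesis by simp
qed

lemma largest_components_S2_iff:
  assumes U: "compact U" "U \<subseteq> S2"
  shows "(\<forall>V\<in>largest_components U. V = S2) \<longleftrightarrow> U = S2"
proof
  assume all: "\<forall>V\<in>largest_components U. V = S2"
  obtain V where V: "V \<in> largest_components U" using largest_components_nonempty[OF U] by blast
  have "V \<subseteq> U" using V in_components_subset by (auto simp: largest_components_def split: if_splits)
  then show "U = S2" using all V U by auto
next
  assume "U = S2"
  have "connected (S2)" by (rule connected_sphere) simp
  then have "components S2 = {S2}" by (intro components_eq_sing_iff[THEN iffD2]) (auto intro!: exI[of _ "axis 1 1"])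
  then show "\<forall>V\<in>largest_components U. V = S2"
    using \<open>U = S2\<close> by (auto simp: largest_components_def split: if_splits)
qed

theorem proposition7p1:
  fixes t \<epsilon> :: real
  assumes "\<epsilon> > 0"
  shows "\<exists>c>0. \<forall>(n::nat) (M :: 'w measure) (a :: nat^3 \<Rightarrow> 'w \<Rightarrow> real).
           n > 0 \<longrightarrow> even n \<longrightarrow> kostlan_coeffs n M a \<longrightarrow>
             \<P>(\<omega> in M. \<forall>V \<in> largest_components (excursion n (\<lambda>J. a J \<omega>) t). V = S2)
               \<ge> exp (- c * real n) \<and>
             \<P>(\<omega> in M. \<forall>V \<in> largest_components (excursion n (\<lambda>J. a J \<omega>) t). sph_area V < \<epsilon>)
               \<ge> exp (- c * sqrt (real n))"
proof -
  define C where "C = 2 * grid_const ^ 3"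
  \<comment> \<open>The constants of the shift estimate depend on \<open>t\<close> only through the level \<open>\<tau>\<close>, which exceeds both \<open>t\<close> and \<open>- t\<close>.\<close>
  define \<tau> where "\<tau> = \<bar>t\<bar> + 1"
  define s where "s = 2 * (ball_level C + \<tau>)"
  define K where "K = 8 + ball_level C * s + s\<^sup>2 * C / 2"
  have C: "C > 0" using grid_const_pos by (simp add: C_def)
  have "ball_level C \<ge> 0" using C by (simp add: ball_level_def)
  then have "s \<ge> 0" by (simp add: s_def \<tau>_def)
  have K: "K > 0"
    using \<open>ball_level C \<ge> 0\<close> \<open>s \<ge> 0\<close> C unfolding K_def by (intro add_pos_nonneg) auto
  \<comment> \<open>Cells have diameter at most \<open>3 / L\<close>, hence area at most \<open>64 * pi * (3 / L)\<^sup>2 = 576 * pi / L\<^sup>2\<close>.\<close>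
  obtain L :: nat where L: "real L > max 3 (576 * pi / \<epsilon>)" using reals_Archimedean2 by blast
  then have L3: "real L > 3" and "576 * pi / \<epsilon> < real L" by auto
  then have L\<epsilon>: "576 * pi < \<epsilon> * real L" using assms by (simp add: pos_divide_less_eq mult.commute)
  define c where "c = K * (1001\<^sup>2 + 3 * (2 * real L + 1) * 1001)"
  have c0: "c > 0" unfolding c_def using K by (intro mult_pos_pos) auto
  have c1: "K * 1001\<^sup>2 \<le> c" and c2: "K * (3 * (2 * real L + 1) * 1001) \<le> c"
    unfolding c_def using K by (auto intro!: mult_left_mono)
  have "exp (- c * real n) \<le> \<P>(\<omega> in M. \<forall>V \<in> largest_components (excursion n (\<lambda>J. a J \<omega>) t). V = S2) \<and>
        exp (- c * sqrt (real n)) \<le> \<P>(\<omega> in M. \<forall>V \<in> largest_components (excursion n (\<lambda>J. a J \<omega>) t). sph_area V < \<epsilon>)"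
    if n: "n > 0" "even n" and kc: "kostlan_coeffs n M a" for n and M :: "'w measure" and a
  proof
    interpret prob_space M using kc by (simp add: kostlan_coeffs_def)
    have beyond: "exp (- K * real (card P)) \<le> prob {\<omega> \<in> space M. \<forall>x\<in>E. \<tau> \<le> \<sigma> * kostlan n (\<lambda>J. a J \<omega>) x}"
      if "finite P" "P \<subseteq> E" "E \<subseteq> S2" "\<bar>\<sigma>\<bar> = 1"
        "\<forall>p\<in>P. \<forall>q\<in>P. p \<noteq> q \<longrightarrow> 1 / (16 * sqrt (real n)) \<le> norm (p - q)"
        "\<forall>x\<in>E. \<exists>p\<in>P. norm (x - p) \<le> 1 / (16 * sqrt (real n))" for P E \<sigma>
    proof -
      have "exp (- (8 + ball_level C * s + s\<^sup>2 * C / 2) * real (card P))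
        \<le> prob {\<omega> \<in> space M. \<forall>x\<in>E. \<tau> \<le> \<sigma> * kostlan n (\<lambda>J. a J \<omega>) x}"
        unfolding s_def
      proof (rule prob_kostlan_beyond_ge[OF kc n that(1,2,3) C])
        show "crowding n P p \<le> C" for p
          unfolding C_def using that by (intro crowding_le n) auto
      qed (use that in \<open>auto simp: \<tau>_def\<close>)
      then show ?thesis by (simp only: K_def)
    qed
    show "exp (- c * real n) \<le> \<P>(\<omega> in M. \<forall>V \<in> largest_components (excursion n (\<lambda>J. a J \<omega>) t). V = S2)"
    proof -
      obtain P where P: "finite P" "P \<subseteq> S2" "real (card P) \<le> 1001\<^sup>2 * real n"
        "\<forall>p\<in>P. \<forall>q\<in>P. p \<noteq> q \<longrightarrow> 1 / (16 * sqrt (real n)) \<le> norm (p - q)"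
        "\<forall>x\<in>S2. \<exists>p\<in>P. norm (x - p) \<le> 1 / (16 * sqrt (real n))"
        using sphere_net[OF n(1)] by blast
      have ev: "{\<omega> \<in> space M. \<forall>V \<in> largest_components (excursion n (\<lambda>J. a J \<omega>) t). V = S2}
          = {\<omega> \<in> space M. (\<lambda>J. a J \<omega>) \<in> {b. \<forall>x\<in>S2. - t \<le> (- 1) * kostlan n b x}}"
        by (subst largest_components_S2_iff[OF compact_excursion]) (auto simp: excursion_def)
      have "K * real (card P) \<le> K * (1001\<^sup>2 * real n)" using P(3) K by (intro mult_left_mono) auto
      also have "\<dots> \<le> c * real n" using mult_right_mono[OF c1, of "real n"] by (simp add: mult.assoc)
      finally have "exp (- c * real n) \<le> exp (- K * real (card P))" by simp
      also have "\<dots> \<le> prob {\<omega> \<in> space M. \<forall>x\<in>S2. \<tau> \<le> (- 1) * kostlan n (\<lambda>J. a J \<omega>) x}"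
        using P by (intro beyond) auto
      also have "\<dots> \<le> \<P>(\<omega> in M. \<forall>V \<in> largest_components (excursion n (\<lambda>J. a J \<omega>) t). V = S2)"
      proof (rule finite_measure_mono)
        show "{\<omega> \<in> space M. \<forall>x\<in>S2. \<tau> \<le> (- 1) * kostlan n (\<lambda>J. a J \<omega>) x}
          \<subseteq> {\<omega> \<in> space M. \<forall>V \<in> largest_components (excursion n (\<lambda>J. a J \<omega>) t). V = S2}"
          unfolding ev by (fastforce simp: \<tau>_def)
        show "{\<omega> \<in> space M. \<forall>V \<in> largest_components (excursion n (\<lambda>J. a J \<omega>) t). V = S2} \<in> events"
          unfolding ev by (intro sets_coeffs[OF kc] borel_closed closed_kostlan_ge) simp
      qed
      finally show ?thesis .
    qed
    show "exp (- c * sqrt (real n)) \<le> \<P>(\<omega> in M. \<forall>V \<in> largest_components (excursion n (\<lambda>J. a J \<omega>) t). sph_area V < \<epsilon>)"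
    proof -
      have L0: "L > 0" using L3 by (cases L) auto
      obtain P where P: "finite P" "P \<subseteq> grid_circles L" "real (card P) \<le> 3 * (2 * real L + 1) * 1001 * sqrt (real n)"
        "\<forall>p\<in>P. \<forall>q\<in>P. p \<noteq> q \<longrightarrow> 1 / (16 * sqrt (real n)) \<le> norm (p - q)"
        "\<forall>x\<in>grid_circles L. \<exists>p\<in>P. norm (x - p) \<le> 1 / (16 * sqrt (real n))"
        using circles_net[OF n(1) L0] by blast
      have "K * real (card P) \<le> K * (3 * (2 * real L + 1) * 1001 * sqrt (real n))"
        using P(3) K by (intro mult_left_mono) auto
      also have "\<dots> \<le> c * sqrt (real n)"
        using mult_right_mono[OF c2, of "sqrt (real n)"] by (simp add: mult.assoc)
      finally have "exp (- c * sqrt (real n)) \<le> exp (- K * real (card P))" by simp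
      also have "\<dots> \<le> prob {\<omega> \<in> space M. \<forall>x\<in>grid_circles L. \<tau> \<le> 1 * kostlan n (\<lambda>J. a J \<omega>) x}"
        using P by (intro beyond) (auto simp: grid_circles_def)
      also have "\<dots> \<le> \<P>(\<omega> in M. \<forall>V \<in> largest_components (excursion n (\<lambda>J. a J \<omega>) t). sph_area V < \<epsilon>)"
      proof (rule finite_measure_mono)
        show "{\<omega> \<in> space M. \<forall>V \<in> largest_components (excursion n (\<lambda>J. a J \<omega>) t). sph_area V < \<epsilon>} \<in> events"
          by (rule sets_largest_components_small[OF assms kc])
        show "{\<omega> \<in> space M. \<forall>x\<in>grid_circles L. \<tau> \<le> 1 * kostlan n (\<lambda>J. a J \<omega>) x}
          \<subseteq> {\<omega> \<in> space M. \<forall>V \<in> largest_components (excursion n (\<lambda>J. a J \<omega>) t). sph_area V < \<epsilon>}"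
        proof safe
          fix \<omega> V
          assume high: "\<forall>x\<in>grid_circles L. \<tau> \<le> 1 * kostlan n (\<lambda>J. a J \<omega>) x"
            and V: "V \<in> largest_components (excursion n (\<lambda>J. a J \<omega>) t)"
          have "V = {} \<or> V \<in> components (excursion n (\<lambda>J. a J \<omega>) t)"
            using V by (simp add: largest_components_def split: if_splits)
          then have Vc: "connected V" "V \<subseteq> excursion n (\<lambda>J. a J \<omega>) t"
            using in_components_connected[of V] in_components_subset[of V] by auto
          have VS: "V \<subseteq> S2" using Vc(2) by (auto simp: excursion_def)
          have off: "V \<inter> grid_circles L = {}"
            using high Vc(2) by (fastforce simp: excursion_def \<tau>_def)
          have "sph_area V \<le> 64 * pi * (3 / real L)\<^sup>2"
            using connected_off_circles_small[OF Vc(1) VS off L0] L3 by (intro sph_area_le[OF VS]) auto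
          also have "\<dots> = 576 * pi / real L / real L" by (simp add: power2_eq_square)
          also have "\<dots> \<le> 576 * pi / real L"
            using L3 divide_left_mono[of 1 "real L" "576 * pi / real L"] by simp
          also have "\<dots> < \<epsilon>" using L\<epsilon> L3 by (simp add: pos_divide_less_eq)
          finally show "sph_area V < \<epsilon>" .
        qed
      qed
      finally show ?thesis .
    qed
  qed
  then show ?thesis using c0 by blast
qed

end
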